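(* Let $X$ be a normal pseudomanifold of dimension at least $1$. Then the following are equivalent: (i) $X$ is a $1$-shelled ball; (ii) $X$ is a $1$-stacked (triangulated) ball; (iii) $X$ is a $1$-stacked $R$-homology ball for some commutative ring $R$; (iv) the dual graph $\Lambda(X)$ is a tree.
   Context: Simplicial complexes are finite and contain the empty set as a face. For a finite set $\alpha$, $\overline{\alpha}$ is the complex of all subsets of $\alpha$, $\partial\alpha$ the complex of all proper subsets, and $\dim(\alpha)=\#(\alpha)-1$; $\ast$ denotes join. The standard ball $B^d_{d+1}$ is the face complex of a $d$-simplex. A weak pseudomanifold is a pure $d$-dimensional complex $X$ in which each $(d-1)$-face lies in at most two facets. Its boundary $\partial X$ is the pure subcomplex whose facets are the $(d-1)$-faces lying in exactly one facet. Its dual graph $\Lambda(X)$ has the facets of $X$ as vertices, two being adjacent if they intersect in a face of codimension one. $X$ is a pseudomanifold if $\Lambda(X)$ is connected. $X$ is a normal pseudomanifold if each face of dimension $\le d-2$ (including the empty face, whose link is $X$) has a connected link. Shelling moves: for pure $d$-dimensional complexes $X,Y$, $X$ is obtained from $Y$ by the shelling move $\alpha\leadsto\beta$ if $\alpha$ and $\beta\ne\emptyset$ are disjoint faces of $X$ such that $Y\subseteq X$, $\alpha\sqcup\beta$ is the only facet of $X$ which is not a facet of $Y$, and the induced subcomplex of $Y$ on $\alpha\sqcup\beta$ is $\overline{\alpha}\ast\partial\beta$. Its index is $\dim(\beta)$. For $0\le k\le d$, a $d$-dimensional pseudomanifold is a $k$-shelled ball if it is obtained from $B^d_{d+1}$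 by a finite (possibly empty) sequence of shelling moves each of index $<k$. Rings are commutative with $1\neq 0$. An $R$-homology $d$-sphere is a $d$-dimensional complex in which the link of every face $\sigma$ (including $\emptyset$) has the reduced homology with coefficients in $R$ of a $(d-\dim(\sigma)-1)$-sphere. An $R$-homology $d$-ball is a $d$-dimensional complex with vanishing reduced $R$-homology in which the link of every non-empty face $\sigma$ has the reduced $R$-homology of a $(d-\dim(\sigma)-1)$-sphere or of a point, and whose faces with $R$-acyclic link form an $R$-homology $(d-1)$-sphere (its boundary). A triangulated ball is a complex whose geometric realization is homeomorphic to a ball. A ($R$-homology or triangulated) $d$-ball is $k$-stacked if all its faces of codimension at least $k+1$ lie in its boundary. *)

theory Defs
  imports
    "HOL-Homology.Homology"
    "HOL-Algebra.Module"
    "HOL-Algebra.AbelCoset"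
    "Graph_Theory.Graph_Theory"
begin

section \<open>Simplicial complexes\<close>

text \<open>Dimensions are integers: the empty face has dimension \<open>-1\<close>.\<close>

definition fdim :: "'a set \<Rightarrow> int" where
  "fdim \<sigma> = int (card \<sigma>) - 1"

definition simplicial_complex :: "'a set set \<Rightarrow> bool" where
  "simplicial_complex X \<longleftrightarrow>
     finite X \<and> {} \<in> X \<and> (\<forall>\<sigma>\<in>X. finite \<sigma> \<and> (\<forall>\<tau>. \<tau> \<subseteq> \<sigma> \<longrightarrow> \<tau> \<in> X))"

definition cdim :: "'a set set \<Rightarrow> int" where
  "cdim X = Max (fdim ` X)"

definition facets :: "'a set set \<Rightarrow> 'a set set" where
  "facets X = {\<phi> \<in> X. \<forall>\<sigma>\<in>X. \<phi> \<subseteq> \<sigma> \<longrightarrow> \<sigma> = \<phi>}"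

definition pure_complex :: "int \<Rightarrow> 'a set set \<Rightarrow> bool" where
  "pure_complex d X \<longleftrightarrow> simplicial_complex X \<and> (\<forall>\<phi>\<in>facets X. fdim \<phi> = d)"

definition link :: "'a set set \<Rightarrow> 'a set \<Rightarrow> 'a set set" where
  "link X \<sigma> = {\<tau>. \<tau> \<inter> \<sigma> = {} \<and> \<tau> \<union> \<sigma> \<in> X}"

definition simplex_closure :: "'a set \<Rightarrow> 'a set set" where
  "simplex_closure \<alpha> = Pow \<alpha>"

definition simplex_boundary :: "'a set \<Rightarrow> 'a set set" where
  "simplex_boundary \<alpha> = {\<tau>. \<tau> \<subset> \<alpha>}"

definition cjoin :: "'a set set \<Rightarrow> 'a set set \<Rightarrow> 'a set set" where
  "cjoin X Y = {\<sigma> \<union> \<tau> | \<sigma> \<tau>. \<sigma> \<in> X \<and> \<tau> \<in> Y}"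

definition induced_subcomplex :: "'a set set \<Rightarrow> 'a set \<Rightarrow> 'a set set" where
  "induced_subcomplex X V = {\<sigma> \<in> X. \<sigma> \<subseteq> V}"

text \<open>Points are given by barycentric coordinates. Since complexes are finite, the product
  topology induces the usual topology of the realization.\<close>

definition geometric_realization :: "'a set set \<Rightarrow> ('a \<Rightarrow> real) topology" where
  "geometric_realization X = subtopology (powertop_real UNIV)
     {x. (\<forall>v. 0 \<le> x v) \<and> {v. x v \<noteq> 0} \<in> X \<and> (\<Sum>v | x v \<noteq> 0. x v) = 1}"


section \<open>Pseudomanifolds\<close>

definition weak_pseudomanifold :: "int \<Rightarrow> 'a set set \<Rightarrow> bool" where
  "weak_pseudomanifold d X \<longleftrightarrow> pure_complex d X \<and>
     (\<forall>\<rho>\<in>X. fdim \<rho> = d - 1 \<longrightarrow> card {\<phi> \<in> facets X. \<rho> \<subseteq> \<phi>} \<le> 2)"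

definition pm_boundary :: "int \<Rightarrow> 'a set set \<Rightarrow> 'a set set" where
  "pm_boundary d X =
     {\<tau>. \<exists>\<rho>\<in>X. fdim \<rho> = d - 1 \<and> card {\<phi> \<in> facets X. \<rho> \<subseteq> \<phi>} = 1 \<and> \<tau> \<subseteq> \<rho>}"

text \<open>As usual in \<open>Graph_Theory\<close>, the undirected graph is a symmetric digraph.\<close>

definition dual_graph :: "int \<Rightarrow> 'a set set \<Rightarrow> 'a set pair_pre_digraph" where
  "dual_graph d X =
     \<lparr>pverts = facets X,
      parcs = {(\<phi>, \<psi>). \<phi> \<in> facets X \<and> \<psi> \<in> facets X \<and> \<phi> \<noteq> \<psi> \<and> fdim (\<phi> \<inter> \<psi>) = d - 1}\<rparr>"

text \<open>In a symmetric digraph the closed walk \<open>u, v, u\<close> is a \<open>cycle\<close>, so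
  \<open>Digraph_Component.tree\<close> is not the notion of a tree for undirected graphs. The cycles of the
  underlying simple graph are exactly the cycles of length at least 3.\<close>

definition undirected_tree :: "('v, 'e) pre_digraph \<Rightarrow> bool" where
  "undirected_tree G \<longleftrightarrow> Digraph_Component.connected G \<and>
     \<not> (\<exists>p. pre_digraph.cycle G p \<and> 3 \<le> length p)"

definition pseudomanifold :: "int \<Rightarrow> 'a set set \<Rightarrow> bool" where
  "pseudomanifold d X \<longleftrightarrow>
     weak_pseudomanifold d X \<and> Digraph_Component.connected (with_proj (dual_graph d X))"

definition normal_pseudomanifold :: "int \<Rightarrow> 'a set set \<Rightarrow> bool" where
  "normal_pseudomanifold d X \<longleftrightarrow> weak_pseudomanifold d X \<and>
     (\<forall>\<sigma>\<in>X. fdim \<sigma> \<le> d - 2 \<longrightarrow> connected_space (geometric_realization (link X \<sigma>)))"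


section \<open>Shelled balls\<close>

text \<open>\<open>shelling_move d Y \<alpha> \<beta> X\<close>: \<open>X\<close> is obtained from \<open>Y\<close> by the move \<open>\<alpha> \<leadsto> \<beta>\<close>.\<close>

definition shelling_move ::
    "int \<Rightarrow> 'a set set \<Rightarrow> 'a set \<Rightarrow> 'a set \<Rightarrow> 'a set set \<Rightarrow> bool" where
  "shelling_move d Y \<alpha> \<beta> X \<longleftrightarrow>
     pure_complex d Y \<and> pure_complex d X \<and>
     \<alpha> \<in> X \<and> \<beta> \<in> X \<and> \<beta> \<noteq> {} \<and> \<alpha> \<inter> \<beta> = {} \<and> Y \<subseteq> X \<and>
     facets X - facets Y = {\<alpha> \<union> \<beta>} \<and>
     induced_subcomplex Y (\<alpha> \<union> \<beta>) = cjoin (simplex_closure \<alpha>) (simplex_boundary \<beta>)"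

inductive obtained_by_shelling :: "int \<Rightarrow> int \<Rightarrow> 'a set set \<Rightarrow> bool" for d k where
  standard_ball:
    "finite \<sigma> \<Longrightarrow> fdim \<sigma> = d \<Longrightarrow> obtained_by_shelling d k (simplex_closure \<sigma>)"
| shelling_step:
    "obtained_by_shelling d k Y \<Longrightarrow> shelling_move d Y \<alpha> \<beta> X \<Longrightarrow> fdim \<beta> < k \<Longrightarrow>
     obtained_by_shelling d k X"

definition shelled_ball :: "int \<Rightarrow> int \<Rightarrow> 'a set set \<Rightarrow> bool" where
  "shelled_ball d k X \<longleftrightarrow>
     0 \<le> k \<and> k \<le> d \<and> pseudomanifold d X \<and> obtained_by_shelling d k X"


section \<open>Reduced simplicial homology with coefficients in a ring\<close>

text \<open>Simplices are oriented by an arbitrarily chosen linear order of all possible vertices; up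
  to isomorphism the homology modules do not depend on it.\<close>

definition vertex_order :: "'a rel" where
  "vertex_order = (SOME r. linear_order_on UNIV r)"

lemma linear_order_vertex_order: "linear_order_on UNIV vertex_order"
proof -
  obtain r :: "'a rel" where "well_order_on UNIV r"
    using well_order_on by blast
  then have "linear_order_on UNIV r"
    by (simp add: well_order_on_def)
  then show ?thesis
    unfolding vertex_order_def by (rule someI)
qed

text \<open>A chain of dimension \<open>p\<close> is given by its coefficients. The multiplicative fields of the record are
  irrelevant for modules.\<close>

definition chain_module ::
    "('r, 'q) ring_scheme \<Rightarrow> 'a set set \<Rightarrow> int \<Rightarrow> ('r, 'a set \<Rightarrow> 'r) module" where
  "chain_module R X p =
     \<lparr>carrier = {c. \<forall>\<sigma>. if \<sigma> \<in> X \<and> fdim \<sigma> = p then c \<sigma> \<in> carrier R else c \<sigma> = \<zero>\<^bsub>R\<^esub>},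
      monoid.mult = undefined, one = undefined,
      zero = (\<lambda>\<sigma>. \<zero>\<^bsub>R\<^esub>),
      add = (\<lambda>c c' \<sigma>. c \<sigma> \<oplus>\<^bsub>R\<^esub> c' \<sigma>),
      smult = (\<lambda>r c \<sigma>. r \<otimes>\<^bsub>R\<^esub> c \<sigma>)\<rparr>"

text \<open>The face \<open>\<tau>\<close> occurs in the boundary of the simplex \<open>insert v \<tau>\<close> with the sign
  \<open>(-1)^i\<close>, where \<open>i\<close> vertices of the simplex precede \<open>v\<close>. For \<open>\<tau> = {}\<close> this
  is the augmentation, which makes the homology reduced.\<close>

definition chain_boundary_map ::
    "('r, 'q) ring_scheme \<Rightarrow> 'a set set \<Rightarrow> ('a set \<Rightarrow> 'r) \<Rightarrow> 'a set \<Rightarrow> 'r" where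
  "chain_boundary_map R X c \<tau> =
     (if \<tau> \<in> X
      then \<Oplus>\<^bsub>R\<^esub>v \<in> {v. v \<notin> \<tau> \<and> insert v \<tau> \<in> X}.
             (if even (card {u \<in> \<tau>. (u, v) \<in> vertex_order})
              then c (insert v \<tau>) else \<ominus>\<^bsub>R\<^esub> c (insert v \<tau>))
      else \<zero>\<^bsub>R\<^esub>)"

definition cycle_module ::
    "('r, 'q) ring_scheme \<Rightarrow> 'a set set \<Rightarrow> int \<Rightarrow> ('r, 'a set \<Rightarrow> 'r) module" where
  "cycle_module R X p =
     (chain_module R X p)
       \<lparr>carrier := {c \<in> carrier (chain_module R X p). chain_boundary_map R X c = (\<lambda>\<tau>. \<zero>\<^bsub>R\<^esub>)}\<rparr>"

definition boundary_chains ::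
    "('r, 'q) ring_scheme \<Rightarrow> 'a set set \<Rightarrow> int \<Rightarrow> ('a set \<Rightarrow> 'r) set" where
  "boundary_chains R X p = chain_boundary_map R X ` carrier (chain_module R X (p + 1))"

text \<open>The quotient of the module of cycles by the submodule of boundaries; its elements are
  cosets.\<close>

definition reduced_homology ::
    "('r, 'q) ring_scheme \<Rightarrow> 'a set set \<Rightarrow> int \<Rightarrow> ('r, ('a set \<Rightarrow> 'r) set) module" where
  "reduced_homology R X p =
     (let Z = cycle_module R X p; B = boundary_chains R X p in
     \<lparr>carrier = a_rcosets\<^bsub>Z\<^esub> B,
      monoid.mult = undefined, one = undefined,
      zero = B,
      add = (\<lambda>K L. K <+>\<^bsub>Z\<^esub> L),
      smult = (\<lambda>r K. \<Union>c\<in>K. B +>\<^bsub>Z\<^esub> (r \<odot>\<^bsub>Z\<^esub> c))\<rparr>)"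

definition self_module :: "('r, 'q) ring_scheme \<Rightarrow> ('r, 'r) module" where
  "self_module R =
     \<lparr>carrier = carrier R, monoid.mult = monoid.mult R, one = \<one>\<^bsub>R\<^esub>, zero = \<zero>\<^bsub>R\<^esub>, add = add R,
      smult = monoid.mult R\<rparr>"

definition module_isomorphic ::
    "('r, 'q) ring_scheme \<Rightarrow> ('r, 'm) module \<Rightarrow> ('r, 'n) module \<Rightarrow> bool" where
  "module_isomorphic R M N \<longleftrightarrow>
     (\<exists>f. f \<in> iso (add_monoid M) (add_monoid N) \<and>
          (\<forall>r\<in>carrier R. \<forall>x\<in>carrier M. f (r \<odot>\<^bsub>M\<^esub> x) = r \<odot>\<^bsub>N\<^esub> f x))"

definition homology_vanishes :: "('r, 'q) ring_scheme \<Rightarrow> 'a set set \<Rightarrow> int \<Rightarrow> bool" where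
  "homology_vanishes R X p \<longleftrightarrow> carrier (reduced_homology R X p) = {\<zero>\<^bsub>reduced_homology R X p\<^esub>}"

definition has_homology_of_sphere :: "('r, 'q) ring_scheme \<Rightarrow> 'a set set \<Rightarrow> int \<Rightarrow> bool" where
  "has_homology_of_sphere R X m \<longleftrightarrow>
     module_isomorphic R (reduced_homology R X m) (self_module R) \<and>
     (\<forall>p. p \<noteq> m \<longrightarrow> homology_vanishes R X p)"

definition acyclic_complex :: "('r, 'q) ring_scheme \<Rightarrow> 'a set set \<Rightarrow> bool" where
  "acyclic_complex R X \<longleftrightarrow> (\<forall>p. homology_vanishes R X p)"


section \<open>Homology balls, triangulated balls and stackedness\<close>

definition homology_sphere :: "('r, 'q) ring_scheme \<Rightarrow> int \<Rightarrow> 'a set set \<Rightarrow> bool" where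
  "homology_sphere R d X \<longleftrightarrow> simplicial_complex X \<and> cdim X = d \<and>
     (\<forall>\<sigma>\<in>X. has_homology_of_sphere R (link X \<sigma>) (d - fdim \<sigma> - 1))"

definition homology_boundary :: "('r, 'q) ring_scheme \<Rightarrow> 'a set set \<Rightarrow> 'a set set" where
  "homology_boundary R X = {\<sigma> \<in> X. acyclic_complex R (link X \<sigma>)}"

definition homology_ball :: "('r, 'q) ring_scheme \<Rightarrow> int \<Rightarrow> 'a set set \<Rightarrow> bool" where
  "homology_ball R d X \<longleftrightarrow> simplicial_complex X \<and> cdim X = d \<and> acyclic_complex R X \<and>
     (\<forall>\<sigma>\<in>X. \<sigma> \<noteq> {} \<longrightarrow>
        has_homology_of_sphere R (link X \<sigma>) (d - fdim \<sigma> - 1) \<or> acyclic_complex R (link X \<sigma>)) \<and>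
     homology_sphere R (d - 1) (homology_boundary R X)"

definition closed_ball_space :: "nat \<Rightarrow> (nat \<Rightarrow> real) topology" where
  "closed_ball_space n = subtopology (Euclidean_space n) {x. (\<Sum>i<n. (x i)\<^sup>2) \<le> 1}"

definition triangulated_ball :: "int \<Rightarrow> 'a set set \<Rightarrow> bool" where
  "triangulated_ball d X \<longleftrightarrow> simplicial_complex X \<and> cdim X = d \<and>
     geometric_realization X homeomorphic_space closed_ball_space (nat d)"

text \<open>Stackedness refers to the boundary \<open>B\<close> of the ball \<open>X\<close>.\<close>

definition stacked_wrt :: "int \<Rightarrow> int \<Rightarrow> 'a set set \<Rightarrow> 'a set set \<Rightarrow> bool" where
  "stacked_wrt d k B X \<longleftrightarrow> (\<forall>\<sigma>\<in>X. d - fdim \<sigma> \<ge> k + 1 \<longrightarrow> \<sigma> \<in> B)"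

definition stacked_homology_ball ::
    "('r, 'q) ring_scheme \<Rightarrow> int \<Rightarrow> int \<Rightarrow> 'a set set \<Rightarrow> bool" where
  "stacked_homology_ball R d k X \<longleftrightarrow>
     homology_ball R d X \<and> stacked_wrt d k (homology_boundary R X) X"

text \<open>A triangulated ball is a weak pseudomanifold, and its boundary sphere is triangulated by
  the boundary in the sense of weak pseudomanifolds.\<close>

definition stacked_triangulated_ball :: "int \<Rightarrow> int \<Rightarrow> 'a set set \<Rightarrow> bool" where
  "stacked_triangulated_ball d k X \<longleftrightarrow>
     triangulated_ball d X \<and> stacked_wrt d k (pm_boundary d X) X"

end

theory Submission
  imports "HOL-Analysis.Further_Topology" Defs
begin

text \<open>A complex is \<open>stacked\<close> if its facets can be listed such that each new facet is a cone, with a new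
  apex, over a ridge that lies in exactly one earlier facet. This is what a \<open>1\<close>-shelling amounts to,
  and in a normal pseudomanifold it is also what a tree as dual graph amounts to: normality makes
  the dual graph of every star connected, so that a leaf of the tree meets the other facets in a
  single ridge.

  Gluing a simplex along a boundary ridge changes neither the homeomorphism type nor the homology,
  which yields the two kinds of balls; over the field with two elements the boundary is computed
  from the complex, since the only inner faces are the facets and the edges of a tree.

  Conversely, an edge of the dual graph of a stacked ball is a bridge. In the topological case, a
  cycle through the edge gives a loop in the interior of the ball that winds once around a function
  without zeros, although the interior is contractible. In the homological case, the ridge of the
  edge is the relative boundary of a chain, although a relative orientation cycle exists.\<close>

section \<open>Facets, stars and normality\<close>

text \<open>The sets \<open>F\<close> of facets are manipulated rather than the complexes, and
  \<open>n\<close> is the number of vertices of a facet. That a graph has no cycle is tested through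
  detours: a cycle joins the ends of one of its edges without using that edge, so the converse
  directions examine a single ridge. Two obstacles shape these directions. A triangulated ball comes
  with a bare homeomorphism, and nothing ties its combinatorial boundary to the sphere; invariance
  of domain supplies one inclusion, that the open ball avoids the boundary complex, and the
  contraction is arranged to use no more than that. A homology ball comes with an arbitrary
  commutative ring, in which 2 may vanish, be a unit or be a zero divisor; a single chain would not
  settle all cases, but of two relative chains one can exist only if 2 is a unit and the other only
  if it is not. In the opposite direction a ring has to be produced over a type of which just two
  distinct elements are known, hence the field with two elements, where chains are sets and signs
  disappear.\<close>

definition faces_of :: "'a set set \<Rightarrow> 'a set set" where
  "faces_of F = {\<sigma>. \<exists>\<phi>\<in>F. \<sigma> \<subseteq> \<phi>}"

definition star :: "'a set set \<Rightarrow> 'a set \<Rightarrow> 'a set set" where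
  "star F \<sigma> = {\<phi> \<in> F. \<sigma> \<subseteq> \<phi>}"

text \<open>The relation depends on a set of facets and not on a complex, so that it can be
  restricted to stars and to subsets of \<open>F\<close>.\<close>

definition adj :: "nat \<Rightarrow> 'a set set \<Rightarrow> 'a set rel" where
  "adj n F = {(\<phi>, \<psi>). \<phi> \<in> F \<and> \<psi> \<in> F \<and> \<phi> \<noteq> \<psi> \<and> Suc (card (\<phi> \<inter> \<psi>)) = n}"

lemma sym_adj: "sym (adj n F)"
  by (auto simp: sym_def adj_def Int_commute)

lemma face_in_facet:
  assumes "simplicial_complex X" "\<sigma> \<in> X"
  shows "\<exists>\<phi>\<in>facets X. \<sigma> \<subseteq> \<phi>"
proof -
  have "finite X" using assms by (simp add: simplicial_complex_def)
  from finite_has_maximal2[OF this assms(2)] show ?thesis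
    unfolding facets_def by auto
qed

lemma faces_of_facets:
  assumes "simplicial_complex X"
  shows "faces_of (facets X) = X"
proof
  show "faces_of (facets X) \<subseteq> X"
    using assms unfolding faces_of_def facets_def simplicial_complex_def by blast
  show "X \<subseteq> faces_of (facets X)"
    using face_in_facet[OF assms] unfolding faces_of_def by blast
qed

lemma pure_complex_facets:
  assumes "pure_complex d X"
  shows "finite (facets X)" "facets X \<noteq> {}" "\<And>\<phi>. \<phi> \<in> facets X \<Longrightarrow> finite \<phi>"
    "\<And>\<phi>. \<phi> \<in> facets X \<Longrightarrow> card \<phi> = nat (d + 1)" "faces_of (facets X) = X"
proof -
  have sc: "simplicial_complex X" using assms by (simp add: pure_complex_def)
  show "finite (facets X)" using sc by (simp add: simplicial_complex_def facets_def)
  show "facets X \<noteq> {}" using face_in_facet[OF sc, of "{}"] sc by (auto simp: simplicial_complex_def)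
  show "finite \<phi>" if "\<phi> \<in> facets X" for \<phi> using that sc by (auto simp: facets_def simplicial_complex_def)
  show "card \<phi> = nat (d + 1)" if "\<phi> \<in> facets X" for \<phi>
    using that assms by (auto simp: pure_complex_def fdim_def)
  show "faces_of (facets X) = X" using faces_of_facets[OF sc] .
qed

lemma facets_faces_of:
  assumes "\<And>\<phi>. \<phi> \<in> F \<Longrightarrow> finite \<phi> \<and> card \<phi> = n"
  shows "facets (faces_of F) = F"
proof
  show "facets (faces_of F) \<subseteq> F"
    unfolding facets_def faces_of_def by blast
  show "F \<subseteq> facets (faces_of F)"
    unfolding facets_def faces_of_def using assms
    by clarsimp (metis card_subset_eq order_refl subset_antisym subset_trans)
qed

lemma simplicial_complex_faces_of:
  assumes "finite F" "F \<noteq> {}" "\<And>\<phi>. \<phi> \<in> F \<Longrightarrow> finite \<phi>"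
  shows "simplicial_complex (faces_of F)"
proof -
  have "faces_of F = (\<Union>\<phi>\<in>F. Pow \<phi>)" unfolding faces_of_def by auto
  then have "finite (faces_of F)" using assms by simp
  then show ?thesis using assms unfolding simplicial_complex_def faces_of_def
    by (auto intro: finite_subset)
qed

lemma pure_complex_faces_of:
  assumes "finite F" "F \<noteq> {}" "\<And>\<phi>. \<phi> \<in> F \<Longrightarrow> finite \<phi> \<and> card \<phi> = n"
  shows "pure_complex (int n - 1) (faces_of F)"
  using simplicial_complex_faces_of[of F] facets_faces_of[of F n] assms
  unfolding pure_complex_def by (auto simp: fdim_def)

lemma parcs_dual_graph:
  assumes "d \<ge> 1"
  shows "parcs (dual_graph d X) = adj (nat (d + 1)) (facets X)"
  using assms by (auto simp: dual_graph_def adj_def fdim_def)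

definition realization :: "'a set set \<Rightarrow> ('a \<Rightarrow> real) set" where
  "realization X = {x. (\<forall>v. 0 \<le> x v) \<and> {v. x v \<noteq> 0} \<in> X \<and> (\<Sum>v | x v \<noteq> 0. x v) = 1}"

lemma geometric_realization_eq: "geometric_realization X = top_of_set (realization X)"
  by (simp add: geometric_realization_def realization_def euclidean_product_topology)

text \<open>The points supported in a facet of \<open>A\<close> and those supported in a facet of
  \<open>B\<close> form two closed sets that cover the realization of the link. A support vertex of
  a common point is a vertex as claimed, so without one the link would be disconnected. The
  conditions \<open>\<phi>1 \<noteq> \<sigma>\<close> and \<open>\<phi>2 \<noteq> \<sigma>\<close>
  make both sets meet the link.\<close>

lemma connected_link_split:
  assumes conn: "connected_space (geometric_realization (link (faces_of F) \<sigma>))"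
    and fin: "finite F"  "\<And>\<phi>. \<phi> \<in> F \<Longrightarrow> finite \<phi>"
    and AB: "A \<union> B = star F \<sigma>" and ne: "\<phi>1 \<in> A" "\<phi>2 \<in> B" "\<phi>1 \<noteq> \<sigma>" "\<phi>2 \<noteq> \<sigma>"
  shows "\<exists>\<phi>\<in>A. \<exists>\<psi>\<in>B. \<exists>v. v \<notin> \<sigma> \<and> v \<in> \<phi> \<inter> \<psi>"
proof (rule ccontr)
  assume no: "\<not> ?thesis"
  let ?L = "link (faces_of F) \<sigma>"
  let ?S = "realization ?L"
  define C where "C A = (\<Union>\<phi>\<in>A. {x::'a \<Rightarrow> real. \<forall>v\<in>-\<phi>. x v = 0})" for A
  have finAB: "finite A" "finite B" using AB fin(1) by (auto simp: star_def intro: rev_finite_subset)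
  have cl1: "closed {x::'a \<Rightarrow> real. \<forall>v\<in>-\<phi>. x v = 0}" for \<phi>
  proof -
    have "{x::'a \<Rightarrow> real. \<forall>v\<in>-\<phi>. x v = 0} = (\<Inter>v\<in>-\<phi>. {x. x v = 0})" by auto
    moreover have "closed {x::'a \<Rightarrow> real. x v = 0}" for v
      by (intro closed_Collect_eq continuous_on_product_coordinates continuous_intros)
    ultimately show ?thesis by auto
  qed
  have cl: "closed (C A)" "closed (C B)" using finAB cl1 by (auto simp: C_def)
  have conn': "topological_space_class.connected ?S"
    using conn unfolding geometric_realization_eq by (metis connectedin_iff_connected connectedin_def subset_UNIV topspace_euclidean)
  have "?S \<subseteq> C A \<union> C B"
  proof
    fix x assume "x \<in> ?S"
    then have *: "{v. x v \<noteq> 0} \<inter> \<sigma> = {}" "{v. x v \<noteq> 0} \<union> \<sigma> \<in> faces_of F" 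
      by (auto simp: realization_def link_def)
    then obtain \<phi> where "\<phi> \<in> F" "{v. x v \<noteq> 0} \<union> \<sigma> \<subseteq> \<phi>" by (auto simp: faces_of_def)
    then have "\<phi> \<in> A \<union> B" "\<forall>v\<in>-\<phi>. x v = 0" using AB by (auto simp: star_def)
    then show "x \<in> C A \<union> C B" by (auto simp: C_def)
  qed
  moreover have "C A \<inter> C B \<inter> ?S = {}"
  proof (rule ccontr)
    assume "C A \<inter> C B \<inter> ?S \<noteq> {}"
    then obtain x \<phi> \<psi> where x: "x \<in> ?S" "\<phi> \<in> A" "\<psi> \<in> B" "\<forall>v\<in>-\<phi>. x v = 0" "\<forall>v\<in>-\<psi>. x v = 0"
      by (auto simp: C_def)
    have "(\<Sum>v | x v \<noteq> 0. x v) = 1" using x(1) by (simp add: realization_def)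
    then have "{v. x v \<noteq> 0} \<noteq> {}" by (metis sum.empty zero_neq_one)
    then obtain v where v: "x v \<noteq> 0" by auto
    then have "v \<notin> \<sigma>" using x(1) by (auto simp: realization_def link_def)
    moreover have "v \<in> \<phi> \<inter> \<psi>" using x(4,5) v by auto
    ultimately show False using no x(2,3) by blast
  qed
  moreover have "C D \<inter> ?S \<noteq> {}" if "\<phi> \<in> D" "D \<subseteq> star F \<sigma>" "\<phi> \<noteq> \<sigma>" for D \<phi>
  proof -
    have "\<sigma> \<subset> \<phi>" using that by (auto simp: star_def)
    then obtain v where v: "v \<in> \<phi>" "v \<notin> \<sigma>" by auto
    define x where "x = (\<lambda>w. if w = v then 1 else 0 :: real)"
    have s: "{w. x w \<noteq> 0} = {v}" by (auto simp: x_def)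
    have "x \<in> ?S" unfolding realization_def using s v that
      by (auto simp: x_def link_def faces_of_def star_def)
    moreover have "x \<in> C D" using that v by (auto simp: C_def x_def)
    ultimately show ?thesis by blast
  qed
  then have "C A \<inter> ?S \<noteq> {}" "C B \<inter> ?S \<noteq> {}" using ne AB by blast+
  ultimately show False using conn' cl unfolding connected_closed by blast
qed

text \<open>Induction on the codimension of \<sigma>. If the facets reachable from \<phi> were not
  the whole star, connectedness of the link would give a vertex \<open>v\<close> outside \<sigma>
  that lies in a reachable and in an unreachable facet; the star of \<open>insert v \<sigma>\<close>
  joins these two by induction. Normality speaks of codimension at least two only, but over a ridge
  any two distinct facets meet exactly in that ridge.\<close>

lemma star_connected:
  assumes "normal_pseudomanifold d X" and "d \<ge> 1" and "\<sigma> \<in> X"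
    and "\<phi> \<in> star (facets X) \<sigma>" and "\<psi> \<in> star (facets X) \<sigma>"
  shows "(\<phi>, \<psi>) \<in> (adj (nat (d + 1)) (star (facets X) \<sigma>))\<^sup>*"
  using assms(3-)
proof (induction "nat (d + 1) - card \<sigma>" arbitrary: \<sigma> \<phi> \<psi> rule: less_induct)
  case less
  define F where "F = facets X"
  define n where "n = nat (d + 1)"
  have pure: "pure_complex d X" using assms by (simp add: normal_pseudomanifold_def weak_pseudomanifold_def)
  note pf = pure_complex_facets[OF pure, folded F_def, folded n_def]
  have \<phi>: "\<phi> \<in> F" "\<sigma> \<subseteq> \<phi>" and \<psi>: "\<psi> \<in> F" "\<sigma> \<subseteq> \<psi>" using less.prems by (auto simp: star_def F_def)
  have fin\<sigma>: "finite \<sigma>" using \<phi> pf(3) finite_subset by blast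
  have cs: "card \<sigma> \<le> n" using \<phi> pf by (metis card_mono)
  show ?case
  proof (cases "\<phi> = \<psi>")
    case False
    have ne: "\<sigma> \<noteq> \<phi>" "\<sigma> \<noteq> \<psi>" using False \<phi> \<psi> pf by (metis card_subset_eq)+
    then have lt: "card \<sigma> < n" using \<phi> pf by (metis psubset_card_mono psubsetI)
    show ?thesis
    proof (cases "Suc (card \<sigma>) = n")
      case True
      have "card (\<phi> \<inter> \<psi>) < n" using \<phi> \<psi> pf False
        by (metis Int_lower1 Int_lower2 card_mono card_subset_eq le_neq_implies_less)
      moreover have "card \<sigma> \<le> card (\<phi> \<inter> \<psi>)" using \<phi> \<psi> pf by (intro card_mono) auto
      ultimately have "Suc (card (\<phi> \<inter> \<psi>)) = n" using True by linarith
      then have "(\<phi>, \<psi>) \<in> adj n (star F \<sigma>)" using \<phi> \<psi> False by (auto simp: adj_def star_def)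
      then show ?thesis by (simp add: n_def F_def)
    next
      case False2: False
      have "fdim \<sigma> \<le> d - 2" using lt False2 assms(2) by (simp add: fdim_def n_def)
      then have conn: "connected_space (geometric_realization (link (faces_of F) \<sigma>))"
        using assms(1) less.prems(1) pf(5) by (simp add: normal_pseudomanifold_def)
      define A where "A = {\<xi> \<in> star F \<sigma>. (\<phi>, \<xi>) \<in> (adj n (star F \<sigma>))\<^sup>*}"
      define B where "B = star F \<sigma> - A"
      show ?thesis
      proof (rule ccontr)
        assume "\<not> ?thesis"
        then have inB: "\<psi> \<in> B" using \<psi> by (auto simp: B_def A_def star_def F_def n_def)
        have AB: "A \<union> B = star F \<sigma>" by (auto simp: A_def B_def)
        have inA: "\<phi> \<in> A" using \<phi> by (auto simp: A_def star_def)
        obtain \<xi> \<omega> v where *: "\<xi> \<in> A" "\<omega> \<in> B" "v \<notin> \<sigma>" "v \<in> \<xi> \<inter> \<omega>"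
          using connected_link_split[OF conn pf(1,3) _ inA inB] ne(1) ne(2) AB by metis
        have m: "\<xi> \<in> star F (insert v \<sigma>)" "\<omega> \<in> star F (insert v \<sigma>)"
          using * by (auto simp: A_def B_def star_def)
        have inX: "insert v \<sigma> \<in> X" using m pf(5) by (auto simp: star_def faces_of_def)
        have "nat (d + 1) - card (insert v \<sigma>) < nat (d + 1) - card \<sigma>"
          using lt *(3) fin\<sigma> by (simp add: n_def)
        from less.hyps[OF this inX] m have "(\<xi>, \<omega>) \<in> (adj n (star F (insert v \<sigma>)))\<^sup>*"
          by (simp add: F_def n_def)
        moreover have "adj n (star F (insert v \<sigma>)) \<subseteq> adj n (star F \<sigma>)" by (auto simp: adj_def star_def)
        ultimately have "(\<xi>, \<omega>) \<in> (adj n (star F \<sigma>))\<^sup>*" using rtrancl_mono by blast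
        moreover have "(\<phi>, \<xi>) \<in> (adj n (star F \<sigma>))\<^sup>*" using * by (auto simp: A_def)
        ultimately have "(\<phi>, \<omega>) \<in> (adj n (star F \<sigma>))\<^sup>*" by (rule rtrancl_trans[rotated])
        then have "\<omega> \<in> A" using * by (auto simp: A_def B_def)
        then show False using * by (simp add: B_def)
      qed
    qed
  qed simp
qed

section \<open>Stacked complexes\<close>

inductive stacked :: "nat \<Rightarrow> 'a set set \<Rightarrow> bool" for n where
  stacked_simplex: "finite \<phi> \<Longrightarrow> card \<phi> = n \<Longrightarrow> stacked n {\<phi>}"
| stacked_step: "stacked n F \<Longrightarrow> \<psi> \<in> F \<Longrightarrow> \<alpha> \<subseteq> \<psi> \<Longrightarrow> Suc (card \<alpha>) = n \<Longrightarrow>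
    (\<And>\<xi>. \<xi> \<in> F \<Longrightarrow> \<alpha> \<subseteq> \<xi> \<Longrightarrow> \<xi> = \<psi>) \<Longrightarrow> b \<notin> \<Union>F \<Longrightarrow> stacked n (insert (insert b \<alpha>) F)"

lemma stacked_facets:
  assumes "stacked n F"
  shows "finite F \<and> F \<noteq> {} \<and> (\<forall>\<phi>\<in>F. finite \<phi> \<and> card \<phi> = n)"
  using assms
proof induction
  case (stacked_step F \<psi> \<alpha> b)
  have "finite \<alpha>" "b \<notin> \<alpha>" using stacked_step.hyps(2,3,6) stacked_step.IH by (auto intro: finite_subset)
  then show ?case using stacked_step.hyps(4) stacked_step.IH by auto
qed auto

lemma faces_of_insert: "faces_of (insert \<phi> F) = Pow \<phi> \<union> faces_of F"
  by (auto simp: faces_of_def)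

text \<open>Adding the apex \<open>b\<close> is the move from \<alpha> to \<open>{b}\<close>, of
  index 0: the boundary of a vertex is \<open>{{}}\<close>, so the join demanded by the move is the
  full simplex on \<alpha>.\<close>

lemma stacked_imp_shelled:
  assumes "stacked n F"
  shows "obtained_by_shelling (int n - 1) 1 (faces_of F)"
  using assms
proof induction
  case (stacked_simplex \<phi>)
  have "faces_of {\<phi>} = simplex_closure \<phi>" by (auto simp: faces_of_def simplex_closure_def)
  then show ?case using stacked_simplex standard_ball[of \<phi> "int n - 1" 1] by (simp add: fdim_def)
next
  case (stacked_step F \<psi> \<alpha> b)
  let ?F' = "insert (insert b \<alpha>) F"
  have st': "stacked n ?F'" by (rule stacked.stacked_step[OF stacked_step.hyps])
  note f = stacked_facets[OF stacked_step.hyps(1)] and f' = stacked_facets[OF st']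
  have b: "b \<notin> \<alpha>" using stacked_step.hyps(2,3,6) by auto
  have fac: "facets (faces_of F) = F" "facets (faces_of ?F') = ?F'"
    using f f' by (auto intro!: facets_faces_of)
  have "insert b \<alpha> \<notin> F" using stacked_step.hyps(6) by auto
  moreover have "induced_subcomplex (faces_of F) (\<alpha> \<union> {b}) = cjoin (simplex_closure \<alpha>) (simplex_boundary {b})"
  proof -
    have "simplex_boundary {b} = {{}}" by (auto simp: simplex_boundary_def)
    moreover have "\<sigma> \<in> faces_of F \<and> \<sigma> \<subseteq> \<alpha> \<union> {b} \<longleftrightarrow> \<sigma> \<subseteq> \<alpha>" for \<sigma>
    proof
      assume *: "\<sigma> \<in> faces_of F \<and> \<sigma> \<subseteq> \<alpha> \<union> {b}"
      then have "b \<notin> \<sigma>" using stacked_step.hyps(6) by (auto simp: faces_of_def)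
      then show "\<sigma> \<subseteq> \<alpha>" using * by auto
    next
      assume "\<sigma> \<subseteq> \<alpha>"
      then show "\<sigma> \<in> faces_of F \<and> \<sigma> \<subseteq> \<alpha> \<union> {b}" using stacked_step.hyps(2,3) by (auto simp: faces_of_def)
    qed
    ultimately show ?thesis
      by (auto simp: induced_subcomplex_def cjoin_def simplex_closure_def)
  qed
  ultimately have "shelling_move (int n - 1) (faces_of F) \<alpha> {b} (faces_of ?F')"
    using f f' b pure_complex_faces_of[of F n] pure_complex_faces_of[of ?F' n]
    unfolding shelling_move_def fac by (auto simp: faces_of_def)
  then show ?case using stacked_step.IH shelling_step[of "int n - 1" 1] by (force simp: fdim_def)
qed

text \<open>Index less than 1 forces \<beta> to be a single vertex, which is new because the induced
  subcomplex has only faces of \<alpha>. A second old facet over \<alpha> would be the third one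
  together with the new facet, so the bound by two yields the unique neighbour.\<close>

lemma shelled_imp_stacked:
  assumes "obtained_by_shelling d 1 X" "d \<ge> 0"
    and "\<forall>\<rho>\<in>X. fdim \<rho> = d - 1 \<longrightarrow> card {\<phi> \<in> facets X. \<rho> \<subseteq> \<phi>} \<le> 2"
  shows "stacked (nat (d + 1)) (facets X)"
  using assms(1,3)
proof induction
  case (standard_ball \<sigma>)
  have "facets (simplex_closure \<sigma>) = {\<sigma>}" by (auto simp: facets_def simplex_closure_def)
  then show ?case using standard_ball stacked.stacked_simplex[of \<sigma> "nat (d + 1)"] by (simp add: fdim_def)
next
  case (shelling_step Y \<alpha> \<beta> X)
  note sm = shelling_step.hyps(2)[unfolded shelling_move_def]
  let ?n = "nat (d + 1)"
  have Y: "pure_complex d Y" and X: "pure_complex d X" using sm by auto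
  note pY = pure_complex_facets[OF Y] and pX = pure_complex_facets[OF X]
  have "finite \<beta>" "\<beta> \<noteq> {}" using sm X by (auto simp: pure_complex_def simplicial_complex_def)
  moreover have "card \<beta> \<le> 1" using shelling_step.hyps(3) by (simp add: fdim_def)
  ultimately have "card \<beta> = 1" by (simp add: le_Suc_eq)
  then obtain b where \<beta>: "\<beta> = {b}" by (auto simp: card_1_singleton_iff)
  have ind: "{\<sigma> \<in> Y. \<sigma> \<subseteq> insert b \<alpha>} = Pow \<alpha>"
  proof -
    have "simplex_boundary {b} = {{}}" by (auto simp: simplex_boundary_def)
    then show ?thesis using sm \<beta> by (auto simp: induced_subcomplex_def cjoin_def simplex_closure_def)
  qed
  have b: "b \<notin> \<alpha>" using sm \<beta> by auto
  have YX: "facets Y \<subseteq> facets X"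
  proof
    fix \<phi> assume \<phi>: "\<phi> \<in> facets Y"
    then have "\<phi> \<in> X" using sm by (auto simp: facets_def)
    then obtain \<psi> where "\<psi> \<in> facets X" "\<phi> \<subseteq> \<psi>" using pX(5) by (auto simp: faces_of_def)
    then show "\<phi> \<in> facets X" using \<phi> pX pY by (metis card_subset_eq)
  qed
  have fX: "facets X = insert (insert b \<alpha>) (facets Y)" using sm YX \<beta> by auto
  \<comment> \<open>A shelling move does not mention the bound by two, so it has to be handed down
    to \<open>Y\<close> before the induction hypothesis applies.\<close>
  have le2: "\<forall>\<rho>\<in>Y. fdim \<rho> = d - 1 \<longrightarrow> card {\<phi> \<in> facets Y. \<rho> \<subseteq> \<phi>} \<le> 2"
  proof (intro ballI impI)
    fix \<rho> assume "\<rho> \<in> Y" "fdim \<rho> = d - 1"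
    then have "card {\<phi> \<in> facets X. \<rho> \<subseteq> \<phi>} \<le> 2" using shelling_step.prems sm by auto
    moreover have "card {\<phi> \<in> facets Y. \<rho> \<subseteq> \<phi>} \<le> card {\<phi> \<in> facets X. \<rho> \<subseteq> \<phi>}"
      using YX pX(1) by (intro card_mono) auto
    ultimately show "card {\<phi> \<in> facets Y. \<rho> \<subseteq> \<phi>} \<le> 2" by linarith
  qed
  have IH: "stacked ?n (facets Y)" using shelling_step.IH le2 by blast
  have "\<alpha> \<in> Y" using ind by auto
  then obtain \<psi> where \<psi>: "\<psi> \<in> facets Y" "\<alpha> \<subseteq> \<psi>" using pY(5) by (auto simp: faces_of_def)
  have new: "insert b \<alpha> \<in> facets X" using fX by auto
  have fa: "finite \<alpha>" using pX(3)[OF new] by simp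
  have ca: "Suc (card \<alpha>) = ?n" using pX(4)[OF new] fa b by simp
  have bY: "b \<notin> \<Union>(facets Y)"
  proof
    assume "b \<in> \<Union>(facets Y)"
    then have "{b} \<in> Y" using pY(5) by (auto simp: faces_of_def)
    then have "{b} \<in> Pow \<alpha>" using ind by auto
    then show False using b by auto
  qed
  have un: "\<xi> = \<psi>" if "\<xi> \<in> facets Y" "\<alpha> \<subseteq> \<xi>" for \<xi>
  proof (rule ccontr)
    assume ne: "\<xi> \<noteq> \<psi>"
    have "{insert b \<alpha>, \<xi>, \<psi>} \<subseteq> {\<phi> \<in> facets X. \<alpha> \<subseteq> \<phi>}" using that \<psi> fX by auto
    moreover have "card {insert b \<alpha>, \<xi>, \<psi>} = 3" using ne that \<psi> bY by (auto simp: card_insert_if)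
    ultimately have "3 \<le> card {\<phi> \<in> facets X. \<alpha> \<subseteq> \<phi>}" 
      using card_mono[of "{\<phi> \<in> facets X. \<alpha> \<subseteq> \<phi>}" "{insert b \<alpha>, \<xi>, \<psi>}"] pX(1) by simp
    moreover have "card {\<phi> \<in> facets X. \<alpha> \<subseteq> \<phi>} \<le> 2"
      using shelling_step.prems sm ca assms(2) by (auto simp: fdim_def)
    ultimately show False by linarith
  qed
  show ?case unfolding fX by (rule stacked.stacked_step[OF IH \<psi> ca un bY])
qed

section \<open>Finite trees: leaves and their removal\<close>

definition has_cycle :: "'v rel \<Rightarrow> bool" where
  "has_cycle E \<longleftrightarrow> (\<exists>vs. distinct vs \<and> 3 \<le> length vs \<and> successively (\<lambda>x y. (x, y) \<in> E) vs \<and>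
     (last vs, hd vs) \<in> E)"

lemma has_cycle_mono: "has_cycle E \<Longrightarrow> E \<subseteq> E' \<Longrightarrow> has_cycle E'"
  unfolding has_cycle_def by (blast intro: successively_mono)

text \<open>All neighbours of the first vertex of a longest simple path lie on the path, and a
  neighbour other than the second vertex would close a cycle of length at least three.\<close>

lemma ex_leaf:
  assumes fin: "finite V" and E: "E \<subseteq> V \<times> V" "sym E" "irrefl E"
    and acyc: "\<not> has_cycle E" and ne: "E \<noteq> {}"
  shows "\<exists>x y. E `` {x} = {y}"
proof -
  let ?P = "\<lambda>vs. distinct vs \<and> set vs \<subseteq> V \<and> successively (\<lambda>x y. (x, y) \<in> E) vs"
  obtain p q where pq: "(p, q) \<in> E" using ne by auto
  have P0: "?P [p, q]" using pq E by (auto simp: irrefl_def)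
  have bnd: "\<forall>vs. ?P vs \<longrightarrow> length vs < Suc (card V)"
    using fin by (metis card_mono distinct_card less_Suc_eq_le)
  from ex_has_greatest_nat[of ?P "[p, q]" length "Suc (card V)", OF P0] bnd
  obtain vs where vs: "?P vs" and max: "\<And>ws. ?P ws \<Longrightarrow> length ws \<le> length vs" by (metis less_imp_le)
  have "length vs \<ge> 2" using max[OF P0] by simp
  then obtain x y rest where vs_eq: "vs = x # y # rest" by (metis Suc_le_length_iff numeral_2_eq_2)
  have xy: "(x, y) \<in> E" using vs vs_eq by simp
  have "z = y" if z: "(x, z) \<in> E" for z
  proof (rule ccontr)
    assume zy: "z \<noteq> y"
    have zx: "(z, x) \<in> E" using z E(2) by (auto dest: symD)
    have "z \<in> set vs"
    proof (rule ccontr)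
      assume "z \<notin> set vs"
      then have "?P (z # vs)" using vs vs_eq zx E(1) by auto
      then show False using max by fastforce
    qed
    moreover have "z \<noteq> x" using z E(3) by (auto simp: irrefl_def)
    ultimately have "z \<in> set rest" using zy vs_eq by auto
    then obtain ps qs where "rest = ps @ z # qs" by (meson split_list)
    then have "vs = (x # y # ps @ [z]) @ qs" using vs_eq by simp
    then have "distinct (x # y # ps @ [z])" "successively (\<lambda>x y. (x, y) \<in> E) (x # y # ps @ [z])"
      using vs by (auto simp: successively_append_iff simp del: append.simps)
    moreover have "(last (x # y # ps @ [z]), hd (x # y # ps @ [z])) \<in> E" using zx by simp
    moreover have "3 \<le> length (x # y # ps @ [z])" by simp
    ultimately show False using acyc unfolding has_cycle_def by blast
  qed
  with xy have "E `` {x} = {y}" by blast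
  then show ?thesis by blast
qed

text \<open>A walk through the leaf \<phi> enters it from its only neighbour \<psi> and returns
  there, so the excursion can be cut out.\<close>

lemma rtrancl_remove_leaf:
  assumes "(x, z) \<in> E\<^sup>*" "x \<noteq> \<phi>" "sym E" "\<And>y. (\<phi>, y) \<in> E \<Longrightarrow> y = \<psi>" "\<psi> \<noteq> \<phi>" "z \<noteq> \<phi>"
  shows "(x, z) \<in> {(a, b) \<in> E. a \<noteq> \<phi> \<and> b \<noteq> \<phi>}\<^sup>*"
proof -
  let ?E = "{(a, b) \<in> E. a \<noteq> \<phi> \<and> b \<noteq> \<phi>}"
  \<comment> \<open>Strengthened for the induction: while the walk stands at \<phi>, the shortened
    walk waits at \<psi>.\<close>
  have "(z \<noteq> \<phi> \<longrightarrow> (x, z) \<in> ?E\<^sup>*) \<and> (z = \<phi> \<longrightarrow> (x, \<psi>) \<in> ?E\<^sup>*)"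
    using assms(1)
  proof induction
    case base
    then show ?case using assms(2) by auto
  next
    case (step y z)
    show ?case
    proof (cases "y = \<phi>")
      case True
      then have "z = \<psi>" using step(2) assms(4) by auto
      then show ?thesis using step True assms(5) by auto
    next
      case y: False
      show ?thesis
      proof (cases "z = \<phi>")
        case True
        then have "y = \<psi>" using step(2) assms(3,4) by (auto dest: symD)
        then show ?thesis using step y True by auto
      next
        case False
        then have "(y, z) \<in> ?E" using step(2) y by auto
        then show ?thesis using step y False by (auto intro: rtrancl_into_rtrancl)
      qed
    qed
  qed
  then show ?thesis using assms(6) by blast
qed

text \<open>Induction on the number of facets, removing a leaf of the dual graph. Connectedness of
  all stars is assumed instead of normality, because it visibly survives the removal of a
  leaf.\<close>

lemma tree_imp_stacked:
  assumes "finite F" "F \<noteq> {}" "\<And>\<phi>. \<phi> \<in> F \<Longrightarrow> finite \<phi> \<and> card \<phi> = n"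
    and "\<And>\<sigma> \<phi> \<psi>. \<phi> \<in> star F \<sigma> \<Longrightarrow> \<psi> \<in> star F \<sigma> \<Longrightarrow> (\<phi>, \<psi>) \<in> (adj n (star F \<sigma>))\<^sup>*"
    and "\<not> has_cycle (adj n F)"
  shows "stacked n F"
  using assms
proof (induction "card F" arbitrary: F rule: less_induct)
  case less
  show ?case
  proof (cases "\<exists>\<phi>. F = {\<phi>}")
    case True
    then show ?thesis using less.prems by (auto intro: stacked.intros)
  next
    case False
    then obtain p q where pq: "p \<in> F" "q \<in> F" "p \<noteq> q" using less.prems(2) by blast
    have "star F {} = F" by (auto simp: star_def)
    then have "(p, q) \<in> (adj n F)\<^sup>*" using less.prems(4)[of p "{}" q] pq by simp
    then have "adj n F \<noteq> {}" using pq(3) by auto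
    moreover have "adj n F \<subseteq> F \<times> F" "irrefl (adj n F)" by (auto simp: adj_def irrefl_def)
    ultimately obtain \<phi> \<psi> where leaf: "adj n F `` {\<phi>} = {\<psi>}"
      using ex_leaf[of F "adj n F"] less.prems sym_adj by metis
    then have "(\<phi>, \<psi>) \<in> adj n F" by auto
    then have \<phi>: "\<phi> \<in> F" and \<psi>: "\<psi> \<in> F" "\<phi> \<noteq> \<psi>" "Suc (card (\<phi> \<inter> \<psi>)) = n" by (auto simp: adj_def)
    have only: "\<xi> = \<psi>" if "(\<phi>, \<xi>) \<in> adj n F" for \<xi> using leaf that by auto
    define \<alpha> where "\<alpha> = \<phi> \<inter> \<psi>"
    have f\<phi>: "finite \<phi>" "card \<phi> = n" using less.prems \<phi> by auto
    have "card (\<phi> - \<alpha>) = 1" using f\<phi> \<psi> by (simp add: \<alpha>_def card_Diff_subset)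
    then obtain b where b: "\<phi> - \<alpha> = {b}" by (auto simp: card_1_singleton_iff)
    have \<phi>_eq: "\<phi> = insert b \<alpha>" and b\<alpha>: "b \<notin> \<alpha>" "b \<notin> \<psi>" using b by (auto simp: \<alpha>_def)
    define G where "G = F - {\<phi>}"
    have starG: "(\<xi>, \<omega>) \<in> (adj n (star G \<sigma>))\<^sup>*" if "\<xi> \<in> star G \<sigma>" "\<omega> \<in> star G \<sigma>" for \<sigma> \<xi> \<omega>
    proof -
      have "(\<xi>, \<omega>) \<in> (adj n (star F \<sigma>))\<^sup>*" using that less.prems(4)[of \<xi> \<sigma> \<omega>] by (auto simp: star_def G_def)
      moreover have "\<And>y. (\<phi>, y) \<in> adj n (star F \<sigma>) \<Longrightarrow> y = \<psi>" using only by (auto simp: adj_def star_def)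
      ultimately have "(\<xi>, \<omega>) \<in> {(a, b) \<in> adj n (star F \<sigma>). a \<noteq> \<phi> \<and> b \<noteq> \<phi>}\<^sup>*"
        using rtrancl_remove_leaf[of \<xi> \<omega> "adj n (star F \<sigma>)" \<phi> \<psi>] that \<psi> sym_adj by (auto simp: star_def G_def)
      moreover have "{(a, b) \<in> adj n (star F \<sigma>). a \<noteq> \<phi> \<and> b \<noteq> \<phi>} \<subseteq> adj n (star G \<sigma>)"
        by (auto simp: adj_def star_def G_def)
      ultimately show ?thesis using rtrancl_mono by blast
    qed
    have acG: "\<not> has_cycle (adj n G)"
      using less.prems(5) has_cycle_mono[of "adj n G" "adj n F"] by (auto simp: adj_def G_def)
    have "card G < card F" using \<phi> less.prems(1) by (simp add: G_def card_Diff1_less del: card_Diff_insert)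
    then have st: "stacked n G"
      using less.hyps[of G] less.prems(1,3) \<psi> starG acG by (auto simp: G_def)
    \<comment> \<open>A facet that contains the ridge \<alpha> of \<phi> shares exactly this ridge
      with \<phi> and is therefore adjacent to the leaf.\<close>
    have un: "\<xi> = \<psi>" if "\<xi> \<in> G" "\<alpha> \<subseteq> \<xi>" for \<xi>
    proof -
      have ne: "\<xi> \<noteq> \<phi>" "\<xi> \<in> F" using that by (auto simp: G_def)
      have "card (\<phi> \<inter> \<xi>) < n"
        using f\<phi> less.prems(3)[OF ne(2)] ne(1)
        by (metis Int_lower1 Int_lower2 card_mono card_subset_eq le_neq_implies_less)
      moreover have "card \<alpha> \<le> card (\<phi> \<inter> \<xi>)" using that f\<phi> by (intro card_mono) (auto simp: \<alpha>_def)
      ultimately have "Suc (card (\<phi> \<inter> \<xi>)) = n" using \<psi>(3) by (simp add: \<alpha>_def)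
      then show ?thesis using only ne \<phi> by (auto simp: adj_def)
    qed
    \<comment> \<open>Another facet through \<open>b\<close> would be joined to \<phi> inside the
      star of \<open>{b}\<close>. The first step of such a walk leads to the only neighbour \<psi>,
      which misses \<open>b\<close>.\<close>
    have bG: "b \<notin> \<Union>G"
    proof
      assume "b \<in> \<Union>G"
      then obtain \<xi> where x: "\<xi> \<in> F" "\<xi> \<noteq> \<phi>" "b \<in> \<xi>" by (auto simp: G_def)
      then have "(\<phi>, \<xi>) \<in> (adj n (star F {b}))\<^sup>*" using less.prems(4)[of \<phi> "{b}" \<xi>] \<phi> \<phi>_eq by (auto simp: star_def)
      then obtain y where y: "(\<phi>, y) \<in> adj n (star F {b})" using x(2) by (metis converse_rtranclE)
      then have "y = \<psi>" using only by (auto simp: adj_def star_def)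
      then show False using y b\<alpha> by (auto simp: adj_def star_def)
    qed
    have "F = insert (insert b \<alpha>) G" using \<phi> \<phi>_eq by (auto simp: G_def)
    moreover have "\<psi> \<in> G" "\<alpha> \<subseteq> \<psi>" "Suc (card \<alpha>) = n" using \<psi> by (auto simp: \<alpha>_def G_def)
    ultimately show ?thesis using stacked_step[OF st _ _ _ un bG] by metis
  qed
qed

section \<open>Cycles in the dual graph\<close>

text \<open>\<open>zip vs (tl vs @ [y])\<close> lists the arcs of the walk that runs through
  \<open>vs\<close> and ends with a step to \<open>y\<close>; taking \<open>y = hd vs\<close> closes
  it.\<close>

lemma pcas_zip: "vs \<noteq> [] \<Longrightarrow> pcas (hd vs) (zip vs (tl vs @ [y])) y"
proof (induction vs)
  case (Cons a vs)
  then show ?case by (cases vs) auto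
qed simp

lemma pawalk_verts_zip: "vs \<noteq> [] \<Longrightarrow> pawalk_verts (hd vs) (zip vs (tl vs @ [y])) = vs @ [y]"
proof (induction vs)
  case (Cons a vs)
  then show ?case by (cases vs) auto
qed simp

lemma set_zip_tl:
  "vs \<noteq> [] \<Longrightarrow> successively (\<lambda>x y. (x, y) \<in> E) vs \<Longrightarrow> (last vs, y) \<in> E \<Longrightarrow>
    set (zip vs (tl vs @ [y])) \<subseteq> E"
proof (induction vs)
  case (Cons a vs)
  then show ?case by (cases vs) auto
qed simp

lemma has_cycle_imp_cycle:
  assumes "has_cycle (parcs G)" "parcs G \<subseteq> pverts G \<times> pverts G"
  shows "\<exists>p. pre_digraph.cycle (with_proj G) p \<and> 3 \<le> length p"
proof -
  obtain vs where vs: "distinct vs" "3 \<le> length vs" "successively (\<lambda>x y. (x, y) \<in> parcs G) vs"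
    "(last vs, hd vs) \<in> parcs G" using assms(1) by (auto simp: has_cycle_def)
  have ne: "vs \<noteq> []" using vs(2) by auto
  let ?p = "zip vs (tl vs @ [hd vs])"
  have len: "length ?p = length vs" using ne by (cases vs) auto
  have "pre_digraph.awalk (with_proj G) (hd vs) ?p (hd vs)"
    using pcas_zip[OF ne] set_zip_tl[OF ne vs(3,4)] vs(4) assms(2) by (auto simp: pre_digraph.awalk_def cas_with_proj_eq)
  moreover have "distinct (tl (vs @ [hd vs]))" using vs(1) ne by (cases vs) auto
  moreover have "?p \<noteq> []" using len ne by (metis length_0_conv)
  ultimately have "pre_digraph.cycle (with_proj G) ?p"
    unfolding pre_digraph.cycle_def using pawalk_verts_zip[OF ne] by (intro exI[of _ "hd vs"]) (simp add: awalk_verts_with_proj_eq)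
  then show ?thesis using len vs(2) by metis
qed

lemma pcas_rtrancl:
  "pcas x q u \<Longrightarrow> set q \<subseteq> E \<Longrightarrow> w \<notin> set (pawalk_verts x q) \<Longrightarrow>
    (x, u) \<in> {(a, b) \<in> E. a \<noteq> w \<and> b \<noteq> w}\<^sup>*"
proof (induction q arbitrary: x)
  case (Cons e q)
  obtain y where e: "e = (x, y)" using Cons.prems by (cases e) auto
  have "y \<in> set (pawalk_verts y q)" by (cases q) (use Cons.prems e in auto)
  then have "(x, y) \<in> {(a, b) \<in> E. a \<noteq> w \<and> b \<noteq> w}" using Cons.prems e by auto
  moreover have "(y, u) \<in> {(a, b) \<in> E. a \<noteq> w \<and> b \<noteq> w}\<^sup>*" using Cons e by auto
  ultimately show ?case by (rule converse_rtrancl_into_rtrancl)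
qed simp

lemma pcas_last: "pcas x q u \<Longrightarrow> last (pawalk_verts x q) = u"
proof (induction q arbitrary: x)
  case (Cons e q)
  then show ?case by (cases q) auto
qed simp

text \<open>The first arc of the cycle is the edge, the remaining arcs are the detour. After its
  start the detour avoids \<open>w\<close>, so it cannot use the edge in either direction.\<close>

lemma cycle_imp_detour:
  assumes "pre_digraph.cycle (with_proj G) p" "3 \<le> length p"
  shows "\<exists>u w. (u, w) \<in> parcs G \<and> (w, u) \<in> (parcs G - {(u, w), (w, u)})\<^sup>*"
proof -
  obtain u where u: "set p \<subseteq> parcs G" "pcas u p u" "distinct (tl (pawalk_verts u p))"
    using assms(1) by (auto simp: pre_digraph.cycle_def pre_digraph.awalk_def cas_with_proj_eq awalk_verts_with_proj_eq)
  \<comment> \<open>The third arc places \<open>u\<close> after \<open>x\<close> among distinct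
    vertices. Hence \<open>x \<noteq> u\<close>, and \<open>(w, x)\<close> is not the edge traversed
    backwards.\<close>
  obtain w x y q where p: "p = (u, w) # (w, x) # (x, y) # q"
  proof -
    obtain e1 e2 e3 q where "p = e1 # e2 # e3 # q" using assms(2) by (metis Suc_le_length_iff numeral_3_eq_3)
    then show ?thesis using u(2) that by (cases e1; cases e2; cases e3) auto
  qed
  let ?E = "parcs G - {(u, w), (w, u)}"
  have d: "distinct (w # x # pawalk_verts y q)" using u(3) p by simp
  have lst: "last (pawalk_verts y q) = u" using u(2) p pcas_last by force
  moreover have "pawalk_verts y q \<noteq> []" by (cases q) auto
  ultimately have "u \<in> set (pawalk_verts y q)" by (metis last_in_set)
  then have xu: "x \<noteq> u" "u \<noteq> w" using d by auto
  have "(x, u) \<in> {(a, b) \<in> parcs G. a \<noteq> w \<and> b \<noteq> w}\<^sup>*"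
    using pcas_rtrancl[of x "(x, y) # q" u "parcs G" w] u p d by auto
  moreover have "{(a, b) \<in> parcs G. a \<noteq> w \<and> b \<noteq> w} \<subseteq> ?E" by auto
  ultimately have "(x, u) \<in> ?E\<^sup>*" using rtrancl_mono by blast
  moreover have "(w, x) \<in> ?E" using u(1) p xu d by auto
  ultimately have "(w, u) \<in> ?E\<^sup>*" by (rule converse_rtrancl_into_rtrancl[rotated])
  moreover have "(u, w) \<in> parcs G" using u(1) p by auto
  ultimately show ?thesis by blast
qed

lemma normal_dual_graph_connected:
  assumes "normal_pseudomanifold d X" "d \<ge> 1"
  shows "Digraph_Component.connected (with_proj (dual_graph d X))"
proof -
  let ?G = "mk_symmetric (with_proj (dual_graph d X))"
  have pure: "pure_complex d X" using assms by (simp add: normal_pseudomanifold_def weak_pseudomanifold_def)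
  note pf = pure_complex_facets[OF pure]
  have v: "pverts (dual_graph d X) = facets X" by (simp add: dual_graph_def)
  have "star (facets X) {} = facets X" by (auto simp: star_def)
  moreover have "{} \<in> X" using pure by (simp add: pure_complex_def simplicial_complex_def)
  ultimately have conn: "(\<phi>, \<psi>) \<in> (parcs (dual_graph d X))\<^sup>*" if "\<phi> \<in> facets X" "\<psi> \<in> facets X" for \<phi> \<psi>
    using star_connected[OF assms, of "{}" \<phi> \<psi>] that by (simp add: parcs_dual_graph[OF assms(2)])
  have "reachable (with_proj ?G) \<phi> \<psi>" if "\<phi> \<in> facets X" "(\<phi>, \<psi>) \<in> (parcs (dual_graph d X))\<^sup>*" for \<phi> \<psi>
    using that(2,1)
  proof (induction rule: rtrancl_induct)
    case base
    then show ?case using that v by (simp add: reachable_def)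
  next
    case (step y z)
    have "(y, z) \<in> parcs ?G" using step(2) by (auto simp: parcs_mk_symmetric)
    moreover have "z \<in> facets X" using step(2) by (auto simp: dual_graph_def)
    ultimately show ?case using step v by (auto simp: reachable_def intro: rtrancl_on_into_rtrancl_on)
  qed
  then show ?thesis unfolding connected_def strongly_connected_def using conn pf(2) v by auto
qed

lemma normal_tree_imp_stacked:
  assumes "normal_pseudomanifold d X" "d \<ge> 1"
    and "undirected_tree (with_proj (dual_graph d X))"
  shows "stacked (nat (d + 1)) (facets X)"
proof -
  have pure: "pure_complex d X" using assms by (simp add: normal_pseudomanifold_def weak_pseudomanifold_def)
  note pf = pure_complex_facets[OF pure]
  have "parcs (dual_graph d X) \<subseteq> pverts (dual_graph d X) \<times> pverts (dual_graph d X)"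
    by (auto simp: dual_graph_def)
  then have nc: "\<not> has_cycle (adj (nat (d + 1)) (facets X))"
    using has_cycle_imp_cycle[of "dual_graph d X"] assms(3)
    by (auto simp: undirected_tree_def parcs_dual_graph[OF assms(2)])
  have "\<sigma> \<in> X" if "\<phi> \<in> star (facets X) \<sigma>" for \<phi> \<sigma>
    using that pf(5) by (auto simp: star_def faces_of_def)
  then show ?thesis
    using star_connected[OF assms(1,2)] nc pf by (intro tree_imp_stacked) auto
qed

text \<open>Connectedness comes from normality, so only detours remain to be excluded. Both
  orientations of the edge are deleted because the graph is a symmetric digraph.\<close>

lemma normal_treeI:
  assumes "normal_pseudomanifold d X" "d \<ge> 1"
    and "\<And>\<phi> \<psi>. (\<phi>, \<psi>) \<in> adj (nat (d + 1)) (facets X) \<Longrightarrow>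
      (\<psi>, \<phi>) \<in> (adj (nat (d + 1)) (facets X) - {(\<phi>, \<psi>), (\<psi>, \<phi>)})\<^sup>* \<Longrightarrow> False"
  shows "undirected_tree (with_proj (dual_graph d X))"
  using normal_dual_graph_connected[OF assms(1,2)] cycle_imp_detour[of "dual_graph d X"] assms(3)
  unfolding undirected_tree_def parcs_dual_graph[OF assms(2)] by blast

text \<open>The bound of two facets over a ridge is attained by \<phi> and \<psi>. This makes the
  edges of the dual graph correspond to the ridges that lie in two facets.\<close>

lemma star_adj_Int:
  assumes "weak_pseudomanifold d X" "d \<ge> 1" "(\<phi>, \<psi>) \<in> adj (nat (d + 1)) (facets X)"
  shows "star (facets X) (\<phi> \<inter> \<psi>) = {\<phi>, \<psi>}"
proof -
  have pure: "pure_complex d X" using assms by (simp add: weak_pseudomanifold_def)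
  note pf = pure_complex_facets[OF pure]
  have a: "\<phi> \<in> facets X" "\<psi> \<in> facets X" "\<phi> \<noteq> \<psi>" "Suc (card (\<phi> \<inter> \<psi>)) = nat (d + 1)"
    using assms(3) by (auto simp: adj_def)
  have "\<phi> \<inter> \<psi> \<in> X" using a(1) pf(5) by (auto simp: faces_of_def)
  moreover have "fdim (\<phi> \<inter> \<psi>) = d - 1" using a(4) assms(2) by (auto simp: fdim_def)
  ultimately have "card (star (facets X) (\<phi> \<inter> \<psi>)) \<le> 2"
    using assms(1) by (auto simp: weak_pseudomanifold_def star_def)
  moreover have "card {\<phi>, \<psi>} = 2" using a by simp
  moreover have "{\<phi>, \<psi>} \<subseteq> star (facets X) (\<phi> \<inter> \<psi>)" "finite (star (facets X) (\<phi> \<inter> \<psi>))"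
    using a pf by (auto simp: star_def)
  ultimately show ?thesis by (metis card_seteq)
qed

section \<open>Stacked complexes are balls\<close>

lemma continuous_on_Max_image:
  fixes f :: "'i \<Rightarrow> 'b::topological_space \<Rightarrow> real"
  assumes "finite A" "A \<noteq> {}" "\<And>i. i \<in> A \<Longrightarrow> continuous_on S (f i)"
  shows "continuous_on S (\<lambda>x. Max ((\<lambda>i. f i x) ` A))"
  using assms
proof (induction rule: finite_ne_induct)
  case (insert i A)
  then have "continuous_on S (\<lambda>x. max (f i x) (Max ((\<lambda>i. f i x) ` A)))"
    by (intro continuous_on_max) auto
  then show ?case using insert.hyps by simp
qed simp

lemma continuous_on_Min_image:
  fixes f :: "'i \<Rightarrow> 'b::topological_space \<Rightarrow> real"
  assumes "finite A" "A \<noteq> {}" "\<And>i. i \<in> A \<Longrightarrow> continuous_on S (f i)"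
  shows "continuous_on S (\<lambda>x. Min ((\<lambda>i. f i x) ` A))"
  using assms
proof (induction rule: finite_ne_induct)
  case (insert i A)
  then have "continuous_on S (\<lambda>x. min (f i x) (Min ((\<lambda>i. f i x) ` A)))"
    by (intro continuous_on_min) auto
  then show ?case using insert.hyps by simp
qed simp

text \<open>Where \<open>m\<close> vanishes the quotient is 0 by convention, and this is also the
  limit: \<open>w / m\<close> stays bounded while \<open>g\<close> tends to 0. It gives continuity
  of a radial map at the origin.\<close>

lemma continuous_on_quotient_vanishing:
  fixes g w m :: "'b::topological_space \<Rightarrow> real"
  assumes "continuous_on S g" "continuous_on S w" "continuous_on S m"
    and bound: "\<And>x. x \<in> S \<Longrightarrow> \<bar>w x\<bar> \<le> C * m x" and zero: "\<And>x. x \<in> S \<Longrightarrow> m x = 0 \<Longrightarrow> g x = 0"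
  shows "continuous_on S (\<lambda>x. g x / m x * w x)"
  unfolding continuous_on_def
proof
  fix a assume a: "a \<in> S"
  have lim: "(g \<longlongrightarrow> g a) (at a within S)" "(w \<longlongrightarrow> w a) (at a within S)" "(m \<longlongrightarrow> m a) (at a within S)"
    using assms(1-3) a by (auto simp: continuous_on_def)
  show "((\<lambda>x. g x / m x * w x) \<longlongrightarrow> g a / m a * w a) (at a within S)"
  proof (cases "m a = 0")
    case False
    then show ?thesis using lim by (intro tendsto_intros)
  next
    case True
    have "(g \<longlongrightarrow> 0) (at a within S)" using lim(1) zero[OF a True] by simp
    then have l0: "((\<lambda>x. \<bar>g x\<bar> * \<bar>C\<bar>) \<longlongrightarrow> 0) (at a within S)"
      by (intro tendsto_mult_left_zero tendsto_rabs_zero)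
    have "\<bar>g x / m x * w x\<bar> \<le> \<bar>g x\<bar> * \<bar>C\<bar>" if x: "x \<in> S" for x
    proof (cases "m x = 0")
      case False
      have "\<bar>w x\<bar> \<le> \<bar>C\<bar> * \<bar>m x\<bar>" using bound[OF x] by (metis abs_ge_self abs_mult order_trans)
      then have "\<bar>w x\<bar> / \<bar>m x\<bar> \<le> \<bar>C\<bar>" using False by (simp add: divide_le_eq)
      then have "\<bar>g x\<bar> * (\<bar>w x\<bar> / \<bar>m x\<bar>) \<le> \<bar>g x\<bar> * \<bar>C\<bar>" by (intro mult_left_mono) auto
      then show ?thesis by (simp add: abs_mult)
    qed simp
    then have "\<forall>\<^sub>F x in at a within S. norm (g x / m x * w x) \<le> \<bar>g x\<bar> * \<bar>C\<bar>"
      by (auto simp: eventually_at_filter)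
    then have "((\<lambda>x. g x / m x * w x) \<longlongrightarrow> 0) (at a within S)"
      by (rule Lim_null_comparison) (rule l0)
    then show ?thesis using True by simp
  qed
qed

text \<open>Radial rescaling from one gauge to another.\<close>

lemma homeomorphic_gauge_bodies:
  fixes a b :: "(nat \<Rightarrow> real) \<Rightarrow> real" and E :: "(nat \<Rightarrow> real) set"
  assumes E: "\<And>t x. x \<in> E \<Longrightarrow> (\<lambda>i. t * x i) \<in> E"
    and cont: "continuous_on UNIV a" "continuous_on UNIV b"
    and hom: "\<And>t x. 0 \<le> t \<Longrightarrow> x \<in> E \<Longrightarrow> a (\<lambda>i. t * x i) = t * a x"
      "\<And>t x. 0 \<le> t \<Longrightarrow> x \<in> E \<Longrightarrow> b (\<lambda>i. t * x i) = t * b x"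
    and bound: "\<And>x i. x \<in> E \<Longrightarrow> \<bar>x i\<bar> \<le> C * a x" "\<And>x i. x \<in> E \<Longrightarrow> \<bar>x i\<bar> \<le> C * b x" and C: "0 < C"
  shows "top_of_set {x\<in>E. a x \<le> 1} homeomorphic_space top_of_set {x\<in>E. b x \<le> 1}"
proof -
  define r :: "((nat \<Rightarrow> real) \<Rightarrow> real) \<Rightarrow> ((nat \<Rightarrow> real) \<Rightarrow> real) \<Rightarrow> (nat \<Rightarrow> real) \<Rightarrow> nat \<Rightarrow> real" where
    "r a b x = (\<lambda>i. a x / b x * x i)" for a b x
  \<comment> \<open>Stated for arbitrary gauges, so that exchanging \<open>a\<close> and
    \<open>b\<close> provides the inverse map as well.\<close>
  have "continuous_on {x\<in>E. a x \<le> 1} (r a b) \<and> r a b ` {x\<in>E. a x \<le> 1} \<subseteq> {x\<in>E. b x \<le> 1} \<and>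
      (\<forall>x\<in>E. r b a (r a b x) = x)"
    if ab: "continuous_on UNIV a" "continuous_on UNIV b"
     "\<And>t x. 0 \<le> t \<Longrightarrow> x \<in> E \<Longrightarrow> a (\<lambda>i. t * x i) = t * a x"
      "\<And>t x. 0 \<le> t \<Longrightarrow> x \<in> E \<Longrightarrow> b (\<lambda>i. t * x i) = t * b x"
     "\<And>x i. x \<in> E \<Longrightarrow> \<bar>x i\<bar> \<le> C * a x" "\<And>x i. x \<in> E \<Longrightarrow> \<bar>x i\<bar> \<le> C * b x"
   for a b :: "(nat \<Rightarrow> real) \<Rightarrow> real"
  proof (intro conjI ballI)
    \<comment> \<open>The bounds by \<open>C\<close> make both gauges definite, so a denominator can
      vanish at the origin only.\<close>
    have z: "x = (\<lambda>i. 0)" if "x \<in> E" "a x = 0 \<or> b x = 0" for x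
      using that ab(5,6)[OF that(1)] by fastforce
    have z0: "a x = 0 \<and> b x = 0" if "x \<in> E" "a x = 0 \<or> b x = 0" for x
      using z[OF that] ab(3,4)[of 0 x] that(1) by simp
    have pos: "a x \<ge> 0" "b x \<ge> 0" if "x \<in> E" for x
      using ab(5,6)[OF that, of 0] C by (auto simp: zero_le_mult_iff dest!: order_trans[OF abs_ge_zero])
    show "continuous_on {x\<in>E. a x \<le> 1} (r a b)"
      unfolding r_def
    proof (rule continuous_on_coordinatewise_then_product)
      fix i
      show "continuous_on {x\<in>E. a x \<le> 1} (\<lambda>x. a x / b x * x i)"
      proof (rule continuous_on_quotient_vanishing[where C = C])
        show "continuous_on {x\<in>E. a x \<le> 1} a" "continuous_on {x\<in>E. a x \<le> 1} b"
          using ab(1,2) continuous_on_subset by blast+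
        show "continuous_on {x\<in>E. a x \<le> 1} (\<lambda>x. x i)"
          by (rule continuous_on_subset[OF continuous_on_product_coordinates]) simp
        show "\<bar>x i\<bar> \<le> C * b x" if "x \<in> {x\<in>E. a x \<le> 1}" for x using ab(6)[of x i] that by blast
        show "a x = 0" if "x \<in> {x\<in>E. a x \<le> 1}" "b x = 0" for x using z0[of x] that by blast
      qed
    qed
    show "r a b ` {x\<in>E. a x \<le> 1} \<subseteq> {x\<in>E. b x \<le> 1}"
    proof
      fix y assume "y \<in> r a b ` {x\<in>E. a x \<le> 1}"
      then obtain x where x: "x \<in> E" "a x \<le> 1" "y = r a b x" by auto
      have "b y = a x / b x * b x" using x ab(4)[of "a x / b x" x] pos by (simp add: r_def)
      then have "b y \<le> 1" using x by (cases "b x = 0") auto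
      moreover have "r a b x \<in> E" unfolding r_def by (rule E[OF x(1)])
      ultimately show "y \<in> {x\<in>E. b x \<le> 1}" using x(3) by simp
    qed
    fix x assume x: "x \<in> E"
    show "r b a (r a b x) = x"
    proof (cases "a x = 0 \<or> b x = 0")
      case True
      then show ?thesis using z[OF x True] by (simp add: r_def)
    next
      case False
      then show ?thesis using x ab(3,4)[of "a x / b x" x] pos[OF x] by (auto simp: r_def fun_eq_iff)
    qed
  qed
  from this[of a b] this[of b a] cont hom bound
  have "homeomorphic_maps (top_of_set {x\<in>E. a x \<le> 1}) (top_of_set {x\<in>E. b x \<le> 1}) (r a b) (r b a)"
    by (auto simp: homeomorphic_maps_def image_subset_iff_funcset)
  then show ?thesis by (auto simp: homeomorphic_space_def)
qed

lemma realizationI: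
  assumes "\<And>v. 0 \<le> x v" "{v. x v \<noteq> 0} \<in> X" "finite U" "{v. x v \<noteq> 0} \<subseteq> U" "sum x U = 1"
  shows "x \<in> realization X"
proof -
  have "sum x U = sum x {v. x v \<noteq> 0}" using assms(3,4) by (intro sum.mono_neutral_right) auto
  then show ?thesis using assms by (simp add: realization_def)
qed

lemma realizationD:
  assumes "x \<in> realization X" "finite U" "{v. x v \<noteq> 0} \<subseteq> U"
  shows "\<And>v. 0 \<le> x v" "{v. x v \<noteq> 0} \<in> X" "sum x U = 1"
proof -
  have "sum x U = sum x {v. x v \<noteq> 0}" using assms(2,3) by (intro sum.mono_neutral_right) auto
  then show "sum x U = 1" using assms(1) by (simp add: realization_def)
qed (use assms(1) in \<open>auto simp: realization_def\<close>)

lemma closed_ball_space_eq: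
  "closed_ball_space d = top_of_set {x \<in> {x. \<forall>i\<ge>d. x i = 0}. sqrt (\<Sum>i<d. (x i)\<^sup>2) \<le> 1}"
  unfolding closed_ball_space_def Euclidean_space_def euclidean_product_topology subtopology_subtopology
  by (simp add: Collect_conj_eq[symmetric])

text \<open>With its barycenter moved to the origin, the simplex is the unit body of a gauge
  \<open>a\<close>. Radial rescaling turns it into the unit body of the Euclidean norm
  \<open>b\<close>.\<close>

lemma simplex_homeomorphic_ball:
  assumes "finite \<sigma>" "card \<sigma> = Suc d"
  shows "geometric_realization (Pow \<sigma>) homeomorphic_space closed_ball_space d"
proof -
  define E where "E = {x::nat \<Rightarrow> real. \<forall>i\<ge>d. x i = 0}"
  \<comment> \<open>The \<open>d + 1\<close> barycentric coordinates diminished by their value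
    \<open>c\<close> at the barycenter. They add up to 0, so the last one is determined by the first
    \<open>d\<close>, which serve as coordinates.\<close>
  define e where "e x j = (if j < d then x j else - (\<Sum>i<d. x i))" for x :: "nat \<Rightarrow> real" and j
  define c where "c = 1 / real (Suc d)"
  have c: "c > 0" "real (Suc d) * c = 1" by (auto simp: c_def)
  \<comment> \<open>Barycentric coordinates are nonnegative if \<open>- e x j \<le> c\<close> for
    all \<open>j\<close>; the factor \<open>Suc d\<close>, the inverse of \<open>c\<close>,
    normalizes this to \<open>a x \<le> 1\<close>.\<close>
  define a where "a x = real (Suc d) * Max ((\<lambda>j. - e x j) ` {..d})" for x
  define b where "b x = sqrt (\<Sum>i<d. (x i)\<^sup>2)" for x :: "nat \<Rightarrow> real"
  have esum: "(\<Sum>j\<le>d. e x j) = 0" for x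
  proof -
    have "{..d} = insert d {..<d}" by auto
    then show ?thesis by (simp add: e_def)
  qed
  have ae: "- e x j \<le> c * a x" if "j \<le> d" for x j
  proof -
    have "- e x j \<le> Max ((\<lambda>j. - e x j) ` {..d})" using that by (intro Max_ge) auto
    then show ?thesis using c(2) by (simp add: a_def mult.assoc[symmetric] mult.commute)
  qed
  have a_le: "a x \<le> 1 \<longleftrightarrow> (\<forall>j\<le>d. - e x j \<le> c)" for x
  proof -
    have "a x \<le> 1 \<longleftrightarrow> Max ((\<lambda>j. - e x j) ` {..d}) \<le> c" by (simp add: a_def c_def field_simps)
    also have "\<dots> \<longleftrightarrow> (\<forall>j\<le>d. - e x j \<le> c)" by (subst Max_le_iff) auto
    finally show ?thesis .
  qed
  have cont_e: "continuous_on UNIV (\<lambda>x. e x j)" for j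
    unfolding e_def by (cases "j < d") (auto intro!: continuous_intros continuous_on_product_coordinates)
  have hom1: "top_of_set {x\<in>E. a x \<le> 1} homeomorphic_space top_of_set {x\<in>E. b x \<le> 1}"
  proof (rule homeomorphic_gauge_bodies[where C = "real (Suc d)"])
    show "continuous_on UNIV a" unfolding a_def
      by (intro continuous_intros continuous_on_Max_image cont_e) auto
    show "continuous_on UNIV b" unfolding b_def
      by (intro continuous_intros continuous_on_product_coordinates)
    fix t :: real and x assume t: "0 \<le> t" and x: "x \<in> E"
    have "- e (\<lambda>i. t * x i) j = t * - e x j" for j by (simp add: e_def sum_distrib_left)
    then have "(\<lambda>j. - e (\<lambda>i. t * x i) j) ` {..d} = (\<lambda>y. t * y) ` ((\<lambda>j. - e x j) ` {..d})"
      by (simp add: image_image)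
    moreover have "Max ((\<lambda>y. t * y) ` ((\<lambda>j. - e x j) ` {..d})) = t * Max ((\<lambda>j. - e x j) ` {..d})"
      using t by (intro mono_Max_commute[symmetric]) (auto intro: monoI mult_left_mono)
    ultimately show "a (\<lambda>i. t * x i) = t * a x" by (simp add: a_def)
    show "b (\<lambda>i. t * x i) = t * b x"
      using t by (simp add: b_def power_mult_distrib sum_distrib_left[symmetric] real_sqrt_mult)
  next
    fix x i assume x: "x \<in> E"
    show "\<bar>x i\<bar> \<le> real (Suc d) * b x"
    proof (cases "i < d")
      case True
      have "\<bar>x i\<bar> = sqrt ((x i)\<^sup>2)" by simp
      also have "\<dots> \<le> 1 * b x" unfolding b_def mult_1 using True by (intro real_sqrt_le_mono member_le_sum) auto
      also have "1 * b x \<le> real (Suc d) * b x"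
        by (rule mult_right_mono) (simp_all add: b_def sum_nonneg)
      finally show ?thesis by simp
    qed (use x in \<open>auto simp: E_def b_def sum_nonneg\<close>)
    show "\<bar>x i\<bar> \<le> real (Suc d) * a x"
    proof -
      \<comment> \<open>All summands are nonnegative by \<open>ae\<close>, and the deviations
        \<open>e x j\<close> cancel in the sum, which leaves \<open>a x\<close>.\<close>
      have "0 \<le> (\<Sum>j\<le>d. c * a x + e x j)" using ae[of _ x] by (intro sum_nonneg) (force simp: algebra_simps)
      also have "\<dots> = a x" using esum[of x] c(2) by (simp add: sum.distrib mult.assoc[symmetric])
      finally have ca: "0 \<le> a x" .
      show ?thesis
      proof (cases "i < d")
        case True
        \<comment> \<open>A single summand is at most the sum of the nonnegative terms; this bounds
          the coordinate from above, while \<open>ae\<close> bounds it from below.\<close>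
        have "x i + c * a x \<le> (\<Sum>j\<le>d. c * a x + e x j)"
          using ae[of _ x] True member_le_sum[of i "{..d}" "\<lambda>j. c * a x + e x j"] by (force simp: e_def algebra_simps)
        also have "\<dots> = a x" using esum[of x] c(2) by (simp add: sum.distrib mult.assoc[symmetric])
        finally have u: "x i \<le> a x" using ca c by (smt (verit) mult_nonneg_nonneg)
        have "- x i \<le> c * a x" using ae[of i x] True by (simp add: e_def)
        moreover have "c \<le> 1" by (simp add: c_def)
        ultimately have "- x i \<le> a x" using ca by (smt (verit) mult_left_le_one_le c(1))
        then have "\<bar>x i\<bar> \<le> 1 * a x" using u by simp
        also have "1 * a x \<le> real (Suc d) * a x" using ca by (intro mult_right_mono) simp_all
        finally show ?thesis by simp
      qed (use x ca in \<open>auto simp: E_def\<close>)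
    qed
  qed (auto simp: E_def)
  obtain h where h: "bij_betw h {..d} \<sigma>"
    using assms ex_bij_betw_nat_finite[of \<sigma>] by (auto simp: lessThan_Suc_atMost atLeast0LessThan)
  define hi where "hi = inv_into {..d} h"
  have hi: "\<And>j. j \<le> d \<Longrightarrow> hi (h j) = j" "\<And>u. u \<in> \<sigma> \<Longrightarrow> h (hi u) = u" "\<And>u. u \<in> \<sigma> \<Longrightarrow> hi u \<le> d" "\<And>j. j \<le> d \<Longrightarrow> h j \<in> \<sigma>"
    using h by (auto simp: hi_def bij_betw_def inv_into_into[of _ h "{..d}", simplified] f_inv_into_f inv_into_f_f
        intro: inv_into_into[of _ h "{..d}", simplified])
  define f where "f x = (\<lambda>i. if i < d then x (h i) - c else 0)" for x :: "'a \<Rightarrow> real"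
  define g where "g y = (\<lambda>u. if u \<in> \<sigma> then c + e y (hi u) else 0)" for y
  have cf: "continuous_on UNIV f" unfolding f_def
  proof (intro continuous_on_coordinatewise_then_product)
    show "continuous_on UNIV (\<lambda>x. if i < d then x (h i) - c else 0)" for i
      by (cases "i < d") (auto intro!: continuous_intros continuous_on_product_coordinates)
  qed
  have cg: "continuous_on UNIV g" unfolding g_def
  proof (intro continuous_on_coordinatewise_then_product)
    show "continuous_on UNIV (\<lambda>y. if u \<in> \<sigma> then c + e y (hi u) else 0)" for u
      by (cases "u \<in> \<sigma>") (auto intro!: continuous_intros cont_e)
  qed
  have sum_h: "(\<Sum>j\<le>d. x (h j)) = sum x \<sigma>" for x :: "'a \<Rightarrow> real"
    using sum.reindex_bij_betw[OF h] by blast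
  have supp: "{v. x v \<noteq> 0} \<subseteq> \<sigma>" if "x \<in> realization (Pow \<sigma>)" for x using that by (auto simp: realization_def)
  have ef: "e (f x) j = x (h j) - c" if x: "x \<in> realization (Pow \<sigma>)" and j: "j \<le> d" for x j
  proof (cases "j < d")
    case False
    then have "j = d" using j by simp
    have "(\<Sum>j\<le>d. x (h j)) = 1" using sum_h realizationD(3)[OF x assms(1) supp[OF x]] by simp
    moreover have "{..d} = insert d {..<d}" by auto
    ultimately have "x (h d) + (\<Sum>j<d. x (h j)) = 1" by simp
    moreover have "real d * c + c = 1" using c(2) by (simp add: algebra_simps)
    ultimately show ?thesis using \<open>j = d\<close> by (simp add: e_def f_def sum_subtractf)
  qed (simp add: e_def f_def)
  have fm: "f x \<in> {x\<in>E. a x \<le> 1}" if x: "x \<in> realization (Pow \<sigma>)" for x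
    using ef[OF x] realizationD(1)[OF x assms(1) supp[OF x]] by (auto simp: E_def a_le) (simp add: f_def)
  have gm: "g y \<in> realization (Pow \<sigma>)" if y: "y \<in> {x\<in>E. a x \<le> 1}" for y
  proof (rule realizationI[where U = \<sigma>])
    show "0 \<le> g y v" for v using y hi(3) by (force simp: g_def a_le)
    have "sum (g y) \<sigma> = (\<Sum>j\<le>d. g y (h j))" using sum_h by simp
    also have "\<dots> = (\<Sum>j\<le>d. c + e y j)" using hi by (intro sum.cong) (auto simp: g_def)
    also have "\<dots> = 1" using esum[of y] c by (simp add: sum.distrib)
    finally show "sum (g y) \<sigma> = 1" .
  qed (use assms in \<open>auto simp: g_def\<close>)
  have gf: "g (f x) = x" if x: "x \<in> realization (Pow \<sigma>)" for x
    using ef[OF x] hi supp[OF x] by (auto simp: g_def fun_eq_iff)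
  have fg: "f (g y) = y" if y: "y \<in> {x\<in>E. a x \<le> 1}" for y
  proof
    fix i show "f (g y) i = y i" using y hi(1)[of i] hi(4)[of i]
      by (cases "i < d") (auto simp: f_def g_def E_def e_def)
  qed
  have "homeomorphic_maps (top_of_set (realization (Pow \<sigma>))) (top_of_set {x\<in>E. a x \<le> 1}) f g"
    using cf cg fm gm gf fg unfolding homeomorphic_maps_def
    by (auto simp: image_subset_iff intro: continuous_on_subset)
  then have "top_of_set (realization (Pow \<sigma>)) homeomorphic_space top_of_set {x\<in>E. a x \<le> 1}"
    by (auto simp: homeomorphic_space_def)
  with hom1 have "top_of_set (realization (Pow \<sigma>)) homeomorphic_space top_of_set {x\<in>E. b x \<le> 1}"
    by (rule homeomorphic_space_trans[rotated])
  then show ?thesis by (simp add: geometric_realization_eq closed_ball_space_eq E_def b_def)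
qed

section \<open>Gluing a simplex along a ridge does not change the homeomorphism type\<close>

text \<open>Summing over a fixed finite set \<open>U\<close> instead of the support makes the
  condition linear in \<open>x\<close>, which suits convex combinations and transfers of
  weight.\<close>

lemma realization_faces_of:
  assumes "finite U" "\<Union>F \<subseteq> U"
  shows "x \<in> realization (faces_of F) \<longleftrightarrow>
    (\<forall>v. 0 \<le> x v) \<and> (\<exists>\<xi>\<in>F. \<forall>v. x v \<noteq> 0 \<longrightarrow> v \<in> \<xi>) \<and> sum x U = 1"
  (is "?L \<longleftrightarrow> ?R")
proof
  assume L: ?L
  then have "{v. x v \<noteq> 0} \<in> faces_of F" by (auto simp: realization_def)
  then obtain \<xi> where \<xi>: "\<xi> \<in> F" "{v. x v \<noteq> 0} \<subseteq> \<xi>" by (auto simp: faces_of_def)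
  then have "{v. x v \<noteq> 0} \<subseteq> U" using assms by auto
  then show ?R using realizationD[OF L assms(1)] \<xi> by blast
next
  assume R: ?R
  then obtain \<xi> where "\<xi> \<in> F" "{v. x v \<noteq> 0} \<subseteq> \<xi>" by auto
  then show ?L using R assms by (intro realizationI[of x _ U]) (auto simp: faces_of_def)
qed

text \<open>The new simplex and its neighbour \<open>insert c \<alpha>\<close> form a bipyramid over \<open>\<alpha>\<close>, which is pushed
  linearly into the neighbour along the lines through the two apices, keeping the part of its
  boundary that meets the rest of the complex fixed.\<close>

lemma homeomorphic_glue_simplex:
  fixes F :: "'a set set"
  assumes fin: "finite F" "\<And>\<xi>. \<xi> \<in> F \<Longrightarrow> finite \<xi>"
    and c: "insert c \<alpha> \<in> F" "c \<notin> \<alpha>" and \<alpha>: "\<alpha> \<noteq> {}"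
    and unique: "\<And>\<xi>. \<xi> \<in> F \<Longrightarrow> \<alpha> \<subseteq> \<xi> \<Longrightarrow> \<xi> = insert c \<alpha>" and b: "b \<notin> \<Union>F"
  shows "geometric_realization (faces_of (insert (insert b \<alpha>) F)) homeomorphic_space
    geometric_realization (faces_of F)"
proof -
  let ?F' = "insert (insert b \<alpha>) F"
  have f\<alpha>: "finite \<alpha>" using fin(2)[OF c(1)] by simp
  define k where "k = real (card \<alpha>)"
  have k: "k > 0" using f\<alpha> \<alpha> by (simp add: k_def card_gt_0_iff)
  have bc: "b \<noteq> c" "b \<notin> \<alpha>" using b c by auto
  define U where "U = insert b (\<Union>F)"
  have U: "finite U" "\<Union>F \<subseteq> U" "\<Union>?F' \<subseteq> U" using fin c by (auto simp: U_def)
  define W where "W = U - insert b (insert c \<alpha>)"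
  have split: "sum x U = x b + x c + sum x \<alpha> + sum x W" for x :: "'a \<Rightarrow> real"
  proof -
    have "U = insert b (insert c \<alpha>) \<union> W" "insert b (insert c \<alpha>) \<inter> W = {}" using c by (auto simp: W_def U_def)
    moreover have "finite W" using U by (simp add: W_def)
    ultimately have "sum x U = sum x (insert b (insert c \<alpha>)) + sum x W"
      using f\<alpha> by (metis finite_insert sum.union_disjoint)
    then show ?thesis using bc c f\<alpha> by simp
  qed
  \<comment> \<open>On points of the two realizations \<open>m\<close> is positive exactly if the
    support contains \<alpha>, so it vanishes on all faces along which the rest of the complex is
    attached.\<close>
  define m where "m x = Min (x ` \<alpha>)" for x :: "'a \<Rightarrow> real"
  \<comment> \<open>Each vertex of \<alpha> gives half of \<open>m x\<close> to \<open>c\<close>,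
    and the weight of \<open>b\<close> is spread evenly over the \<open>k\<close> vertices of
    \<alpha>. The total weight does not change, and the minimum over \<alpha> becomes
    \<open>m x / 2 + x b / k\<close>.\<close>
  define h where "h x = (\<lambda>u. if u = c then x c + k * m x / 2 else if u = b then 0
    else if u \<in> \<alpha> then x u - m x / 2 + x b / k else x u)" for x
  \<comment> \<open>For \<open>z = h x\<close> the difference \<open>z c - k * m z\<close> equals
    \<open>x c - x b\<close>. As one of \<open>x b\<close> and \<open>x c\<close> is 0, this
    recovers both, and \<open>2 * min (m z) (z c / k)\<close> recovers \<open>m x\<close>. The image
    of the ridge is the set where \<open>z c = k * m z\<close>.\<close>
  define g where "g z = (\<lambda>u. if u = c then max 0 (z c - k * m z) else if u = b then max 0 (k * m z - z c)
    else if u \<in> \<alpha> then z u - m z + 2 * min (m z) (z c / k) else z u)" for z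
  have cm: "continuous_on UNIV m" unfolding m_def
    using f\<alpha> \<alpha> continuous_on_Min_image[of \<alpha> UNIV "\<lambda>i x. x i"] by (simp add: continuous_on_product_coordinates)
  have ch: "continuous_on UNIV h" unfolding h_def
  proof (intro continuous_on_coordinatewise_then_product)
    fix u show "continuous_on UNIV (\<lambda>x. if u = c then x c + k * m x / 2 else if u = b then 0
      else if u \<in> \<alpha> then x u - m x / 2 + x b / k else x u)"
      using k by (cases "u = c"; cases "u = b"; cases "u \<in> \<alpha>")
        (auto intro!: continuous_intros cm continuous_on_product_coordinates)
  qed
  have cg: "continuous_on UNIV g" unfolding g_def
  proof (intro continuous_on_coordinatewise_then_product)
    fix u show "continuous_on UNIV (\<lambda>z. if u = c then max 0 (z c - k * m z) else if u = b then max 0 (k * m z - z c)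
    else if u \<in> \<alpha> then z u - m z + 2 * min (m z) (z c / k) else z u)"
      using k by (cases "u = c"; cases "u = b"; cases "u \<in> \<alpha>")
        (auto intro!: continuous_intros cm continuous_on_product_coordinates)
  qed
  have m_le: "m x \<le> x u" if "u \<in> \<alpha>" for x u using that f\<alpha> by (simp add: m_def)
  have m_nonneg: "0 \<le> m x" if "\<And>u. 0 \<le> x u" for x using that f\<alpha> \<alpha> by (simp add: m_def)
  have m_pos: "u \<in> \<alpha> \<Longrightarrow> x u \<noteq> 0" if "0 < m x" for x u using m_le[of u x] that by auto
  have m_shift: "m y = m x + s" if "\<And>u. u \<in> \<alpha> \<Longrightarrow> y u = x u + s" for x y :: "'a \<Rightarrow> real" and s
  proof -
    have "y ` \<alpha> = (\<lambda>t. t + s) ` (x ` \<alpha>)" using that by (auto simp: image_image)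
    moreover have "Min ((\<lambda>t. t + s) ` (x ` \<alpha>)) = Min (x ` \<alpha>) + s"
      using f\<alpha> \<alpha> by (intro mono_Min_commute[symmetric]) (auto intro: monoI)
    ultimately show ?thesis by (simp add: m_def)
  qed
  have sum_shift: "sum y \<alpha> = sum x \<alpha> + k * s" if "\<And>u. u \<in> \<alpha> \<Longrightarrow> y u = x u + s" for x y :: "'a \<Rightarrow> real" and s
    using that by (simp add: sum.distrib k_def)
  have h\<alpha>: "h x u = x u + (x b / k - m x / 2)" if "u \<in> \<alpha>" for x u using that c bc by (auto simp: h_def)
  have g\<alpha>: "g z u = z u + (2 * min (m z) (z c / k) - m z)" if "u \<in> \<alpha>" for z u using that c bc by (auto simp: g_def)
  have hW: "sum (h x) W = sum x W" for x by (rule sum.cong) (auto simp: h_def W_def)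
  have gW: "sum (g x) W = sum x W" for x by (rule sum.cong) (auto simp: g_def W_def)
  have kmin: "k * min (m z) (z c / k) = min (k * m z) (z c)" for z
    using k by (simp add: min_mult_distrib_left)
  let ?R' = "realization (faces_of ?F')" and ?R = "realization (faces_of F)"
  have xbc: "x b = 0 \<or> x c = 0" if "x \<in> ?R'" for x
    using that b bc c unfolding realization_faces_of[OF U(1,3)] by blast
  have zb: "z b = 0" if "z \<in> ?R" for z
    using that b unfolding realization_faces_of[OF U(1,2)] by blast
  have hR: "h x \<in> ?R" if x: "x \<in> ?R'" for x
    unfolding realization_faces_of[OF U(1,2)]
  proof (intro conjI allI)
    have nn: "0 \<le> x v" for v using x unfolding realization_faces_of[OF U(1,3)] by auto
    note m0 = m_nonneg[of x, OF nn]
    show "0 \<le> h x v" for v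
      using nn[of v] nn[of b] nn[of c] m0 m_le[of v x] k by (auto simp: h_def)
    have "sum (h x) U = sum x U"
      using sum_shift[of "h x" x, OF h\<alpha>] k bc unfolding split hW by (simp add: h_def algebra_simps)
    then show "sum (h x) U = 1" using x unfolding realization_faces_of[OF U(1,3)] by simp
    obtain \<xi> where \<xi>: "\<xi> \<in> ?F'" "\<forall>v. x v \<noteq> 0 \<longrightarrow> v \<in> \<xi>"
      using x unfolding realization_faces_of[OF U(1,3)] by auto
    \<comment> \<open>Either the support lies in the bipyramid, which is mapped into the neighbour,
      or it misses a vertex of \<alpha>, and then \<open>m x = 0\<close> and \<open>h\<close> fixes
      \<open>x\<close>.\<close>
    show "\<exists>\<xi>\<in>F. \<forall>v. h x v \<noteq> 0 \<longrightarrow> v \<in> \<xi>"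
    proof (cases "\<xi> = insert b \<alpha> \<or> \<alpha> \<subseteq> \<xi>")
      case True
      then have "\<xi> \<subseteq> insert b (insert c \<alpha>)" using \<xi> unique by blast
      then show ?thesis using \<xi>(2) c(1) by (intro bexI[of _ "insert c \<alpha>"]) (auto simp: h_def)
    next
      case False
      then have "\<xi> \<in> F" "\<not> 0 < m x" using \<xi> m_pos[of x] by auto
      then have "m x = 0" "x b = 0" using m0 \<xi> b by auto
      then have "h x = x" by (auto simp: h_def fun_eq_iff)
      then show ?thesis using \<xi> \<open>\<xi> \<in> F\<close> by auto
    qed
  qed
  have gR: "g z \<in> ?R'" if z: "z \<in> ?R" for z
    unfolding realization_faces_of[OF U(1,3)]
  proof (intro conjI allI)
    have nn: "0 \<le> z v" for v using z unfolding realization_faces_of[OF U(1,2)] by auto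
    note m0 = m_nonneg[of z, OF nn]
    have "0 \<le> min (m z) (z c / k)" using m0 nn[of c] k by auto
    then show "0 \<le> g z v" for v
      using nn[of v] m_le[of v z] by (auto simp: g_def)
    have "sum (g z) U = sum z U"
      using sum_shift[of "g z" z, OF g\<alpha>] zb[OF z] bc kmin[of z] unfolding split gW
      by (simp add: g_def algebra_simps) (auto simp: max_def min_def)
    then show "sum (g z) U = 1" using z unfolding realization_faces_of[OF U(1,2)] by simp
    obtain \<xi> where \<xi>: "\<xi> \<in> F" "\<forall>v. z v \<noteq> 0 \<longrightarrow> v \<in> \<xi>"
      using z unfolding realization_faces_of[OF U(1,2)] by auto
    show "\<exists>\<xi>\<in>?F'. \<forall>v. g z v \<noteq> 0 \<longrightarrow> v \<in> \<xi>"
    proof (cases "\<alpha> \<subseteq> \<xi>")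
      case True
      then have \<xi>': "\<xi> = insert c \<alpha>" using \<xi> unique by blast
      show ?thesis
      proof (cases "z c \<ge> k * m z")
        case True
        then show ?thesis using \<xi> \<xi>' c(1) by (intro bexI[of _ "insert c \<alpha>"]) (auto simp: g_def)
      next
        case False
        then show ?thesis using \<xi> \<xi>' by (intro bexI[of _ "insert b \<alpha>"]) (auto simp: g_def)
      qed
    next
      case False
      then have "\<not> 0 < m z" using \<xi> m_pos[of z] by auto
      then have "m z = 0" "z b = 0" "0 \<le> z c / k" using m0 zb[OF z] nn[of c] k by auto
      then have "g z = z" using nn[of c] by (auto simp: g_def fun_eq_iff)
      then show ?thesis using \<xi> by auto
    qed
  qed
  have gh: "g (h x) = x" if x: "x \<in> ?R'" for x
  proof
    fix u
    have nn: "0 \<le> x v" for v using x unfolding realization_faces_of[OF U(1,3)] by auto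
    have mh: "m (h x) = m x + (x b / k - m x / 2)" by (rule m_shift) (rule h\<alpha>)
    have hc: "h x c = x c + k * m x / 2" by (simp add: h_def)
    have kmh: "k * m (h x) = k * m x / 2 + x b" using mh k by (simp add: field_simps)
    have mi: "min (m (h x)) (h x c / k) = m x / 2"
      using xbc[OF x] nn[of b] nn[of c] k unfolding mh hc by (auto simp: min_def field_simps)
    consider "u = c" | "u = b" | "u \<in> \<alpha>" | "u \<noteq> c" "u \<noteq> b" "u \<notin> \<alpha>" by blast
    then show "g (h x) u = x u"
    proof cases
      case 1
      then show ?thesis using xbc[OF x] nn[of b] nn[of c] kmh hc by (auto simp: g_def)
    next
      case 2
      then show ?thesis using xbc[OF x] nn[of b] nn[of c] kmh hc bc by (auto simp: g_def)
    next
      case 3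
      then show ?thesis using mi mh g\<alpha>[of u "h x"] h\<alpha>[of u x] by simp
    qed (simp add: g_def h_def)
  qed
  have hg: "h (g z) = z" if z: "z \<in> ?R" for z
  proof
    fix u
    let ?\<mu> = "min (m z) (z c / k)"
    have mg: "m (g z) = m z + (2 * ?\<mu> - m z)" by (rule m_shift) (rule g\<alpha>)
    have gb: "g z b / k = max 0 (m z - z c / k)" using bc k by (auto simp: g_def max_def field_simps)
    have gc: "g z c = max 0 (z c - k * m z)" by (simp add: g_def)
    consider "u = c" | "u = b" | "u \<in> \<alpha>" | "u \<noteq> c" "u \<noteq> b" "u \<notin> \<alpha>" by blast
    then show "h (g z) u = z u"
    proof cases
      case 1
      then show ?thesis using mg gc kmin[of z] by (simp add: h_def)
    next
      case 2
      then show ?thesis using zb[OF z] bc by (simp add: h_def)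
    next
      case 3
      then show ?thesis using h\<alpha>[of u "g z"] g\<alpha>[of u z] mg gb by (auto simp: max_def min_def)
    qed (simp add: g_def h_def)
  qed
  have "homeomorphic_maps (top_of_set ?R') (top_of_set ?R) h g"
    using ch cg hR gR gh hg unfolding homeomorphic_maps_def
    by (auto simp: image_subset_iff intro: continuous_on_subset)
  then show ?thesis by (auto simp: homeomorphic_space_def geometric_realization_eq)
qed

lemma stacked_homeomorphic_ball:
  assumes "stacked n F" "2 \<le> n"
  shows "geometric_realization (faces_of F) homeomorphic_space closed_ball_space (n - 1)"
  using assms(1)
proof induction
  case (stacked_simplex \<phi>)
  have "faces_of {\<phi>} = Pow \<phi>" by (auto simp: faces_of_def)
  then show ?case using stacked_simplex simplex_homeomorphic_ball[of \<phi> "n - 1"] assms(2) by simp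
next
  case (stacked_step F \<psi> \<alpha> b)
  note f = stacked_facets[OF stacked_step.hyps(1)]
  have \<psi>: "finite \<psi>" "card \<psi> = n" using f stacked_step.hyps(2) by auto
  then have "card (\<psi> - \<alpha>) = 1" using stacked_step.hyps(3,4) finite_subset by (subst card_Diff_subset) auto
  then obtain c where "\<psi> - \<alpha> = {c}" by (auto simp: card_1_singleton_iff)
  then have c: "\<psi> = insert c \<alpha>" "c \<notin> \<alpha>" using stacked_step.hyps(3) by auto
  \<comment> \<open>For \<open>n = 1\<close> the ridge would be empty and the result two isolated
    points.\<close>
  have "\<alpha> \<noteq> {}" using stacked_step.hyps(4) assms(2) by auto
  then have "geometric_realization (faces_of (insert (insert b \<alpha>) F)) homeomorphic_space
    geometric_realization (faces_of F)"
    using homeomorphic_glue_simplex[of F c \<alpha> b] f c stacked_step.hyps(2,5,6) by metis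
  then show ?case using stacked_step.IH by (rule homeomorphic_space_trans)
qed

text \<open>If \<sigma> lies in the new simplex, it is too small to contain \<alpha>. Dropping a
  vertex of \<alpha> outside \<sigma> from the new simplex leaves a ridge through the new vertex
  \<open>b\<close>, which no other facet contains. Otherwise the ridge found earlier is not in the
  new simplex either, and its star does not change.\<close>

lemma stacked_codim2_face:
  assumes "stacked n F" "\<sigma> \<in> faces_of F" "card \<sigma> + 2 \<le> n"
  shows "\<exists>\<rho>. \<sigma> \<subseteq> \<rho> \<and> Suc (card \<rho>) = n \<and> (\<exists>\<phi>. star F \<rho> = {\<phi>})"
  using assms
proof (induction arbitrary: \<sigma>)
  case (stacked_simplex \<phi>)
  have "\<sigma> \<subseteq> \<phi>" using stacked_simplex.prems(1) by (simp add: faces_of_def)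
  moreover have "card \<sigma> \<noteq> card \<phi>" using stacked_simplex.prems(2) stacked_simplex.hyps(2) by linarith
  ultimately have "\<not> \<phi> \<subseteq> \<sigma>" by (metis subset_antisym)
  then obtain v where "v \<in> \<phi>" "v \<notin> \<sigma>" by blast
  then show ?case using stacked_simplex
    by (intro exI[of _ "\<phi> - {v}"]) (auto simp: faces_of_def star_def)
next
  case (stacked_step F \<psi> \<alpha> b)
  let ?\<phi> = "insert b \<alpha>"
  note f = stacked_facets[OF stacked_step.hyps(1)]
  have f\<alpha>: "finite \<alpha>" using f stacked_step.hyps(2,3) finite_subset by blast
  have b\<alpha>: "b \<notin> \<alpha>" using stacked_step.hyps(2,3,6) by auto
  show ?case
  proof (cases "\<sigma> \<subseteq> ?\<phi>")
    case True
    have "\<not> \<alpha> \<subseteq> \<sigma>"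
    proof
      assume "\<alpha> \<subseteq> \<sigma>"
      then have "card \<alpha> \<le> card \<sigma>" using True f\<alpha> by (meson card_mono finite.insertI finite_subset)
      then show False using stacked_step.prems(2) stacked_step.hyps(4) by simp
    qed
    then obtain v where v: "v \<in> \<alpha>" "v \<notin> \<sigma>" by auto
    let ?\<rho> = "?\<phi> - {v}"
    have "b \<in> ?\<rho>" using v b\<alpha> by auto
    then have "star (insert ?\<phi> F) ?\<rho> = {?\<phi>}" using stacked_step.hyps(6) by (auto simp: star_def)
    moreover have "Suc (card ?\<rho>) = n" using v f\<alpha> b\<alpha> stacked_step.hyps(4)
      by (metis card.insert card_Suc_Diff1 finite_insert insertCI)
    ultimately show ?thesis using True v by (intro exI[of _ ?\<rho>]) auto
  next
    case False
    then have "\<sigma> \<in> faces_of F" using stacked_step.prems(1) by (auto simp: faces_of_def)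
    from stacked_step.IH[OF this stacked_step.prems(2)] obtain \<rho> \<phi> where
      \<rho>: "\<sigma> \<subseteq> \<rho>" "Suc (card \<rho>) = n" "star F \<rho> = {\<phi>}" by auto
    then have "star (insert ?\<phi> F) \<rho> = {\<phi>}" using False by (auto simp: star_def)
    then show ?thesis using \<rho> by auto
  qed
qed

lemma pm_boundary_faces_of:
  assumes "\<And>\<phi>. \<phi> \<in> F \<Longrightarrow> finite \<phi> \<and> card \<phi> = n"
  shows "pm_boundary (int n - 1) (faces_of F) =
    {\<tau>. \<exists>\<rho>. \<tau> \<subseteq> \<rho> \<and> Suc (card \<rho>) = n \<and> (\<exists>\<phi>. star F \<rho> = {\<phi>})}"
proof -
  have 1: "\<rho> \<in> faces_of F" if "star F \<rho> = {\<phi>}" for \<rho> \<phi> using that by (auto simp: faces_of_def star_def)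
  have 2: "fdim \<rho> = int n - 1 - 1 \<longleftrightarrow> Suc (card \<rho>) = n" for \<rho> :: "'a set" by (auto simp: fdim_def)
  have 3: "card {\<phi> \<in> F. \<rho> \<subseteq> \<phi>} = 1 \<longleftrightarrow> (\<exists>\<phi>. star F \<rho> = {\<phi>})" for \<rho>
    unfolding star_def One_nat_def by (rule card_1_singleton_iff)
  have eq: "\<rho> \<in> faces_of F \<and> fdim \<rho> = int n - 1 - 1 \<and> card {\<phi> \<in> F. \<rho> \<subseteq> \<phi>} = 1 \<longleftrightarrow>
    Suc (card \<rho>) = n \<and> (\<exists>\<phi>. star F \<rho> = {\<phi>})" for \<rho>
    unfolding 2 3 using 1 by blast
  have "(\<exists>\<rho>\<in>faces_of F. fdim \<rho> = int n - 1 - 1 \<and> card {\<phi> \<in> F. \<rho> \<subseteq> \<phi>} = 1 \<and> \<tau> \<subseteq> \<rho>) \<longleftrightarrow>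
    (\<exists>\<rho>. \<tau> \<subseteq> \<rho> \<and> Suc (card \<rho>) = n \<and> (\<exists>\<phi>. star F \<rho> = {\<phi>}))" for \<tau>

  proof
    assume "\<exists>\<rho>\<in>faces_of F. fdim \<rho> = int n - 1 - 1 \<and> card {\<phi> \<in> F. \<rho> \<subseteq> \<phi>} = 1 \<and> \<tau> \<subseteq> \<rho>"
    then obtain \<rho> where r: "\<rho> \<in> faces_of F" "fdim \<rho> = int n - 1 - 1" "card {\<phi> \<in> F. \<rho> \<subseteq> \<phi>} = 1" "\<tau> \<subseteq> \<rho>"
      by (elim bexE conjE)
    show "\<exists>\<rho>. \<tau> \<subseteq> \<rho> \<and> Suc (card \<rho>) = n \<and> (\<exists>\<phi>. star F \<rho> = {\<phi>})"
      using eq[THEN iffD1, OF conjI[OF r(1) conjI[OF r(2,3)]]] r(4) by blast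
  next
    assume "\<exists>\<rho>. \<tau> \<subseteq> \<rho> \<and> Suc (card \<rho>) = n \<and> (\<exists>\<phi>. star F \<rho> = {\<phi>})"
    then obtain \<rho> where r: "\<tau> \<subseteq> \<rho>" "Suc (card \<rho>) = n \<and> (\<exists>\<phi>. star F \<rho> = {\<phi>})" by (elim exE conjE) blast
    note q = eq[THEN iffD2, OF r(2)]
    show "\<exists>\<rho>\<in>faces_of F. fdim \<rho> = int n - 1 - 1 \<and> card {\<phi> \<in> F. \<rho> \<subseteq> \<phi>} = 1 \<and> \<tau> \<subseteq> \<rho>"
      using q[THEN conjunct1] q[THEN conjunct2, THEN conjunct1] q[THEN conjunct2, THEN conjunct2] r(1)
      by (intro bexI[of _ \<rho>] conjI)
  qed
  moreover have "facets (faces_of F) = F" by (rule facets_faces_of[OF assms])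
  ultimately show ?thesis by (simp only: pm_boundary_def)
qed

lemma cdim_faces_of:
  assumes "finite F" "F \<noteq> {}" "\<And>\<phi>. \<phi> \<in> F \<Longrightarrow> finite \<phi> \<and> card \<phi> = n"
  shows "cdim (faces_of F) = int n - 1"
  unfolding cdim_def
proof (rule Max_eqI)
  have "finite (faces_of F)" using simplicial_complex_faces_of[of F] assms by (auto simp: simplicial_complex_def)
  then show "finite (fdim ` faces_of F)" by simp
  show "y \<le> int n - 1" if y: "y \<in> fdim ` faces_of F" for y
  proof -
    obtain \<sigma> \<phi> where \<sigma>: "\<phi> \<in> F" "\<sigma> \<subseteq> \<phi>" "y = fdim \<sigma>" using y unfolding faces_of_def by blast
    then have "card \<sigma> \<le> n" using assms(3) by (metis card_mono)
    then show ?thesis using \<sigma>(3) by (simp add: fdim_def)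
  qed
  obtain \<phi> where "\<phi> \<in> F" using assms(2) by auto
  then have "fdim \<phi> = int n - 1" "\<phi> \<in> faces_of F" using assms(3) by (auto simp: fdim_def faces_of_def)
  then show "int n - 1 \<in> fdim ` faces_of F" by (metis imageI)
qed

lemma stacked_imp_stacked_triangulated_ball:
  assumes "stacked n F" "2 \<le> n"
  shows "stacked_triangulated_ball (int n - 1) 1 (faces_of F)"
proof -
  note f = stacked_facets[OF assms(1)]
  have "\<sigma> \<in> pm_boundary (int n - 1) (faces_of F)"
    if "\<sigma> \<in> faces_of F" "int n - 1 - fdim \<sigma> \<ge> 2" for \<sigma>
    using stacked_codim2_face[OF assms(1) that(1)] that(2) f
    by (subst pm_boundary_faces_of) (auto simp: fdim_def)
  moreover have "nat (int n - 1) = n - 1" by simp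
  ultimately show ?thesis
    using stacked_homeomorphic_ball[OF assms] simplicial_complex_faces_of[of F] cdim_faces_of[of F n] f
    unfolding stacked_triangulated_ball_def triangulated_ball_def stacked_wrt_def by auto
qed

section \<open>Stacked triangulated balls have a tree as dual graph\<close>

text \<open>Logarithms of the same number differ by integer multiples of
  \<open>2 * pi * \<i>\<close>, so \<open>u\<close> has a discrete range.\<close>

lemma exp_constant_imp_constant:
  fixes u :: "real \<Rightarrow> complex"
  assumes "continuous_on {a..b} u" "\<And>t. t \<in> {a..b} \<Longrightarrow> exp (u t) = k" "s \<in> {a..b}" "t \<in> {a..b}"
  shows "u s = u t"
proof -
  have "u constant_on {a..b}"
  proof (rule continuous_discrete_range_constant[OF _ assms(1)])
    show "topological_space_class.connected {a..b}" by simp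
    fix x assume x: "x \<in> {a..b}"
    have "2 * pi \<le> norm (u y - u x)" if "y \<in> {a..b}" "u y \<noteq> u x" for y
    proof -
      have "exp (u y) = exp (u x)" using assms(2) x that by simp
      then obtain n :: int where n: "u y = u x + (of_int (2 * n) * pi) * \<i>" unfolding exp_eq by blast
      then have "n \<noteq> 0" using that(2) by auto
      then have "1 \<le> \<bar>real_of_int n\<bar>" by linarith
      moreover have "norm (u y - u x) = \<bar>real_of_int n\<bar> * (2 * pi)"
        unfolding n by (simp add: norm_mult abs_mult)
      ultimately show ?thesis by (simp add: mult_le_cancel_right1)
    qed
    then show "\<exists>e>0. \<forall>y. y \<in> {a..b} \<and> u y \<noteq> u x \<longrightarrow> e \<le> norm (u y - u x)"
      by (intro exI[of _ "2 * pi"]) auto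
  qed
  then show ?thesis using assms(3,4) by (auto simp: constant_on_def)
qed

text \<open>The square is contractible, so \<open>G\<close> has a logarithm on all of it. It is
  constant along the edge \<open>s = 1\<close>, and the difference of its values at
  \<open>t = 1\<close> and \<open>t = 0\<close> does not depend on \<open>s\<close>; hence it closes
  up along the edge \<open>s = 0\<close> as well.\<close>

lemma contracted_loop_log:
  fixes G :: "real \<times> real \<Rightarrow> complex"
  assumes cont: "continuous_on ({0..1} \<times> {0..1}) G" and nz: "\<And>z. z \<in> {0..1} \<times> {0..1} \<Longrightarrow> G z \<noteq> 0"
    and const: "\<And>t. t \<in> {0..1} \<Longrightarrow> G (1, t) = k"
    and loop: "\<And>s. s \<in> {0..1} \<Longrightarrow> G (s, 0) = G (s, 1)"
  obtains q where "continuous_on {0..1} q" "\<And>t. t \<in> {0..1} \<Longrightarrow> G (0, t) = exp (q t)" "q 0 = q 1"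
proof -
  have "contractible ({0..1} \<times> {0..1} :: (real \<times> real) set)"
    by (intro convex_imp_contractible convex_Times) auto
  then obtain L where L: "continuous_on ({0..1} \<times> {0..1}) L" "\<And>z. z \<in> {0..1} \<times> {0..1} \<Longrightarrow> G z = exp (L z)"
    using continuous_logarithm_on_contractible[OF cont _ nz] by blast
  have sec: "continuous_on {0..1} (\<lambda>t. L (s, t))" "continuous_on {0..1} (\<lambda>t. L (t, s))" if "s \<in> {0..1}" for s
    using that by (auto intro!: continuous_on_compose2[OF L(1)] continuous_intros)
  have 1: "L (1, 0) = L (1, 1)"
    by (rule exp_constant_imp_constant[OF sec(1), of 1 k]) (use const L(2) in \<open>auto simp: mem_Times_iff\<close>)
  have "L (0, 1) - L (0, 0) = L (1, 1) - L (1, 0)"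
    by (rule exp_constant_imp_constant[of 0 1 "\<lambda>s. L (s, 1) - L (s, 0)" 1])
      (use sec loop L(2) in \<open>auto intro!: continuous_intros simp: exp_diff mem_Times_iff\<close>)
  then have "L (0, 0) = L (0, 1)" using 1 by simp
  then show ?thesis using that[of "\<lambda>t. L (0, t)"] sec(1)[of 0] L(2) by auto
qed

text \<open>The first half of the loop avoids the nonnegative reals and the second half the
  nonpositive reals, so \<open>q\<close> follows the branches \<open>Ln (- w)\<close> and
  \<open>Ln w\<close> up to constants. At the two changeovers these branches differ by
  \<open>\<i> * pi\<close> with opposite signs, so \<open>q\<close> would gain
  \<open>2 * pi * \<i>\<close> over the loop.\<close>

lemma no_log_around_origin:
  fixes w q :: "real \<Rightarrow> complex"
  assumes w: "continuous_on {0..1} w" and q: "continuous_on {0..1} q" "\<And>t. t \<in> {0..1} \<Longrightarrow> w t = exp (q t)" "q 0 = q 1"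
    and half1: "\<And>t. t \<in> {0..1/2} \<Longrightarrow> - w t \<notin> nonpos_Reals" and half2: "\<And>t. t \<in> {1/2..1} \<Longrightarrow> w t \<notin> nonpos_Reals"
    and ends: "Im (w 0) > 0" "Im (w (1/2)) < 0" "w 1 = w 0"
  shows False
proof -
  have ex: "exp (q t) \<noteq> 0" for t by simp
  have "q (1/2) - Ln (- w (1/2)) = q 0 - Ln (- w 0)"
  proof (rule exp_constant_imp_constant[of 0 "1/2" "\<lambda>t. q t - Ln (- w t)" "-1"])
    show "continuous_on {0..1/2} (\<lambda>t. q t - Ln (- w t))"
      using half1 by (intro continuous_intros continuous_on_Ln continuous_on_subset[OF q(1)] continuous_on_subset[OF w]) auto
    show "exp (q t - Ln (- w t)) = - 1" if "t \<in> {0..1/2}" for t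
      using q(2)[of t] that by (simp add: exp_diff)
  qed auto
  moreover have "q 1 - Ln (w 1) = q (1/2) - Ln (w (1/2))"
  proof (rule exp_constant_imp_constant[of "1/2" 1 "\<lambda>t. q t - Ln (w t)" 1])
    show "continuous_on {1/2..1} (\<lambda>t. q t - Ln (w t))"
      using half2 by (intro continuous_intros continuous_on_Ln continuous_on_subset[OF q(1)] continuous_on_subset[OF w]) auto
    show "exp (q t - Ln (w t)) = 1" if "t \<in> {1/2..1}" for t
      using q(2)[of t] that by (simp add: exp_diff)
  qed auto
  moreover have "w 0 \<noteq> 0" "w (1/2) \<noteq> 0" using ends by force+
  then have "Ln (- w 0) = Ln (w 0) - \<i> * pi" "Ln (- w (1/2)) = Ln (w (1/2)) + \<i> * pi"
    using ends(1,2) Ln_minus[of "w 0"] Ln_minus[of "w (1/2)"] by simp_all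
  ultimately have "\<i> * complex_of_real pi = - (\<i> * complex_of_real pi)" using q(3) ends(3) by (simp add: algebra_simps) 
  then show False by simp
qed

text \<open>By density it suffices to exclude a point in the relative interior of \<open>\<rho>\<close>. Near such a point the
  complex is a half space, so an interior point of the ball there would contradict invariance of
  domain.\<close>

lemma ball_boundary_avoids_interior:
  fixes F :: "'a set set" and g :: "(nat \<Rightarrow> real) \<Rightarrow> 'a \<Rightarrow> real"
  assumes F: "\<And>\<phi>. \<phi> \<in> F \<Longrightarrow> finite \<phi> \<and> card \<phi> = Suc k" "finite F" and k: "k > 0"
    and D: "D = {x. (\<forall>i\<ge>k. x i = 0) \<and> (\<Sum>i<k. (x i)\<^sup>2) \<le> 1}"
    and h: "continuous_on (realization (faces_of F)) h" "h ` realization (faces_of F) \<subseteq> D"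
    and g: "continuous_on D g" "g ` D \<subseteq> realization (faces_of F)"
    and gh: "\<And>x. x \<in> realization (faces_of F) \<Longrightarrow> g (h x) = x" and hg: "\<And>y. y \<in> D \<Longrightarrow> h (g y) = y"
    and y: "y \<in> D" "(\<Sum>i<k. (y i)\<^sup>2) < 1"
    and \<rho>: "card \<rho> = k" "star F \<rho> = {\<phi>}"
  shows "\<not> {v. g y v \<noteq> 0} \<subseteq> \<rho>"
proof
  assume sub: "{v. g y v \<noteq> 0} \<subseteq> \<rho>"
  let ?R = "realization (faces_of F)"
  define E where "E = {x::nat \<Rightarrow> real. \<forall>i\<ge>k. x i = 0}"
  have Eu: "Euclidean_space k = top_of_set E"
    by (simp add: Euclidean_space_def E_def euclidean_product_topology)
  define I where "I = {x \<in> E. (\<Sum>i<k. (x i)\<^sup>2) < 1}"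
  have ID: "I \<subseteq> D" by (auto simp: I_def D E_def)
  define U0 where "U0 = \<Union>F"
  have U0: "finite U0" "\<Union>F \<subseteq> U0" using F by (auto simp: U0_def)
  have \<phi>: "\<phi> \<in> F" "\<rho> \<subseteq> \<phi>" using \<rho>(2) by (auto simp: star_def)
  have f\<rho>: "finite \<rho>" using F(1) \<phi> finite_subset by blast
  have "card (\<phi> - \<rho>) = 1" using F(1)[OF \<phi>(1)] \<phi> \<rho>(1) f\<rho> by (simp add: card_Diff_subset)
  then obtain a where "\<phi> - \<rho> = {a}" by (auto simp: card_1_singleton_iff)
  then have a: "\<phi> = insert a \<rho>" "a \<notin> \<rho>" using \<phi> by auto
  have \<rho>U: "\<rho> \<subseteq> U0" using \<phi> by (auto simp: U0_def)
  have opI: "openin (top_of_set E) I"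
  proof -
    have "open {x::nat \<Rightarrow> real. (\<Sum>i<k. (x i)\<^sup>2) < 1}"
      by (intro open_Collect_less continuous_intros continuous_on_product_coordinates)
    moreover have "I = E \<inter> {x. (\<Sum>i<k. (x i)\<^sup>2) < 1}" by (auto simp: I_def)
    ultimately show ?thesis by blast
  qed
  have "\<exists>y1\<in>I. {v. g y1 v \<noteq> 0} = \<rho>"
  proof -
    \<comment> \<open>The segment from \<open>g y\<close> to the barycenter of \<rho>. For positive
      \<open>t\<close> the support is all of \<rho>, and for small \<open>t\<close> the point
      \<open>h (x t)\<close> is still in the open ball.\<close>
    define x where "x t = (\<lambda>v. (1 - t) * g y v + (if v \<in> \<rho> then t / k else 0))" for t :: real
    have gy: "g y \<in> ?R" using g y by auto
    have nn: "0 \<le> g y v" for v using gy unfolding realization_faces_of[OF U0] by auto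
    have supp: "{v. x t v \<noteq> 0} = \<rho>" if "0 < t" "t \<le> 1" for t
    proof -
      have "0 < x t v" if "v \<in> \<rho>" for v
        using that nn[of v] k \<open>0 < t\<close> \<open>t \<le> 1\<close> by (auto simp: x_def intro!: add_nonneg_pos)
      moreover have "x t v = 0" if "v \<notin> \<rho>" for v using that sub by (auto simp: x_def)
      ultimately show ?thesis by (auto simp: less_imp_neq[symmetric])
    qed
    have xR: "x t \<in> ?R" if t: "t \<in> {0..1}" for t
      unfolding realization_faces_of[OF U0]
    proof (intro conjI allI)
      show "0 \<le> x t v" for v using nn[of v] t by (auto simp: x_def)
      have "(\<Sum>v\<in>U0. if v \<in> \<rho> then t / k else 0) = (\<Sum>v\<in>\<rho>. t / k)"
        using U0(1) \<rho>U by (simp add: sum.If_cases Int_absorb1)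
      also have "\<dots> = t" using k \<rho>(1) by simp
      finally have "sum (x t) U0 = (1 - t) * sum (g y) U0 + t"
        by (simp add: x_def sum.distrib sum_distrib_left)
      moreover have "sum (g y) U0 = 1" using gy unfolding realization_faces_of[OF U0] by simp
      ultimately show "sum (x t) U0 = 1" by simp
      have "x t v \<noteq> 0 \<longrightarrow> v \<in> \<phi>" for v using sub \<phi> by (auto simp: x_def split: if_splits)
      then show "\<exists>\<xi>\<in>F. \<forall>v. x t v \<noteq> 0 \<longrightarrow> v \<in> \<xi>" using \<phi>(1) by blast
    qed
    have cx: "continuous_on {0..1} x" unfolding x_def
    proof (rule continuous_on_coordinatewise_then_product)
      fix v show "continuous_on {0..1} (\<lambda>t. (1 - t) * g y v + (if v \<in> \<rho> then t / k else 0))"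
        using k by (cases "v \<in> \<rho>") (auto intro!: continuous_intros)
    qed
    have x0: "x 0 = g y" by (auto simp: x_def)
    define N where "N t = (\<Sum>i<k. (h (x t) i)\<^sup>2)" for t
    have chx: "continuous_on {0..1} (\<lambda>t. h (x t))"
      using xR by (intro continuous_on_compose2[OF h(1) cx]) auto
    have cN: "continuous_on {0..1} N" unfolding N_def
      by (intro continuous_intros continuous_on_product_then_coordinatewise[OF chx])
    have "N 0 < 1" using y x0 hg[OF y(1)] by (simp add: N_def)
    moreover have "(N \<longlongrightarrow> N 0) (at 0 within {0..1})" using cN by (auto simp: continuous_on_def)
    ultimately have "\<forall>\<^sub>F t in at 0 within {0..1}. N t < 1" by (auto dest: order_tendstoD(2))
    then obtain \<delta> where \<delta>: "\<delta> > 0" "\<And>t. t \<in> {0..1} \<Longrightarrow> t \<noteq> 0 \<Longrightarrow> dist t 0 < \<delta> \<Longrightarrow> N t < 1"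
      unfolding eventually_at by blast
    define t where "t = min 1 (\<delta> / 2)"
    have t: "0 < t" "t \<le> 1" "N t < 1" using \<delta>(1) \<delta>(2)[of t] by (auto simp: t_def dist_real_def)
    have "h (x t) \<in> I" using t h(2) xR[of t] by (auto simp: I_def D E_def N_def)
    moreover have "g (h (x t)) = x t" using gh xR[of t] t by auto
    ultimately show ?thesis using supp[of t] t by (intro bexI[of _ "h (x t)"]) auto
  qed
  then obtain y1 where y1: "y1 \<in> I" "{v. g y1 v \<noteq> 0} = \<rho>" by blast
  \<comment> \<open>Where all coordinates at \<rho> are positive, the support contains \<rho> and so
    lies in \<phi>, the only facet over \<rho>. Near \<open>y1\<close> the complex is thus the half
    space where the coordinate at \<open>a\<close> is nonnegative.\<close>
  define U where "U = {z \<in> I. \<forall>v\<in>\<rho>. 0 < g z v}"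
  have UI: "U \<subseteq> I" by (auto simp: U_def)
  have nng: "0 \<le> g z v" if "z \<in> I" for z v
  proof -
    have "g z \<in> ?R" using that ID g(2) by auto
    then show ?thesis unfolding realization_faces_of[OF U0] by auto
  qed
  have cg: "continuous_on I g" using g(1) ID by (rule continuous_on_subset)
  have opU: "openin (top_of_set E) U"
  proof -
    have "{x::'a \<Rightarrow> real. \<forall>v\<in>\<rho>. 0 < x v} = (\<Inter>v\<in>\<rho>. {x. 0 < x v})" by auto
    moreover have "open {x::'a \<Rightarrow> real. 0 < x v}" for v
      by (intro open_Collect_less continuous_intros continuous_on_product_coordinates)
    ultimately have "open {x::'a \<Rightarrow> real. \<forall>v\<in>\<rho>. 0 < x v}" using f\<rho> by auto
    then have "openin (top_of_set I) (I \<inter> g -` {x. \<forall>v\<in>\<rho>. 0 < x v})"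
      by (rule continuous_openin_preimage_gen[OF cg])
    moreover have "I \<inter> g -` {x. \<forall>v\<in>\<rho>. 0 < x v} = U" by (auto simp: U_def)
    ultimately show ?thesis using openin_trans opI by metis
  qed
  have y1U: "y1 \<in> U" using y1 nng[OF y1(1)] by (fastforce simp: U_def less_le)
  have suppU: "\<forall>v. g z v \<noteq> 0 \<longrightarrow> v \<in> \<phi>" if "z \<in> U" for z
  proof -
    have "g z \<in> ?R" using that UI ID g(2) by blast
    then obtain \<xi> where \<xi>: "\<xi> \<in> F" "\<forall>v. g z v \<noteq> 0 \<longrightarrow> v \<in> \<xi>" unfolding realization_faces_of[OF U0] by auto
    moreover have "\<rho> \<subseteq> \<xi>" using that \<xi>(2) by (force simp: U_def)
    ultimately show ?thesis using \<rho>(2) by (auto simp: star_def)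
  qed
  obtain e where e: "bij_betw e {..<k} \<rho>"
    using f\<rho> \<rho>(1) ex_bij_betw_nat_finite[of \<rho>] by (auto simp: atLeast0LessThan)
  \<comment> \<open>barycentric coordinates of \<open>\<phi>\<close>, the redundant one of \<open>e 0\<close> being replaced by that of \<open>a\<close>\<close>
  define f where "f z = (\<lambda>i. if i = 0 then g z a else if i < k then g z (e i) else 0)" for z
  have cf: "continuous_on U f" unfolding f_def
  proof (rule continuous_on_coordinatewise_then_product)
    fix i
    have *: "continuous_on U (\<lambda>z. g z v)" for v
      using continuous_on_product_then_coordinatewise[OF cg] UI continuous_on_subset by blast
    show "continuous_on U (\<lambda>z. if i = 0 then g z a else if i < k then g z (e i) else 0)"
      using * by (cases "i = 0"; cases "i < k") auto
  qed
  have fE: "f z \<in> E" for z using k by (auto simp: f_def E_def)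
  have "inj_on f U"
  proof (rule inj_onI)
    fix z z' assume z: "z \<in> U" "z' \<in> U" "f z = f z'"
    have ga: "g z a = g z' a" using fun_cong[OF z(3), of 0] by (simp add: f_def)
    have ge: "g z (e i) = g z' (e i)" if "i < k" "i \<noteq> 0" for i
      using fun_cong[OF z(3), of i] that by (simp add: f_def)
    have tot: "g w a + (\<Sum>i<k. g w (e i)) = 1" if "w \<in> U" for w
    proof -
      have "g w \<in> ?R" using that UI ID g(2) by blast
      then have "sum (g w) U0 = 1" unfolding realization_faces_of[OF U0] by auto
      moreover have "sum (g w) U0 = sum (g w) \<phi>"
        using suppU[OF that] \<phi>(1) U0(1) by (intro sum.mono_neutral_right) (auto simp: U0_def)
      ultimately have "g w a + sum (g w) \<rho> = 1" using a f\<rho> by simp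
      then show ?thesis using sum.reindex_bij_betw[OF e, of "g w"] by simp
    qed
    have "{..<k} = insert 0 ({..<k} - {0})" using k by auto
    then have "(\<Sum>i<k. g w (e i)) = g w (e 0) + (\<Sum>i\<in>{..<k} - {0}. g w (e i))" for w
      by (metis finite_Diff finite_lessThan insert_Diff_single sum.insert_remove Diff_idemp)
    moreover have "(\<Sum>i\<in>{..<k} - {0}. g z (e i)) = (\<Sum>i\<in>{..<k} - {0}. g z' (e i))"
      using ge by (intro sum.cong) auto
    ultimately have "g z (e 0) = g z' (e 0)" using tot[OF z(1)] tot[OF z(2)] ga by simp
    then have "g z (e i) = g z' (e i)" if "i < k" for i using ge that by (cases "i = 0") auto
    then have "g z v = g z' v" if "v \<in> \<rho>" for v using e that by (auto simp: bij_betw_def)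
    then have "g z = g z'" using ga a suppU[OF z(1)] suppU[OF z(2)] by (metis (no_types, lifting) ext insertE)
    then show "z = z'" using hg z UI ID by (metis subsetD)
  qed
  then have op: "openin (top_of_set E) (f ` U)"
  proof -
    assume inj: "inj_on f U"
    have "E \<inter> U = U" using UI by (auto simp: I_def)
    then have "continuous_map (subtopology (top_of_set E) U) (top_of_set E) f"
      using cf fE by (simp add: subtopology_subtopology Pi_iff)
    then show ?thesis using invariance_of_domain_Euclidean_space[of k U f] opU inj unfolding Eu by blast
  qed
  then obtain T where T: "open T" "f ` U = E \<inter> T" by (auto simp: openin_open)
  \<comment> \<open>A short move from \<open>f y1\<close>, whose coordinate at \<open>a\<close> is
    0, in the negative direction of this coordinate stays in the open image of \<open>U\<close>,
    although the coordinate is nonnegative there.\<close>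
  define p where "p t = (\<lambda>i. if i = 0 then f y1 0 - t else f y1 i)" for t :: real
  have cp: "continuous_on UNIV p" unfolding p_def
  proof (rule continuous_on_coordinatewise_then_product)
    fix i show "continuous_on UNIV (\<lambda>t. if i = 0 then f y1 0 - t else f y1 i)"
      by (cases "i = 0") (auto intro!: continuous_intros)
  qed
  have "p 0 = f y1" by (auto simp: p_def)
  then have "0 \<in> p -` T" using T(2) y1U by auto
  moreover have "open (p -` T)" using cp T(1) by (simp add: open_vimage)
  ultimately obtain \<delta> where \<delta>: "\<delta> > 0" "ball 0 \<delta> \<subseteq> p -` T" by (meson open_contains_ball)
  have "\<delta> / 2 \<in> ball 0 \<delta>" using \<delta>(1) by (simp add: dist_real_def)
  then have "\<delta> / 2 \<in> p -` T" using \<delta>(2) by blast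
  moreover have "p (\<delta> / 2) \<in> E" using fE[of y1] k by (auto simp: p_def E_def)
  ultimately have "p (\<delta> / 2) \<in> f ` U" using T(2) by auto
  then obtain z where z: "z \<in> U" "p (\<delta> / 2) = f z" by auto
  have "g y1 a = 0" using y1(2) a(2) by auto
  then have "f z 0 = - (\<delta> / 2)" using fun_cong[OF z(2), of 0] by (simp add: p_def f_def)
  then have "g z a < 0" using \<delta>(1) by (simp add: f_def)
  then show False using nng[of z a] z(1) UI by auto
qed

section \<open>The winding argument for triangulated balls\<close>

definition barycenter :: "'a set \<Rightarrow> 'a \<Rightarrow> real" where
  "barycenter \<eta> = (\<lambda>v. if v \<in> \<eta> then 1 / real (card \<eta>) else 0)"

text \<open>The straight segment works: every point of it except the starting point has support
  \<xi>.\<close>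

lemma path_component_barycenters:
  fixes F :: "'a set set"
  assumes "finite F" "\<And>\<phi>. \<phi> \<in> F \<Longrightarrow> finite \<phi>" "\<xi> \<in> F" "\<eta> \<subseteq> \<xi>" "\<eta> \<noteq> {}"
    and T: "\<And>x. x \<in> realization (faces_of F) \<Longrightarrow> {v. x v \<noteq> 0} = \<eta> \<or> {v. x v \<noteq> 0} = \<xi> \<Longrightarrow> x \<in> T"
  shows "path_component T (barycenter \<eta>) (barycenter \<xi>)"
proof -
  have f: "finite \<xi>" "finite \<eta>" "\<xi> \<noteq> {}" using assms finite_subset by blast+
  then have c: "0 < card \<eta>" "0 < card \<xi>" using assms(5) by (auto simp: card_gt_0_iff)
  define U0 where "U0 = \<Union>F"
  have U0: "finite U0" "\<Union>F \<subseteq> U0" using assms by (auto simp: U0_def)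
  define p where "p t = (\<lambda>v. (1 - t) * barycenter \<eta> v + t * barycenter \<xi> v)" for t
  have "p t \<in> T" if t: "t \<in> {0..1}" for t
  proof (rule T)
    show "p t \<in> realization (faces_of F)"
      unfolding realization_faces_of[OF U0]
    proof (intro conjI allI)
      show "0 \<le> p t v" for v using t by (auto simp: p_def barycenter_def)
      have "sum (barycenter \<zeta>) U0 = 1" if "\<zeta> \<subseteq> U0" "0 < card \<zeta>" for \<zeta>
        using U0(1) that by (simp add: barycenter_def sum.If_cases Int_absorb1)
      then have "sum (barycenter \<eta>) U0 = 1" "sum (barycenter \<xi>) U0 = 1" using c assms(3,4) by (auto simp: U0_def)
      then show "sum (p t) U0 = 1" by (simp add: p_def sum.distrib sum_distrib_left[symmetric])
      have "\<forall>v. p t v \<noteq> 0 \<longrightarrow> v \<in> \<xi>" using assms(4) by (auto simp: p_def barycenter_def)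
      then show "\<exists>\<xi>\<in>F. \<forall>v. p t v \<noteq> 0 \<longrightarrow> v \<in> \<xi>" using assms(3) by blast
    qed
    show "{v. p t v \<noteq> 0} = \<eta> \<or> {v. p t v \<noteq> 0} = \<xi>"
    proof (cases "t = 0")
      case True
      then show ?thesis using c by (auto simp: p_def barycenter_def)
    next
      case False
      then have "0 < t * barycenter \<xi> v" if "v \<in> \<xi>" for v using that t c by (simp add: barycenter_def)
      moreover have "0 \<le> (1 - t) * barycenter \<eta> v" for v using t by (simp add: barycenter_def)
      ultimately have "0 < p t v" if "v \<in> \<xi>" for v using that unfolding p_def by (smt (verit))
      moreover have "p t v = 0" if "v \<notin> \<xi>" for v using that assms(4) by (auto simp: p_def barycenter_def)
      ultimately have "{v. p t v \<noteq> 0} = \<xi>" by force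
      then show ?thesis by blast
    qed
  qed
  moreover have "path p" unfolding path_def p_def
    by (intro continuous_on_coordinatewise_then_product continuous_intros)
  ultimately show ?thesis
    unfolding path_component_def by (intro exI[of _ p]) (auto simp: path_image_def pathstart_def pathfinish_def p_def)
qed

lemma stacked_ball_adj_bridge:
  fixes F :: "'a set set"
  assumes F: "finite F" "\<And>\<phi>. \<phi> \<in> F \<Longrightarrow> finite \<phi> \<and> card \<phi> = Suc k" and k: "k > 0"
    and ball: "geometric_realization (faces_of F) homeomorphic_space closed_ball_space k"
    and stacked: "\<And>\<sigma>. \<sigma> \<in> faces_of F \<Longrightarrow> card \<sigma> < k \<Longrightarrow> \<exists>\<rho>. \<sigma> \<subseteq> \<rho> \<and> card \<rho> = k \<and> (\<exists>\<phi>. star F \<rho> = {\<phi>})"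
    and two: "\<And>\<xi> \<omega>. (\<xi>, \<omega>) \<in> adj (Suc k) F \<Longrightarrow> star F (\<xi> \<inter> \<omega>) = {\<xi>, \<omega>}"
    and edge: "(\<phi>, \<psi>) \<in> adj (Suc k) F" and detour: "(\<psi>, \<phi>) \<in> (adj (Suc k) F - {(\<phi>, \<psi>), (\<psi>, \<phi>)})\<^sup>*"
  shows False
proof -
  let ?R = "realization (faces_of F)"
  define D where "D = {x. (\<forall>i\<ge>k. x i = 0) \<and> (\<Sum>i<k. (x i)\<^sup>2) \<le> (1::real)}"
  have "closed_ball_space k = top_of_set D"
    unfolding closed_ball_space_eq by (rule arg_cong[of _ _ top_of_set]) (auto simp: D_def)
  then obtain h g where hg: "homeomorphic_maps (top_of_set ?R) (top_of_set D) h g"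
    using ball by (auto simp: homeomorphic_space_def geometric_realization_eq)
  then have h: "continuous_on ?R h" "h ` ?R \<subseteq> D" and g: "continuous_on D g" "g ` D \<subseteq> ?R"
    and gh: "\<And>x. x \<in> ?R \<Longrightarrow> g (h x) = x" and hg: "\<And>y. y \<in> D \<Longrightarrow> h (g y) = y"
    by (auto simp: homeomorphic_maps_def)
  define bd where "bd \<sigma> \<longleftrightarrow> (\<exists>\<rho>. \<sigma> \<subseteq> \<rho> \<and> card \<rho> = k \<and> (\<exists>\<phi>. star F \<rho> = {\<phi>}))" for \<sigma>
  define W where "W = {x \<in> ?R. \<not> bd {v. x v \<noteq> 0}}"
  define U0 where "U0 = \<Union>F"
  have U0: "finite U0" "\<Union>F \<subseteq> U0" using F by (auto simp: U0_def)
  \<comment> \<open>This inclusion is all that links the combinatorial boundary to the ball. It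
    suffices for the contraction \<open>K\<close>, which is the identity of \<open>W\<close> at
    \<open>s = 0\<close> and takes its values in the image of the open ball for
    \<open>s > 0\<close>.\<close>
  have int: "g y \<in> W" if "y \<in> D" "(\<Sum>i<k. (y i)\<^sup>2) < 1" for y
    using ball_boundary_avoids_interior[OF F(2) F(1) k D_def h g gh hg that] g(2) that(1)
    by (auto simp: W_def bd_def)
  \<comment> \<open>the contraction of the open ball, read in the complex without its boundary\<close>
  define K where "K s x = g (\<lambda>i. (1 - s) * h x i)" for s x
  have KD: "(\<lambda>i. (1 - s) * h x i) \<in> D" if "s \<in> {0..1}" "x \<in> ?R" for s x
  proof -
    have hx: "h x \<in> D" using h that by auto
    have "(\<Sum>i<k. ((1 - s) * h x i)\<^sup>2) = (1 - s)\<^sup>2 * (\<Sum>i<k. (h x i)\<^sup>2)"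
      by (simp add: power_mult_distrib sum_distrib_left)
    also have "\<dots> \<le> 1 * 1" using hx that(1)
      by (intro mult_mono) (auto simp: D_def power_le_one sum_nonneg)
    finally show ?thesis using hx by (simp add: D_def)
  qed
  have KW: "K s x \<in> W" if "s \<in> {0..1}" "x \<in> W" for s x
  proof (cases "s = 0")
    case True
    then show ?thesis using that gh by (auto simp: K_def W_def)
  next
    case False
    have hx: "h x \<in> D" using h that by (auto simp: W_def)
    have "(\<Sum>i<k. ((1 - s) * h x i)\<^sup>2) = (1 - s)\<^sup>2 * (\<Sum>i<k. (h x i)\<^sup>2)"
      by (simp add: power_mult_distrib sum_distrib_left)
    also have "\<dots> \<le> (1 - s)\<^sup>2 * 1" using hx by (intro mult_left_mono) (auto simp: D_def)
    also have "(1 - s)\<^sup>2 * 1 < 1" using False that(1) by (simp add: power_less_one_iff abs_square_less_1)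
    finally show ?thesis unfolding K_def using int KD[of s x] that by (auto simp: W_def)
  qed
  define \<rho> where "\<rho> = \<phi> \<inter> \<psi>"
  have e: "\<phi> \<in> F" "\<psi> \<in> F" "\<phi> \<noteq> \<psi>" "card \<rho> = k" using edge by (auto simp: adj_def \<rho>_def)
  have f\<rho>: "finite \<rho>" "\<rho> \<noteq> {}" using e F k by (auto simp: \<rho>_def)
  have st: "star F \<rho> = {\<phi>, \<psi>}" using two[OF edge] by (simp add: \<rho>_def)
  have "card (\<phi> - \<rho>) = 1" "card (\<psi> - \<rho>) = 1" using F(2)[OF e(1)] F(2)[OF e(2)] e(4) f\<rho>
    by (auto simp: card_Diff_subset \<rho>_def)
  then obtain b c where "\<phi> - \<rho> = {b}" "\<psi> - \<rho> = {c}" by (auto simp: card_1_singleton_iff)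
  then have bc: "\<phi> = insert b \<rho>" "\<psi> = insert c \<rho>" "b \<notin> \<rho>" "c \<notin> \<rho>" by (auto simp: \<rho>_def)
  then have bnc: "b \<noteq> c" using e by auto
  define m where "m x = Min (x ` \<rho>)" for x :: "'a \<Rightarrow> real"
  \<comment> \<open>Off the boundary, \<open>P\<close> has no zero; it is positive on the interior of \<open>\<rho>\<close>, lies in the two open
    half planes on the interiors of \<open>\<phi>\<close> and \<open>\<psi>\<close>, and is negative everywhere else. Hence a loop that
    crosses \<open>\<rho>\<close> once has winding number \<open>\<plusminus>1\<close>.\<close>
  define P where "P x = Complex (m x - (1 - sum x \<rho>)) ((x c - x b) * m x)" for x
  have cP: "continuous_on UNIV P"
  proof -
    have "continuous_on UNIV m" unfolding m_def
      using f\<rho> continuous_on_Min_image[of \<rho> UNIV "\<lambda>i x. x i"] by (simp add: continuous_on_product_coordinates)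
    then show ?thesis unfolding P_def Complex_eq
      by (intro continuous_intros continuous_on_product_coordinates)
  qed
  \<comment> \<open>Stackedness enters here: off the boundary only the interiors of facets and of
    ridges remain.\<close>
  have W_card: "k \<le> card {v. x v \<noteq> 0}" if "x \<in> W" for x
  proof (rule ccontr)
    assume "\<not> ?thesis"
    moreover have "{v. x v \<noteq> 0} \<in> faces_of F" using that by (auto simp: W_def realization_def)
    ultimately show False using stacked[of "{v. x v \<noteq> 0}"] that by (auto simp: W_def bd_def)
  qed
  have nn: "0 \<le> x v" if "x \<in> W" for x v using that by (auto simp: W_def realization_def)
  have fs: "finite {v. x v \<noteq> 0}" if "x \<in> W" for x
    using that F finite_subset by (fastforce simp: W_def realization_def faces_of_def)
  \<comment> \<open>A vertex of \<rho> has weight 0, so \<open>m x = 0\<close>. Some weight lies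
    outside \<rho>, since a support inside \<rho> with at least \<open>k\<close> vertices would be
    all of \<rho>; this makes the real part negative.\<close>
  have P_out: "Im (P x) = 0 \<and> Re (P x) < 0" if x: "x \<in> W" "\<not> \<rho> \<subseteq> {v. x v \<noteq> 0}" for x
  proof -
    obtain u where u: "u \<in> \<rho>" "x u = 0" using x by auto
    have "m x = 0" unfolding m_def
      using u f\<rho> nn[OF x(1)] by (intro Min_eqI) force+
    moreover have "\<not> {v. x v \<noteq> 0} \<subseteq> \<rho>"
    proof
      assume "{v. x v \<noteq> 0} \<subseteq> \<rho>"
      then have "{v. x v \<noteq> 0} = \<rho>" using W_card[OF x(1)] f\<rho> e(4) by (simp add: card_seteq)
      then show False using x by simp
    qed
    then obtain w where w: "w \<notin> \<rho>" "x w \<noteq> 0" by auto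
    have "x \<in> ?R" using x by (simp add: W_def)
    then have sx: "sum x U0 = 1" and "\<exists>\<xi>\<in>F. \<forall>v. x v \<noteq> 0 \<longrightarrow> v \<in> \<xi>" unfolding realization_faces_of[OF U0] by auto
    then have "w \<in> U0" using w by (auto simp: U0_def)
    then have "sum x (insert w \<rho>) \<le> sum x U0" using U0 e(1) bc nn[OF x(1)]
      by (intro sum_mono2) (auto simp: U0_def)
    then have "x w + sum x \<rho> \<le> 1" using sx w f\<rho> by simp
    moreover have "0 < x w" using w nn[OF x(1), of w] by simp
    ultimately show ?thesis by (simp add: P_def)
  qed
  have P_in: "{v. x v \<noteq> 0} = \<rho> \<and> Im (P x) = 0 \<and> Re (P x) > 0 \<or> {v. x v \<noteq> 0} = \<phi> \<and> Im (P x) < 0 \<or>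
     {v. x v \<noteq> 0} = \<psi> \<and> Im (P x) > 0" if x: "x \<in> W" "\<rho> \<subseteq> {v. x v \<noteq> 0}" for x
  proof -
    have "0 < x v" if "v \<in> \<rho>" for v using that x(2) nn[OF x(1), of v] by (auto simp: less_le)
    then have mp: "m x > 0" using f\<rho> by (simp add: m_def)
    have "x \<in> ?R" using x by (simp add: W_def)
    then have sx: "sum x U0 = 1" and "\<exists>\<xi>\<in>F. \<forall>v. x v \<noteq> 0 \<longrightarrow> v \<in> \<xi>" unfolding realization_faces_of[OF U0] by auto
    then obtain \<xi> where \<xi>: "\<xi> \<in> F" "{v. x v \<noteq> 0} \<subseteq> \<xi>" by auto
    then have "\<xi> \<in> star F \<rho>" using x(2) by (auto simp: star_def)
    then have "\<xi> = \<phi> \<or> \<xi> = \<psi>" using st by auto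
    then consider "{v. x v \<noteq> 0} = \<rho>" | "{v. x v \<noteq> 0} = \<phi>" | "{v. x v \<noteq> 0} = \<psi>"
      using \<xi>(2) x(2) bc by (metis subset_antisym subset_insert subset_insert_iff insert_absorb insert_subset)
    then show ?thesis
    proof cases
      case 1
      then have "x b = 0" "x c = 0" using bc by auto
      have "sum x U0 = sum x \<rho>" using 1 U0 e(1) bc by (intro sum.mono_neutral_right) (auto simp: U0_def)
      then show ?thesis using 1 mp sx \<open>x b = 0\<close> \<open>x c = 0\<close> by (simp add: P_def)
    next
      case 2
      then have "x b \<noteq> 0" "x c = 0" using bc bnc by auto
      then show ?thesis using 2 mp nn[OF x(1), of b] by (simp add: P_def mult_less_0_iff)
    next
      case 3
      then have "x c \<noteq> 0" "x b = 0" using bc bnc by auto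
      then show ?thesis using 3 mp nn[OF x(1), of c] by (simp add: P_def)
    qed
  qed
  have nbd: "\<not> bd \<xi>" if "\<xi> \<in> F" for \<xi>
  proof
    assume "bd \<xi>"
    then obtain \<rho>' \<omega> where r: "\<xi> \<subseteq> \<rho>'" "card \<rho>' = k" "star F \<rho>' = {\<omega>}" by (auto simp: bd_def)
    then have "finite \<rho>'" using k by (intro card_ge_0_finite) simp
    then have "card \<xi> \<le> k" using r card_mono by blast
    then show False using F(2)[OF that] by simp
  qed
  have nbd2: "\<not> bd (\<xi> \<inter> \<omega>)" if a: "(\<xi>, \<omega>) \<in> adj (Suc k) F" for \<xi> \<omega>
  proof
    assume "bd (\<xi> \<inter> \<omega>)"
    then obtain \<rho>' \<zeta> where r: "\<xi> \<inter> \<omega> \<subseteq> \<rho>'" "card \<rho>' = k" "star F \<rho>' = {\<zeta>}" by (auto simp: bd_def)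
    then have "finite \<rho>'" using k by (intro card_ge_0_finite) simp
    then have "\<xi> \<inter> \<omega> = \<rho>'" using r a by (intro card_subset_eq) (auto simp: adj_def)
    then show False using two[OF a] r a by (auto simp: adj_def doubleton_eq_iff)
  qed
  have seg: "path_component T (barycenter \<xi>) (barycenter \<omega>)"
    if a: "(\<xi>, \<omega>) \<in> adj (Suc k) F"
     and T: "\<And>x. x \<in> W \<Longrightarrow> {v. x v \<noteq> 0} \<in> {\<xi> \<inter> \<omega>, \<xi>, \<omega>} \<Longrightarrow> x \<in> T" for T \<xi> \<omega>
  proof -
    have x: "\<xi> \<in> F" "\<omega> \<in> F" "\<xi> \<inter> \<omega> \<noteq> {}" using a k by (auto simp: adj_def)
    have "path_component T (barycenter (\<xi> \<inter> \<omega>)) (barycenter \<zeta>)" if "\<zeta> \<in> {\<xi>, \<omega>}" for \<zeta>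
      using that x F nbd nbd2[OF a] by (intro path_component_barycenters[of F] T) (auto simp: W_def)
    then show ?thesis by (meson insertCI path_component_sym path_component_trans)
  qed
  \<comment> \<open>On \<open>T1\<close> the values of \<open>P\<close> are never nonnegative reals,
    on \<open>T2\<close> below they are never nonpositive reals. The detour stays in
    \<open>T1\<close>, and the way back through \<rho> stays in \<open>T2\<close>.\<close>
  define T1 where "T1 = {x \<in> W. {v. x v \<noteq> 0} \<noteq> \<rho>}"
  have pc1: "path_component T1 (barycenter \<psi>) (barycenter \<phi>)"
    using detour
  proof (induction rule: rtrancl_induct)
    case base
    have "path_component T1 (barycenter \<psi>) (barycenter \<psi>)"
      using F e f\<rho> nbd bc by (intro path_component_barycenters[of F]) (auto simp: T1_def W_def)
    then show ?case .
  next
    case (step \<xi> \<omega>)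
    have a: "(\<xi>, \<omega>) \<in> adj (Suc k) F" using step(2) by simp
    \<comment> \<open>A ridge determines the two facets over it, so only the deleted edge crosses
      \<rho>.\<close>
    have "\<xi> \<inter> \<omega> \<noteq> \<rho>"
    proof
      assume "\<xi> \<inter> \<omega> = \<rho>"
      then have "{\<xi>, \<omega>} = {\<phi>, \<psi>}" using two[OF a] st by metis
      then have "(\<xi>, \<omega>) = (\<phi>, \<psi>) \<or> (\<xi>, \<omega>) = (\<psi>, \<phi>)" by (simp add: doubleton_eq_iff)
      then show False using step(2) by blast
    qed
    moreover have "\<xi> \<in> F" "\<omega> \<in> F" using a by (auto simp: adj_def)
    then have "\<xi> \<noteq> \<rho>" "\<omega> \<noteq> \<rho>" using F(2) e(4) by (metis n_not_Suc_n)+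
    ultimately have "path_component T1 (barycenter \<xi>) (barycenter \<omega>)"
      by (intro seg[OF a]) (auto simp: T1_def)
    then show ?case using step(3) path_component_trans by blast
  qed
  then obtain \<gamma>1 where \<gamma>1: "path \<gamma>1" "path_image \<gamma>1 \<subseteq> T1" "pathstart \<gamma>1 = barycenter \<psi>" "pathfinish \<gamma>1 = barycenter \<phi>"
    unfolding path_component_def by blast
  define T2 where "T2 = {x \<in> W. \<rho> \<subseteq> {v. x v \<noteq> 0}}"
  have "path_component T2 (barycenter \<phi>) (barycenter \<psi>)"
  proof (rule seg[OF edge])
    fix x assume x: "x \<in> W" "{v. x v \<noteq> 0} \<in> {\<phi> \<inter> \<psi>, \<phi>, \<psi>}"
    then have "\<rho> \<subseteq> {v. x v \<noteq> 0}" unfolding \<rho>_def by blast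
    then show "x \<in> T2" using x(1) by (simp add: T2_def)
  qed
  then obtain \<gamma>2 where \<gamma>2: "path \<gamma>2" "path_image \<gamma>2 \<subseteq> T2" "pathstart \<gamma>2 = barycenter \<phi>" "pathfinish \<gamma>2 = barycenter \<psi>"
    unfolding path_component_def by blast
  define \<gamma> where "\<gamma> = \<gamma>1 +++ \<gamma>2"
  have c\<gamma>: "continuous_on {0..1} \<gamma>" using \<gamma>1 \<gamma>2 by (auto simp: \<gamma>_def path_def[symmetric])
  have \<gamma>1': "\<gamma> t \<in> T1" if "t \<in> {0..1/2}" for t
    using that \<gamma>1(2) by (auto simp: \<gamma>_def joinpaths_def path_image_def)
  have \<gamma>2': "\<gamma> t \<in> T2" if "t \<in> {1/2..1}" for t
  proof (cases "t = 1/2")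
    case True
    have "\<gamma> t = \<gamma>2 0" using \<gamma>1(4) \<gamma>2(3) unfolding True by (simp add: \<gamma>_def joinpaths_def pathstart_def pathfinish_def)
    then show ?thesis using \<gamma>2(2) by (auto simp: path_image_def)
  next
    case False
    then show ?thesis using that \<gamma>2(2) by (auto simp: \<gamma>_def joinpaths_def path_image_def)
  qed
  have \<gamma>W: "\<gamma> t \<in> W" if "t \<in> {0..1}" for t
    using \<gamma>1'[of t] \<gamma>2'[of t] that by (cases "t \<le> 1/2") (auto simp: T1_def T2_def)
  have \<gamma>ends: "\<gamma> 0 = barycenter \<psi>" "\<gamma> 1 = barycenter \<psi>" "\<gamma> (1/2) = barycenter \<phi>"
    using \<gamma>1 \<gamma>2 by (auto simp: \<gamma>_def joinpaths_def pathstart_def pathfinish_def)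
  have Pnz: "P x \<noteq> 0" if "x \<in> W" for x using P_in[OF that] P_out[OF that] by (cases "\<rho> \<subseteq> {v. x v \<noteq> 0}") auto
  define G where "G z = P (K (fst z) (\<gamma> (snd z)))" for z :: "real \<times> real"
  have "continuous_on ({0..1} \<times> {0..1}) G"
  proof -
    have "continuous_on ({0..1} \<times> {0..1}) (\<lambda>z::real \<times> real. h (\<gamma> (snd z)))"
      using \<gamma>W by (intro continuous_on_compose2[OF h(1)] continuous_on_compose2[OF c\<gamma>] continuous_intros)
        (auto simp: W_def)
    from continuous_on_product_then_coordinatewise[OF this]
    have "continuous_on ({0..1} \<times> {0..1}) (\<lambda>z::real \<times> real. \<lambda>i. (1 - fst z) * h (\<gamma> (snd z)) i)"
      by (intro continuous_on_coordinatewise_then_product continuous_intros)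
    then have "continuous_on ({0..1} \<times> {0..1}) (\<lambda>z::real \<times> real. K (fst z) (\<gamma> (snd z)))"
      unfolding K_def using KD \<gamma>W by (intro continuous_on_compose2[OF g(1)]) (auto simp: W_def)
    then show ?thesis unfolding G_def by (intro continuous_on_compose2[OF cP]) auto
  qed
  moreover have "G z \<noteq> 0" if "z \<in> {0..1} \<times> {0..1}" for z
    using that Pnz KW \<gamma>W by (auto simp: G_def)
  moreover have "G (1, t) = P (g (\<lambda>i. 0))" for t by (simp add: G_def K_def)
  moreover have "G (s, 0) = G (s, 1)" for s using \<gamma>ends by (simp add: G_def)
  ultimately obtain q where q: "continuous_on {0..1} q" "\<And>t. t \<in> {0..1} \<Longrightarrow> G (0, t) = exp (q t)" "q 0 = q 1"
    using contracted_loop_log[of G] by metis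
  have G0: "G (0, t) = P (\<gamma> t)" if "t \<in> {0..1}" for t
    using \<gamma>W[OF that] gh by (simp add: G_def K_def W_def)
  show False
  proof (rule no_log_around_origin[of "\<lambda>t. P (\<gamma> t)" q])
    show "continuous_on {0..1} (\<lambda>t. P (\<gamma> t))" by (intro continuous_on_compose2[OF cP c\<gamma>]) auto
    show "- P (\<gamma> t) \<notin> nonpos_Reals" if "t \<in> {0..1/2}" for t
      using \<gamma>1'[OF that] P_in[of "\<gamma> t"] P_out[of "\<gamma> t"]
      by (cases "\<rho> \<subseteq> {v. \<gamma> t v \<noteq> 0}") (auto simp: T1_def complex_nonpos_Reals_iff)
    show "P (\<gamma> t) \<notin> nonpos_Reals" if "t \<in> {1/2..1}" for t
      using \<gamma>2'[OF that] P_in[of "\<gamma> t"] by (auto simp: T2_def complex_nonpos_Reals_iff)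
    have "{v. barycenter \<zeta> v \<noteq> 0} = \<zeta>" if "\<zeta> \<in> F" for \<zeta> :: "'a set"
      using F(2)[OF that] by (auto simp: barycenter_def)
    then have "{v. \<gamma> 0 v \<noteq> 0} = \<psi>" "{v. \<gamma> (1/2) v \<noteq> 0} = \<phi>" using \<gamma>ends e by auto
    moreover have "\<gamma> 0 \<in> W" "\<gamma> (1/2) \<in> W" using \<gamma>W by auto
    moreover have "\<psi> \<noteq> \<rho>" "\<phi> \<noteq> \<rho>" using bc by auto
    ultimately show "Im (P (\<gamma> 0)) > 0" "Im (P (\<gamma> (1/2))) < 0"
      using P_in[of "\<gamma> 0"] P_in[of "\<gamma> (1/2)"] bc e(3) by auto
    show "P (\<gamma> 1) = P (\<gamma> 0)" using \<gamma>ends by simp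
  qed (use q G0 in auto)
qed

lemma stacked_triangulated_ball_imp_tree:
  assumes "normal_pseudomanifold d X" "d \<ge> 1" "stacked_triangulated_ball d 1 X"
  shows "undirected_tree (with_proj (dual_graph d X))"
proof (rule normal_treeI[OF assms(1,2)])
  fix \<phi> \<psi>
  assume edge: "(\<phi>, \<psi>) \<in> adj (nat (d + 1)) (facets X)"
    and detour: "(\<psi>, \<phi>) \<in> (adj (nat (d + 1)) (facets X) - {(\<phi>, \<psi>), (\<psi>, \<phi>)})\<^sup>*"
  define k where "k = nat d"
  have n: "nat (d + 1) = Suc k" and k: "k > 0" and d: "d = int (Suc k) - 1" using assms(2) by (auto simp: k_def)
  have wp: "weak_pseudomanifold d X" using assms by (simp add: normal_pseudomanifold_def)
  then have pure: "pure_complex d X" by (simp add: weak_pseudomanifold_def)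
  note pf = pure_complex_facets[OF pure, unfolded n]
  have "pm_boundary d X = {\<tau>. \<exists>\<rho>. \<tau> \<subseteq> \<rho> \<and> card \<rho> = k \<and> (\<exists>\<phi>. star (facets X) \<rho> = {\<phi>})}"
    using pm_boundary_faces_of[of "facets X" "Suc k"] pf d by simp
  then have "\<exists>\<rho>. \<sigma> \<subseteq> \<rho> \<and> card \<rho> = k \<and> (\<exists>\<phi>. star (facets X) \<rho> = {\<phi>})"
    if "\<sigma> \<in> faces_of (facets X)" "card \<sigma> < k" for \<sigma>
    using assms(3) that pf(5) by (auto simp: stacked_triangulated_ball_def stacked_wrt_def fdim_def d)
  moreover have "geometric_realization (faces_of (facets X)) homeomorphic_space closed_ball_space k"
    using assms(3) pf(5) by (simp add: stacked_triangulated_ball_def triangulated_ball_def k_def)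
  moreover have "star (facets X) (\<xi> \<inter> \<omega>) = {\<xi>, \<omega>}" if "(\<xi>, \<omega>) \<in> adj (Suc k) (facets X)" for \<xi> \<omega>
    using star_adj_Int[OF wp assms(2)] that unfolding n by simp
  ultimately show False
    using pf(1,3,4) k edge[unfolded n] detour[unfolded n]
    by (intro stacked_ball_adj_bridge[of "facets X" k \<phi> \<psi>]) simp_all
qed

section \<open>Stacked homology balls have a tree as dual graph\<close>

text \<open>A sign is a truth value, with \<open>True\<close> for plus, so that the product of two
  signs is their equality.\<close>

definition signed :: "('r, 'q) ring_scheme \<Rightarrow> bool \<Rightarrow> 'r \<Rightarrow> 'r" where
  "signed R e x = (if e then x else \<ominus>\<^bsub>R\<^esub> x)"

definition incidence :: "'a \<Rightarrow> 'a set \<Rightarrow> bool" where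
  "incidence v \<tau> \<longleftrightarrow> even (card {u \<in> \<tau>. (u, v) \<in> vertex_order})"

lemma chains_iff:
  "c \<in> carrier (chain_module R X p) \<longleftrightarrow>
    (\<forall>\<sigma>. if \<sigma> \<in> X \<and> fdim \<sigma> = p then c \<sigma> \<in> carrier R else c \<sigma> = \<zero>\<^bsub>R\<^esub>)"
  by (simp add: chain_module_def)

lemma chain_boundary_map_eq:
  "chain_boundary_map R X c \<tau> = (if \<tau> \<in> X then
    (\<Oplus>\<^bsub>R\<^esub>v \<in> {v. v \<notin> \<tau> \<and> insert v \<tau> \<in> X}. signed R (incidence v \<tau>) (c (insert v \<tau>))) else \<zero>\<^bsub>R\<^esub>)"
  by (simp add: chain_boundary_map_def signed_def incidence_def)

lemma carrier_reduced_homology: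
  "carrier (reduced_homology R X p) =
    {{(\<lambda>\<sigma>. b \<sigma> \<oplus>\<^bsub>R\<^esub> c \<sigma>) | b. b \<in> boundary_chains R X p} | c.
      c \<in> carrier (chain_module R X p) \<and> chain_boundary_map R X c = (\<lambda>\<tau>. \<zero>\<^bsub>R\<^esub>)}"
  "\<zero>\<^bsub>reduced_homology R X p\<^esub> = boundary_chains R X p"
  by (auto simp: reduced_homology_def Let_def A_RCOSETS_defs r_coset_def cycle_module_def chain_module_def)

context
  fixes R :: "('r, 'q) ring_scheme" (structure)
  assumes R: "cring R"
begin

interpretation cring R by (rule R)

lemma signed_closed [simp]: "x \<in> carrier R \<Longrightarrow> signed R e x \<in> carrier R"
  by (simp add: signed_def)

lemma signed_zero [simp]: "signed R e \<zero> = \<zero>"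
  by (simp add: signed_def)

lemma signed_signed: "x \<in> carrier R \<Longrightarrow> signed R e (signed R e' x) = signed R (e = e') x"
  by (simp add: signed_def)

lemma signed_add:
  "x \<in> carrier R \<Longrightarrow> y \<in> carrier R \<Longrightarrow> signed R e (x \<oplus> y) = signed R e x \<oplus> signed R e y"
  by (simp add: signed_def minus_add)

lemma signed_minus: "x \<in> carrier R \<Longrightarrow> signed R e (\<ominus> x) = \<ominus> signed R e x"
  by (simp add: signed_def)

lemma chain_closed: "c \<in> carrier (chain_module R X p) \<Longrightarrow> c \<sigma> \<in> carrier R"
  unfolding chains_iff by (metis zero_closed)

lemma chain_boundary_zero: "chain_boundary_map R X (\<lambda>\<sigma>. \<zero>) = (\<lambda>\<tau>. \<zero>)"
  by (auto simp: chain_boundary_map_eq fun_eq_iff)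

lemma zero_chain: "(\<lambda>\<sigma>. \<zero>) \<in> carrier (chain_module R X p)"
  by (simp add: chains_iff)

text \<open>The coset of \<open>c\<close> has to be the only coset, that of the boundaries, and it
  contains \<open>c\<close> because 0 is a boundary.\<close>

lemma homology_vanishesD:
  assumes "homology_vanishes R X p" "c \<in> carrier (chain_module R X p)"
    "chain_boundary_map R X c = (\<lambda>\<tau>. \<zero>)"
  shows "\<exists>e\<in>carrier (chain_module R X (p + 1)). chain_boundary_map R X e = c"
proof -
  let ?B = "boundary_chains R X p"
  have z: "(\<lambda>\<sigma>. \<zero>) \<in> ?B"
    using imageI[OF zero_chain[of X "p + 1"], of "chain_boundary_map R X"]
    unfolding boundary_chains_def chain_boundary_zero .
  have m: "(\<lambda>\<sigma>. \<zero> \<oplus> c \<sigma>) \<in> {(\<lambda>\<sigma>. b \<sigma> \<oplus> c \<sigma>) | b. b \<in> ?B}"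
    by (intro CollectI exI[of _ "\<lambda>\<sigma>. \<zero>"] conjI refl z)
  have e: "(\<lambda>\<sigma>. \<zero> \<oplus> c \<sigma>) = c" using chain_closed[OF assms(2)] by simp
  have "{(\<lambda>\<sigma>. b \<sigma> \<oplus> c \<sigma>) | b. b \<in> ?B} \<in> carrier (reduced_homology R X p)"
    unfolding carrier_reduced_homology(1) using assms(2,3) by (intro CollectI exI[of _ c] conjI refl)
  moreover have "carrier (reduced_homology R X p) = {?B}"
    using assms(1) unfolding homology_vanishes_def carrier_reduced_homology(2) .
  ultimately have "{(\<lambda>\<sigma>. b \<sigma> \<oplus> c \<sigma>) | b. b \<in> ?B} = ?B" by (simp only: singleton_iff)
  with m have "c \<in> ?B" unfolding e by (simp only:)
  then show ?thesis by (auto simp: boundary_chains_def)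
qed

text \<open>If 0 were the only cycle, the homology would have a single element, but it is in
  bijection with a ring that has at least two.\<close>

lemma sphere_nonzero_cycle:
  assumes "has_homology_of_sphere R X m" "\<one> \<noteq> \<zero>"
  shows "\<exists>z\<in>carrier (chain_module R X m). chain_boundary_map R X z = (\<lambda>\<tau>. \<zero>) \<and> z \<noteq> (\<lambda>\<tau>. \<zero>)"
proof (rule ccontr)
  assume no: "\<not> ?thesis"
  let ?H = "reduced_homology R X m"
  have "x = y" if xy: "x \<in> carrier ?H" "y \<in> carrier ?H" for x y
  proof -
    obtain c c' where c: "c \<in> carrier (chain_module R X m)" "chain_boundary_map R X c = (\<lambda>\<tau>. \<zero>)"
        "x = {(\<lambda>\<sigma>. b \<sigma> \<oplus> c \<sigma>) | b. b \<in> boundary_chains R X m}"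
      and c': "c' \<in> carrier (chain_module R X m)" "chain_boundary_map R X c' = (\<lambda>\<tau>. \<zero>)"
        "y = {(\<lambda>\<sigma>. b \<sigma> \<oplus> c' \<sigma>) | b. b \<in> boundary_chains R X m}"
      using xy unfolding carrier_reduced_homology(1) mem_Collect_eq by (elim exE conjE)
    have "c = c'" using no c(1,2) c'(1,2) by metis
    then show ?thesis using c(3) c'(3) by simp
  qed
  moreover obtain f where "f \<in> iso (add_monoid ?H) (add_monoid (self_module R))"
    using assms(1) by (auto simp: has_homology_of_sphere_def module_isomorphic_def)
  then have "f ` carrier ?H = carrier R" by (simp add: iso_def bij_betw_def self_module_def)
  then have "\<zero> \<in> f ` carrier ?H" "\<one> \<in> f ` carrier ?H" by simp_all
  then obtain x y where "x \<in> carrier ?H" "y \<in> carrier ?H" "\<zero> = f x" "\<one> = f y" by (elim imageE)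
  ultimately show False using assms(2) by metis
qed

text \<open>The difference of the two points is a cycle, and there is no nonzero chain of dimension
  1 that could bound it.\<close>

lemma two_points_not_acyclic:
  assumes "acyclic_complex R {{}, {u}, {w}}" "u \<noteq> w" "\<one> \<noteq> \<zero>"
  shows False
proof -
  let ?L = "{{}, {u}, {w}}"
  define k where "k \<sigma> = (if \<sigma> = {u} then \<one> else if \<sigma> = {w} then \<ominus> \<one> else \<zero>)" for \<sigma>
  have k: "k \<in> carrier (chain_module R ?L 0)"
    unfolding chains_iff by (auto simp: k_def fdim_def)
  have "chain_boundary_map R ?L k \<tau> = \<zero>" for \<tau>
  proof (cases "\<tau> = {}")
    case True
    have "{v. v \<notin> {} \<and> insert v {} \<in> ?L} = {u, w}" by auto
    then show ?thesis using True assms(2) by (simp add: chain_boundary_map_eq incidence_def signed_def k_def r_neg)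
  next
    case False
    then have "\<tau> \<notin> ?L \<or> \<tau> = {u} \<or> \<tau> = {w}" by auto
    moreover have A: "{v. v \<notin> {x} \<and> insert v {x} \<in> ?L} = {}" for x by auto
    have "chain_boundary_map R ?L k {x} = \<zero>" for x
      unfolding chain_boundary_map_eq A finsum_empty by simp
    moreover have "chain_boundary_map R ?L k \<tau> = \<zero>" if "\<tau> \<notin> ?L"
      unfolding chain_boundary_map_eq using that by (rule if_not_P)
    ultimately show ?thesis by metis
  qed
  then have kz: "chain_boundary_map R ?L k = (\<lambda>\<tau>. \<zero>)" by auto
  obtain e where e: "e \<in> carrier (chain_module R ?L (0 + 1))" "chain_boundary_map R ?L e = k"
    using homology_vanishesD[OF _ k kz] assms(1) unfolding acyclic_complex_def by blast
  have "e \<sigma> = \<zero>" for \<sigma>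
  proof -
    have "\<not> (\<sigma> \<in> ?L \<and> fdim \<sigma> = 0 + 1)" by (auto simp: fdim_def)
    then show ?thesis using e(1) unfolding chains_iff by presburger
  qed
  then have "e = (\<lambda>\<sigma>. \<zero>)" by auto
  then have "k {u} = \<zero>" using e(2) chain_boundary_zero by metis
  then show False using assms(3) by (simp add: k_def)
qed

lemma chain_boundary_sub:
  assumes "c \<in> carrier (chain_module R X p)" "c' \<in> carrier (chain_module R X p)"
  shows "chain_boundary_map R X (\<lambda>\<sigma>. c \<sigma> \<ominus> c' \<sigma>) \<tau> =
    chain_boundary_map R X c \<tau> \<ominus> chain_boundary_map R X c' \<tau>"
proof (cases "\<tau> \<in> X")
  case True
  have cl: "c \<sigma> \<in> carrier R" "c' \<sigma> \<in> carrier R" for \<sigma> using chain_closed assms by auto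
  let ?A = "{v. v \<notin> \<tau> \<and> insert v \<tau> \<in> X}"
  let ?s = "\<lambda>c v. signed R (incidence v \<tau>) (c (insert v \<tau>))"
  have "finsum R (?s (\<lambda>\<sigma>. c \<sigma> \<ominus> c' \<sigma>)) ?A = finsum R (\<lambda>v. ?s c v \<oplus> \<ominus> ?s c' v) ?A"
    using cl by (intro finsum_cong') (auto simp: minus_eq signed_add signed_minus)
  also have "\<dots> = finsum R (?s c) ?A \<oplus> finsum R (\<lambda>v. \<ominus> ?s c' v) ?A"
    using cl by (intro finsum_addf) auto
  also have "finsum R (\<lambda>v. \<ominus> ?s c' v) ?A = \<ominus> finsum R (?s c') ?A"
  proof -
    have "finsum R (\<lambda>v. \<ominus> ?s c' v) ?A \<oplus> finsum R (?s c') ?A = finsum R (\<lambda>v. \<ominus> ?s c' v \<oplus> ?s c' v) ?A"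
      using cl by (intro finsum_addf[symmetric]) auto
    also have "\<dots> = \<zero>" using cl by (intro add.finprod_one_eqI) (simp add: l_neg)
    finally show ?thesis using cl by (intro minus_equality[symmetric] finsum_closed) auto
  qed
  finally show ?thesis using True by (simp add: chain_boundary_map_eq minus_eq)
qed (simp add: chain_boundary_map_eq minus_eq)

text \<open>A chain on \<open>Y\<close> vanishes on the additional cofaces in \<open>X\<close>, and
  a face outside \<open>Y\<close> has no coface in \<open>Y\<close>. This permits passing between
  the ball and its boundary sphere.\<close>

lemma chain_boundary_subcomplex:
  assumes X: "simplicial_complex X" and Y: "simplicial_complex Y" "Y \<subseteq> X"
    and c: "c \<in> carrier (chain_module R Y p)"
  shows "chain_boundary_map R X c = chain_boundary_map R Y c"
proof
  fix \<tau>
  have z: "c (insert v \<tau>) = \<zero>" if "insert v \<tau> \<notin> Y" for v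
    using c that unfolding chains_iff by metis
  show "chain_boundary_map R X c \<tau> = chain_boundary_map R Y c \<tau>"
  proof (cases "\<tau> \<in> Y")
    case True
    have "finite (\<Union>X)" using X by (auto simp: simplicial_complex_def)
    then have "finite {v. v \<notin> \<tau> \<and> insert v \<tau> \<in> X}" by (rule rev_finite_subset) auto
    then have "(\<Oplus>v \<in> {v. v \<notin> \<tau> \<and> insert v \<tau> \<in> Y}. signed R (incidence v \<tau>) (c (insert v \<tau>))) =
      (\<Oplus>v \<in> {v. v \<notin> \<tau> \<and> insert v \<tau> \<in> X}. signed R (incidence v \<tau>) (c (insert v \<tau>)))"
      using Y(2) z chain_closed[OF c] by (intro add.finprod_mono_neutral_cong_left) auto
    then show ?thesis using True Y(2) by (auto simp: chain_boundary_map_eq)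
  next
    case False
    then have "insert v \<tau> \<notin> Y" for v using Y(1) unfolding simplicial_complex_def by blast
    then have "(\<Oplus>v \<in> {v. v \<notin> \<tau> \<and> insert v \<tau> \<in> X}. signed R (incidence v \<tau>) (c (insert v \<tau>))) = \<zero>"
      using z by (intro add.finprod_one_eqI) auto
    then show ?thesis using False by (simp add: chain_boundary_map_eq)
  qed
qed

lemma chain_subcomplex:
  assumes "c \<in> carrier (chain_module R Y p)" "Y \<subseteq> X"
  shows "c \<in> carrier (chain_module R X p)"
  using assms unfolding chains_iff by (metis subsetD zero_closed)

lemma chain_boundary_pair:
  assumes "c \<in> carrier (chain_module R X p)" "\<tau> \<in> X" "{v. v \<notin> \<tau> \<and> insert v \<tau> \<in> X} = {u, w}" "u \<noteq> w"
  shows "chain_boundary_map R X c \<tau> =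
    signed R (incidence u \<tau>) (c (insert u \<tau>)) \<oplus> signed R (incidence w \<tau>) (c (insert w \<tau>))"
  using assms chain_closed[OF assms(1)] by (simp add: chain_boundary_map_eq)

text \<open>The cancellation behind the vanishing of the double boundary: exactly one of
  \<open>v\<close> and \<open>w\<close> precedes the other, so exactly one of the two insertions
  shifts a position.\<close>

lemma incidence_insert:
  assumes "finite \<kappa>" "v \<notin> \<kappa>" "w \<notin> \<kappa>" "v \<noteq> w"
  shows "(incidence v \<kappa> = incidence w (insert v \<kappa>)) \<noteq> (incidence w \<kappa> = incidence v (insert w \<kappa>))"
proof -
  have "incidence v (insert w \<kappa>) \<longleftrightarrow> (incidence v \<kappa> \<noteq> ((w, v) \<in> vertex_order))"
    if "v \<notin> \<kappa>" "w \<notin> \<kappa>" "v \<noteq> w" for v w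
  proof -
    have "{u \<in> insert w \<kappa>. (u, v) \<in> vertex_order} =
      (if (w, v) \<in> vertex_order then insert w {u \<in> \<kappa>. (u, v) \<in> vertex_order} else {u \<in> \<kappa>. (u, v) \<in> vertex_order})"
      by auto
    then show ?thesis using assms(1) that by (simp add: incidence_def)
  qed
  moreover have "antisym (vertex_order :: 'a rel)" "total (vertex_order :: 'a rel)"
    using linear_order_vertex_order[where 'a = 'a] by (simp_all add: linear_order_on_def partial_order_on_def)
  then have "((w, v) \<in> vertex_order) \<noteq> ((v, w) \<in> vertex_order)"
    using assms(4) by (metis UNIV_I antisymD total_on_def)
  ultimately show ?thesis using assms by auto
qed

definition simplex_chain :: "'a set \<Rightarrow> 'a set \<Rightarrow> 'r" where
  "simplex_chain \<rho> = (\<lambda>\<sigma>. if \<sigma> = \<rho> then \<one> else \<zero>)"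

lemma boundary_simplex_chain_outside:
  assumes "\<not> (\<tau> \<subseteq> \<rho> \<and> Suc (card \<tau>) = card \<rho>)" "finite \<rho>"
  shows "chain_boundary_map R X (simplex_chain \<rho>) \<tau> = \<zero>"
proof -
  have "insert v \<tau> \<noteq> \<rho>" if "v \<notin> \<tau>" for v using assms that by (auto simp: card_insert_if)
  then have "(\<Oplus>v \<in> {v. v \<notin> \<tau> \<and> insert v \<tau> \<in> X}. signed R (incidence v \<tau>) (simplex_chain \<rho> (insert v \<tau>))) = \<zero>"
    by (intro add.finprod_one_eqI) (simp add: simplex_chain_def)
  then show ?thesis by (simp add: chain_boundary_map_eq)
qed

lemma boundary_simplex_chain_inside:
  assumes X: "simplicial_complex X" "insert v \<tau> \<in> X" "v \<notin> \<tau>"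
  shows "chain_boundary_map R X (simplex_chain (insert v \<tau>)) \<tau> = signed R (incidence v \<tau>) \<one>"
proof -
  have \<tau>: "\<tau> \<in> X" using X unfolding simplicial_complex_def by blast
  have "finite (\<Union>X)" using X by (auto simp: simplicial_complex_def)
  then have "finite {v. v \<notin> \<tau> \<and> insert v \<tau> \<in> X}" by (rule rev_finite_subset) auto
  moreover have "insert u \<tau> \<noteq> insert v \<tau>" if "u \<noteq> v" "u \<notin> \<tau>" for u using that X(3) by auto
  ultimately have "(\<Oplus>u \<in> {v}. signed R (incidence u \<tau>) (simplex_chain (insert v \<tau>) (insert u \<tau>))) =
    (\<Oplus>u \<in> {v. v \<notin> \<tau> \<and> insert v \<tau> \<in> X}. signed R (incidence u \<tau>) (simplex_chain (insert v \<tau>) (insert u \<tau>)))"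
    using X by (intro add.finprod_mono_neutral_cong_left) (auto simp: simplex_chain_def)
  then show ?thesis using \<tau> by (simp add: chain_boundary_map_eq simplex_chain_def)
qed

text \<open>Two complexes occur because the inner ridge \<rho> of the application lies in the ball
  but not in the sphere \<open>Y\<close>, while its boundary is to be a cycle of \<open>Y\<close>.
  Over a face of \<rho> that misses two vertices, exactly two terms meet, with opposite
  signs.\<close>

lemma boundary_boundary_simplex_chain:
  assumes X: "simplicial_complex X" "\<rho> \<in> X" and Y: "simplicial_complex Y" "\<And>\<tau>. \<tau> \<subset> \<rho> \<Longrightarrow> Suc (card \<tau>) = card \<rho> \<Longrightarrow> \<tau> \<in> Y"
  shows "chain_boundary_map R Y (chain_boundary_map R X (simplex_chain \<rho>)) = (\<lambda>\<tau>. \<zero>)"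
proof
  fix \<kappa>
  let ?y = "chain_boundary_map R X (simplex_chain \<rho>)"
  have f\<rho>: "finite \<rho>" using X by (auto simp: simplicial_complex_def)
  have cl: "?y \<tau> \<in> carrier R" for \<tau>
    by (simp add: chain_boundary_map_eq simplex_chain_def Pi_iff finsum_closed)
  let ?f = "\<lambda>v. signed R (incidence v \<kappa>) (?y (insert v \<kappa>))"
  let ?A = "{v. v \<notin> \<kappa> \<and> insert v \<kappa> \<in> Y}"
  have "finite (\<Union>Y)" using Y by (auto simp: simplicial_complex_def)
  then have finA: "finite ?A" by (rule rev_finite_subset) auto
  have "finsum R ?f ?A = \<zero>"
  proof (cases "\<kappa> \<subseteq> \<rho> \<and> Suc (Suc (card \<kappa>)) = card \<rho>")
    case False
    have "?y (insert v \<kappa>) = \<zero>" if "v \<notin> \<kappa>" for v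
    proof (rule boundary_simplex_chain_outside[OF _ f\<rho>], rule notI)
      assume *: "insert v \<kappa> \<subseteq> \<rho> \<and> Suc (card (insert v \<kappa>)) = card \<rho>"
      then have "finite \<kappa>" using finite_subset[of \<kappa> \<rho>] f\<rho> by auto
      then show False using * that False by auto
    qed
    then show ?thesis by (intro add.finprod_one_eqI) simp
  next
    case True
    have f\<kappa>: "finite \<kappa>" using True f\<rho> finite_subset by blast
    have "card (\<rho> - \<kappa>) = 2" using True card_Diff_subset[OF f\<kappa>, of \<rho>] by linarith
    then obtain v w where vw: "\<rho> - \<kappa> = {v, w}" "v \<noteq> w" by (auto simp: card_2_iff)
    then have \<rho>: "\<rho> = insert v (insert w \<kappa>)" "\<rho> = insert w (insert v \<kappa>)" and nin: "v \<notin> \<kappa>" "w \<notin> \<kappa>" using True by auto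
    have "insert v \<kappa> \<subset> \<rho>" "insert w \<kappa> \<subset> \<rho>" using vw(2) nin unfolding \<rho>(1) by auto
    moreover have "Suc (card (insert v \<kappa>)) = card \<rho>" "Suc (card (insert w \<kappa>)) = card \<rho>"
      using True nin f\<kappa> by simp_all
    ultimately have ins: "insert v \<kappa> \<in> Y" "insert w \<kappa> \<in> Y" using Y(2) by blast+
    have "finsum R ?f {v, w} = finsum R ?f ?A"
    proof (intro add.finprod_mono_neutral_cong_left finA)
      fix u assume u: "u \<in> ?A - {v, w}"
      then have "\<not> insert u \<kappa> \<subseteq> \<rho>" using vw by auto
      then have "?y (insert u \<kappa>) = \<zero>" by (intro boundary_simplex_chain_outside[OF _ f\<rho>]) blast
      then show "?f u = \<zero>" by simp
    qed (use ins nin cl in auto)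
    moreover have "?y (insert v \<kappa>) = signed R (incidence w (insert v \<kappa>)) \<one>"
      using boundary_simplex_chain_inside[OF X(1), of w "insert v \<kappa>"] X(2) vw(2) nin unfolding \<rho>(2) by simp
    moreover have "?y (insert w \<kappa>) = signed R (incidence v (insert w \<kappa>)) \<one>"
      using boundary_simplex_chain_inside[OF X(1), of v "insert w \<kappa>"] X(2) vw(2) nin unfolding \<rho>(1) by simp
    ultimately have "finsum R ?f ?A = signed R (incidence v \<kappa> = incidence w (insert v \<kappa>)) \<one> \<oplus>
      signed R (incidence w \<kappa> = incidence v (insert w \<kappa>)) \<one>"
      using vw(2) cl by (simp add: signed_signed)
    also have "\<dots> = \<zero>"
      using incidence_insert[OF f\<kappa> nin vw(2)] by (auto simp: signed_def l_neg r_neg)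
    finally show ?thesis .
  qed
  then show "chain_boundary_map R Y ?y \<kappa> = \<zero>" by (simp add: chain_boundary_map_eq)
qed

end

lemma link_faces_of:
  "link (faces_of F) \<sigma> = faces_of ((\<lambda>\<phi>. \<phi> - \<sigma>) ` star F \<sigma>)"
  by (auto simp: link_def faces_of_def star_def)

lemma stacked_homology_ball_imp_tree:
  fixes R :: "('r, 'q) ring_scheme" (structure)
  assumes X: "normal_pseudomanifold d X" "d \<ge> 1" and R: "cring R" "\<one> \<noteq> \<zero>"
    and ball: "stacked_homology_ball R d 1 X"
  shows "undirected_tree (with_proj (dual_graph d X))"
proof (rule normal_treeI[OF X])
  interpret cring R by (rule R)
  define n where "n = nat (d + 1)"
  define F where "F = facets X"
  define B where "B = homology_boundary R X"
  fix \<phi> \<psi>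
  assume "(\<phi>, \<psi>) \<in> adj (nat (d + 1)) (facets X)"
    and "(\<psi>, \<phi>) \<in> (adj (nat (d + 1)) (facets X) - {(\<phi>, \<psi>), (\<psi>, \<phi>)})\<^sup>*"
  then have edge: "(\<phi>, \<psi>) \<in> adj n F" and detour: "(\<psi>, \<phi>) \<in> (adj n F - {(\<phi>, \<psi>), (\<psi>, \<phi>)})\<^sup>*"
    by (simp_all add: n_def F_def)
  have wp: "weak_pseudomanifold d X" using X by (simp add: normal_pseudomanifold_def)
  then have pure: "pure_complex d X" by (simp add: weak_pseudomanifold_def)
  note pf = pure_complex_facets[OF pure, folded n_def F_def]
  have sc: "simplicial_complex X" using pure by (simp add: pure_complex_def)
  have hb: "acyclic_complex R X" "homology_sphere R (d - 1) B"
    and stk: "\<And>\<sigma>. \<sigma> \<in> X \<Longrightarrow> fdim \<sigma> \<le> d - 2 \<Longrightarrow> \<sigma> \<in> B"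
    using ball by (auto simp: stacked_homology_ball_def homology_ball_def stacked_wrt_def B_def)
  have BX: "B \<subseteq> X" by (auto simp: B_def homology_boundary_def)
  have scB: "simplicial_complex B" using hb by (simp add: homology_sphere_def)
  have sphB: "has_homology_of_sphere R B (d - 1)"
  proof -
    have "{} \<in> B" using scB by (simp add: simplicial_complex_def)
    moreover have "link B {} = B" by (auto simp: link_def)
    ultimately show ?thesis using hb(2) by (auto simp: homology_sphere_def fdim_def)
  qed
  \<comment> \<open>A ridge with two facets has two points as its link, which is not acyclic. Hence
    it lies outside the homological boundary.\<close>
  have ridge: "\<exists>u w. u \<noteq> w \<and> u \<notin> \<xi> \<inter> \<omega> \<and> w \<notin> \<xi> \<inter> \<omega> \<and> \<xi> = insert u (\<xi> \<inter> \<omega>) \<and> \<omega> = insert w (\<xi> \<inter> \<omega>) \<and>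
      {v. v \<notin> \<xi> \<inter> \<omega> \<and> insert v (\<xi> \<inter> \<omega>) \<in> X} = {u, w} \<and> \<xi> \<inter> \<omega> \<in> X \<and> \<xi> \<inter> \<omega> \<notin> B"
    if a: "(\<xi>, \<omega>) \<in> adj n F" for \<xi> \<omega>
  proof -
    let ?\<eta> = "\<xi> \<inter> \<omega>"
    have x: "\<xi> \<in> F" "\<omega> \<in> F" "\<xi> \<noteq> \<omega>" "Suc (card ?\<eta>) = n" using a by (auto simp: adj_def)
    have st: "star F ?\<eta> = {\<xi>, \<omega>}" using star_adj_Int[OF wp X(2)] a by (simp add: n_def F_def)
    have "finite ?\<eta>" using pf(3)[OF x(1)] by simp
    then have "card (\<xi> - ?\<eta>) = 1" "card (\<omega> - ?\<eta>) = 1" using x(4) pf(4)[OF x(1)] pf(4)[OF x(2)]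
      card_Diff_subset[of ?\<eta> \<xi>] card_Diff_subset[of ?\<eta> \<omega>] by simp_all
    then obtain u w where uw: "\<xi> - ?\<eta> = {u}" "\<omega> - ?\<eta> = {w}" by (auto simp: card_1_singleton_iff)
    then have e: "\<xi> = insert u ?\<eta>" "\<omega> = insert w ?\<eta>" "u \<notin> ?\<eta>" "w \<notin> ?\<eta>" by blast+
    then have ne: "u \<noteq> w" using x(3) by metis
    have "insert v ?\<eta> \<in> X \<longleftrightarrow> v \<in> {u, w}" if "v \<notin> ?\<eta>" for v
    proof -
      have "insert v ?\<eta> \<in> X \<longleftrightarrow> (\<exists>\<zeta>\<in>star F ?\<eta>. v \<in> \<zeta>)"
        unfolding pf(5)[symmetric] by (auto simp: faces_of_def star_def)
      also have "\<dots> \<longleftrightarrow> v \<in> \<xi> \<or> v \<in> \<omega>" unfolding st by simp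
      finally show ?thesis using e that by blast
    qed
    then have s: "{v. v \<notin> ?\<eta> \<and> insert v ?\<eta> \<in> X} = {u, w}" using e by blast
    have "link X ?\<eta> = faces_of {{u}, {w}}"
      using link_faces_of[of F ?\<eta>] unfolding pf(5) st by (simp add: uw)
    also have "\<dots> = {{}, {u}, {w}}" by (auto simp: faces_of_def)
    finally have "?\<eta> \<notin> B" using two_points_not_acyclic[OF R(1) _ ne R(2)] by (auto simp: B_def homology_boundary_def)
    moreover have "?\<eta> \<in> X" using x(1) pf(5) by (auto simp: faces_of_def)
    ultimately show ?thesis using e ne s by blast
  qed
  have bdry: "\<exists>e1 e2. \<forall>c\<in>carrier (chain_module R X d).
      chain_boundary_map R X c (\<xi> \<inter> \<omega>) = signed R e1 (c \<xi>) \<oplus> signed R e2 (c \<omega>)"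
    if a: "(\<xi>, \<omega>) \<in> adj n F" for \<xi> \<omega>
  proof -
    obtain u w where r: "u \<noteq> w" "\<xi> = insert u (\<xi> \<inter> \<omega>)" "\<omega> = insert w (\<xi> \<inter> \<omega>)"
      "{v. v \<notin> \<xi> \<inter> \<omega> \<and> insert v (\<xi> \<inter> \<omega>) \<in> X} = {u, w}" "\<xi> \<inter> \<omega> \<in> X" using ridge[OF a] by metis
    show ?thesis
      using chain_boundary_pair[OF R(1) _ r(5,4,1)] unfolding r(2,3)[symmetric] by blast
  qed
  \<comment> \<open>The sign \<open>e\<close> depends on the walk and not on the chain; this is why
    \<open>c0\<close> and \<open>c1\<close> will be governed by the same sign.\<close>
  have transport: "\<exists>e. \<forall>c\<in>carrier (chain_module R X d).
      (\<forall>(\<xi>, \<omega>)\<in>E. chain_boundary_map R X c (\<xi> \<inter> \<omega>) = \<zero>) \<longrightarrow> c \<omega>' = signed R e (c \<xi>')"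
    if E: "(\<xi>', \<omega>') \<in> E\<^sup>*" "E \<subseteq> adj n F" for E \<xi>' \<omega>'
    using E(1)
  proof (induction rule: rtrancl_induct)
    case base
    show ?case by (intro exI[of _ True]) (simp add: signed_def)
  next
    case (step \<xi> \<omega>)
    obtain e where e: "\<forall>c\<in>carrier (chain_module R X d).
      (\<forall>(\<xi>, \<omega>)\<in>E. chain_boundary_map R X c (\<xi> \<inter> \<omega>) = \<zero>) \<longrightarrow> c \<xi> = signed R e (c \<xi>')" using step by blast
    obtain e1 e2 where b: "\<forall>c\<in>carrier (chain_module R X d).
      chain_boundary_map R X c (\<xi> \<inter> \<omega>) = signed R e1 (c \<xi>) \<oplus> signed R e2 (c \<omega>)"
      using bdry[of \<xi> \<omega>] step(2) E(2) by blast
    \<comment> \<open>The vanishing boundary gives \<open>c \<omega> = \<ominus> c \<xi>\<close> if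
      \<open>e1\<close> and \<open>e2\<close> agree and \<open>c \<omega> = c \<xi>\<close>
      otherwise; the equality with \<open>e\<close> multiplies the signs.\<close>
    show ?case
    proof (intro exI[of _ "(e1 \<noteq> e2) = e"] ballI impI)
      fix c assume c: "c \<in> carrier (chain_module R X d)" "\<forall>(\<xi>, \<omega>)\<in>E. chain_boundary_map R X c (\<xi> \<inter> \<omega>) = \<zero>"
      have cl: "c \<sigma> \<in> carrier R" for \<sigma> using chain_closed[OF R(1) c(1)] .
      have "signed R e1 (c \<xi>) \<oplus> signed R e2 (c \<omega>) = \<zero>" using b c step(2) by fastforce
      then have "signed R e2 (c \<omega>) = \<ominus> signed R e1 (c \<xi>)"
        using cl signed_closed[OF R(1)] by (metis add.m_comm minus_equality minus_minus)
      then have "c \<omega> = signed R (e1 \<noteq> e2) (c \<xi>)"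
        using cl by (cases e1; cases e2) (auto simp: signed_def, (metis minus_minus)+)
      moreover have "c \<xi> = signed R e (c \<xi>')" using e c by blast
      ultimately show "c \<omega> = signed R ((e1 \<noteq> e2) = e) (c \<xi>')" using signed_signed[OF R(1) cl] by simp
    qed
  qed
  define \<rho> where "\<rho> = \<phi> \<inter> \<psi>"
  have \<rho>: "\<rho> \<in> X" "\<rho> \<notin> B" "Suc (card \<rho>) = n" using ridge[OF edge] edge by (auto simp: \<rho>_def adj_def)
  have f\<rho>: "finite \<rho>" using \<rho>(1) sc by (auto simp: simplicial_complex_def)
  have fd\<rho>: "fdim \<rho> = d - 1" using \<rho>(3) X(2) by (auto simp: fdim_def n_def)
  have other: "\<xi> \<inter> \<omega> \<noteq> \<rho>" if "(\<xi>, \<omega>) \<in> adj n F - {(\<phi>, \<psi>), (\<psi>, \<phi>)}" for \<xi> \<omega>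
  proof
    assume "\<xi> \<inter> \<omega> = \<rho>"
    then have "{\<xi>, \<omega>} = {\<phi>, \<psi>}"
      using star_adj_Int[OF wp X(2), of \<xi> \<omega>] star_adj_Int[OF wp X(2), of \<phi> \<psi>] that edge
      unfolding \<rho>_def n_def F_def by (metis DiffD1)
    then have "(\<xi>, \<omega>) = (\<phi>, \<psi>) \<or> (\<xi>, \<omega>) = (\<psi>, \<phi>)" by (simp add: doubleton_eq_iff)
    then show False using that by blast
  qed
  \<comment> \<open>\<open>c0\<close> orients the ball up to a nonzero scalar, while \<open>c1\<close> has the relative boundary \<open>\<rho>\<close>. Along
    the detour both are determined by their value at \<open>\<psi>\<close> up to the same sign, which is incompatible
    with their different boundaries at \<open>\<rho>\<close>.\<close>
  obtain c0 where c0: "c0 \<in> carrier (chain_module R X d)" "c0 \<noteq> (\<lambda>\<sigma>. \<zero>)"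
    and c0z: "\<And>\<sigma>. \<sigma> \<notin> B \<Longrightarrow> chain_boundary_map R X c0 \<sigma> = \<zero>"
  proof -
    obtain z where z: "z \<in> carrier (chain_module R B (d - 1))" "chain_boundary_map R B z = (\<lambda>\<tau>. \<zero>)" "z \<noteq> (\<lambda>\<tau>. \<zero>)"
      using sphere_nonzero_cycle[OF R(1) sphB R(2)] by blast
    have "chain_boundary_map R X z = (\<lambda>\<tau>. \<zero>)" using chain_boundary_subcomplex[OF R(1) sc scB BX z(1)] z(2) by simp
    moreover have "z \<in> carrier (chain_module R X (d - 1))" using chain_subcomplex[OF R(1) z(1) BX] .
    moreover have "homology_vanishes R X (d - 1)" using hb(1) by (simp add: acyclic_complex_def)
    ultimately obtain c where c: "c \<in> carrier (chain_module R X (d - 1 + 1))" "chain_boundary_map R X c = z"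
      using homology_vanishesD[OF R(1)] by blast
    have "c \<noteq> (\<lambda>\<sigma>. \<zero>)" using c(2) z(3) chain_boundary_zero[OF R(1)] by metis
    moreover have "z \<sigma> = \<zero>" if "\<sigma> \<notin> B" for \<sigma> using z(1) that unfolding chains_iff by metis
    ultimately show ?thesis using that[of c] c by simp
  qed
  \<comment> \<open>By stackedness the boundary of \<rho> is a cycle of \<open>B\<close>. It bounds
    a chain \<open>b\<close> there, since a sphere of dimension \<open>d - 1\<close> has no homology
    in degree \<open>d - 2\<close>. The difference of \<rho> and \<open>b\<close> is a cycle and
    bounds in the ball.\<close>
  obtain c1 where c1: "c1 \<in> carrier (chain_module R X d)" and c1\<rho>: "chain_boundary_map R X c1 \<rho> = \<one>"
    and c1z: "\<And>\<sigma>. \<sigma> \<notin> B \<Longrightarrow> \<sigma> \<noteq> \<rho> \<Longrightarrow> chain_boundary_map R X c1 \<sigma> = \<zero>"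
  proof -
    define r where "r = simplex_chain R \<rho>"
    define y where "y = chain_boundary_map R X r"
    have r: "r \<in> carrier (chain_module R X (d - 1))"
      using \<rho> fd\<rho> by (auto simp: chains_iff r_def simplex_chain_def[OF R(1)])
    have yc: "y \<tau> \<in> carrier R" for \<tau>
      using chain_closed[OF R(1) r] signed_closed[OF R(1)]
      by (simp add: y_def chain_boundary_map_eq Pi_iff finsum_closed)
    have y0: "y \<tau> = \<zero>" if "\<not> (\<tau> \<subseteq> \<rho> \<and> Suc (card \<tau>) = card \<rho>)" for \<tau>
      using boundary_simplex_chain_outside[OF R(1) that f\<rho>] by (simp add: y_def r_def)
    have inB: "\<tau> \<in> B \<and> fdim \<tau> = d - 2" if t: "\<tau> \<subseteq> \<rho>" "Suc (card \<tau>) = card \<rho>" for \<tau>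
    proof -
      have "\<tau> \<in> X" using \<rho>(1) t sc unfolding simplicial_complex_def by blast
      moreover have "fdim \<tau> = d - 2" using t fd\<rho> by (simp add: fdim_def)
      ultimately show ?thesis using stk by simp
    qed
    have y: "y \<in> carrier (chain_module R B (d - 2))"
      unfolding chains_iff
    proof
      fix \<tau> show "if \<tau> \<in> B \<and> fdim \<tau> = d - 2 then y \<tau> \<in> carrier R else y \<tau> = \<zero>"
        using yc y0 inB by (cases "\<tau> \<subseteq> \<rho> \<and> Suc (card \<tau>) = card \<rho>") auto
    qed
    have "chain_boundary_map R B y = (\<lambda>\<tau>. \<zero>)"
      unfolding y_def r_def using inB by (intro boundary_boundary_simplex_chain[OF R(1) sc \<rho>(1) scB]) auto
    moreover have "homology_vanishes R B (d - 2)" using sphB by (simp add: has_homology_of_sphere_def)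
    ultimately obtain b where b: "b \<in> carrier (chain_module R B (d - 2 + 1))" "chain_boundary_map R B b = y"
      using homology_vanishesD[OF R(1) _ y] by blast
    have b': "b \<in> carrier (chain_module R X (d - 1))" using chain_subcomplex[OF R(1) b(1) BX] by simp
    have bz: "b \<sigma> = \<zero>" if "\<sigma> \<notin> B" for \<sigma> using b(1) that unfolding chains_iff by metis
    define t where "t = (\<lambda>\<sigma>. r \<sigma> \<ominus> b \<sigma>)"
    have "chain_boundary_map R X t \<tau> = \<zero>" for \<tau>
      using chain_boundary_sub[OF R(1) r b', of \<tau>] chain_boundary_subcomplex[OF R(1) sc scB BX b(1)] b(2) yc
      by (simp add: t_def y_def[symmetric] minus_eq r_neg)
    then have "chain_boundary_map R X t = (\<lambda>\<tau>. \<zero>)" by auto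
    moreover have "t \<in> carrier (chain_module R X (d - 1))"
      using r b' unfolding chains_iff t_def by (auto simp: minus_eq split: if_splits)
    moreover have "homology_vanishes R X (d - 1)" using hb(1) by (simp add: acyclic_complex_def)
    ultimately obtain c where c: "c \<in> carrier (chain_module R X (d - 1 + 1))" "chain_boundary_map R X c = t"
      using homology_vanishesD[OF R(1)] by blast
    have "t \<rho> = \<one>" using bz[OF \<rho>(2)] by (simp add: t_def r_def simplex_chain_def[OF R(1)] minus_eq)
    moreover have "t \<sigma> = \<zero>" if "\<sigma> \<notin> B" "\<sigma> \<noteq> \<rho>" for \<sigma>
      using bz[OF that(1)] that(2) by (simp add: t_def r_def simplex_chain_def[OF R(1)] minus_eq)
    ultimately show ?thesis using that[of c] c by simp
  qed
  have cl0: "c0 \<sigma> \<in> carrier R" for \<sigma> using chain_closed[OF R(1) c0(1)] .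
  have cl1: "c1 \<sigma> \<in> carrier R" for \<sigma> using chain_closed[OF R(1) c1] .
  have adjB: "\<xi> \<inter> \<omega> \<notin> B" if "(\<xi>, \<omega>) \<in> adj n F" for \<xi> \<omega> using ridge[OF that] by blast
  let ?E = "adj n F - {(\<phi>, \<psi>), (\<psi>, \<phi>)}"
  obtain e where e: "\<And>c. c \<in> carrier (chain_module R X d) \<Longrightarrow>
      (\<forall>(\<xi>, \<omega>)\<in>?E. chain_boundary_map R X c (\<xi> \<inter> \<omega>) = \<zero>) \<Longrightarrow> c \<phi> = signed R e (c \<psi>)"
    using transport[OF detour] by blast
  have e0: "c0 \<phi> = signed R e (c0 \<psi>)" using c0z adjB by (intro e[OF c0(1)]) blast
  have e1: "c1 \<phi> = signed R e (c1 \<psi>)" using c1z adjB other by (intro e[OF c1]) blast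
  obtain s1 s2 where s: "\<And>c. c \<in> carrier (chain_module R X d) \<Longrightarrow>
      chain_boundary_map R X c \<rho> = signed R s1 (c \<phi>) \<oplus> signed R s2 (c \<psi>)"
    using bdry[OF edge] unfolding \<rho>_def by blast
  define x0 where "x0 = c0 \<psi>"
  define x1 where "x1 = c1 \<psi>"
  have x: "x0 \<in> carrier R" "x1 \<in> carrier R" by (auto simp: x0_def x1_def cl0 cl1)
  have q0: "signed R (s1 = e) x0 \<oplus> signed R s2 x0 = \<zero>"
    using s[OF c0(1)] c0z[OF \<rho>(2)] e0 signed_signed[OF R(1) x(1)] by (simp add: x0_def)
  have q1: "signed R (s1 = e) x1 \<oplus> signed R s2 x1 = \<one>"
    using s[OF c1] c1\<rho> e1 signed_signed[OF R(1) x(2)] by (simp add: x1_def)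
  \<comment> \<open>Opposite signs would turn \<open>q1\<close> into \<open>0 = 1\<close>. With
    equal signs \<open>q1\<close> makes 2 a unit, whereas \<open>q0\<close> says that 2 annihilates
    \<open>x0\<close>; so \<open>x0 = 0\<close> over every ring.\<close>
  have eq: "(s1 = e) = s2"
  proof (rule ccontr)
    assume "(s1 = e) \<noteq> s2"
    then have "signed R (s1 = e) x1 \<oplus> signed R s2 x1 = \<zero>"
      using x by (cases s2) (auto simp: signed_def l_neg r_neg)
    then show False using q1 R(2) by simp
  qed
  have "x0 \<oplus> x0 = \<zero>"
  proof -
    have "signed R s2 (x0 \<oplus> x0) = \<zero>" using q0 eq signed_add[OF R(1) x(1) x(1)] by simp
    then have "signed R s2 (signed R s2 (x0 \<oplus> x0)) = \<zero>" using signed_zero[OF R(1)] by simp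
    then show ?thesis using signed_signed[OF R(1), of "x0 \<oplus> x0" s2 s2] x by (simp add: signed_def)
  qed
  moreover have "x0 \<otimes> signed R s2 x1 \<oplus> x0 \<otimes> signed R s2 x1 = x0"
    using q1 eq x signed_closed[OF R(1) x(2)] by (simp add: r_distr[symmetric])
  moreover have "x0 \<otimes> signed R s2 x1 \<oplus> x0 \<otimes> signed R s2 x1 = (x0 \<oplus> x0) \<otimes> signed R s2 x1"
    using x signed_closed[OF R(1) x(2)] by (simp add: l_distr)
  ultimately have x00: "x0 = \<zero>" using x signed_closed[OF R(1) x(2)] by simp
  \<comment> \<open>The boundary of \<open>c0\<close> vanishes at all ridges with two facets, so one
    value determines \<open>c0\<close> up to sign along the connected dual graph.\<close>
  have "c0 \<xi> = \<zero>" if "\<xi> \<in> F" for \<xi>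
  proof -
    have "star F {} = F" "{} \<in> X" using sc by (auto simp: star_def simplicial_complex_def)
    then have "(\<psi>, \<xi>) \<in> (adj n F)\<^sup>*"
      using star_connected[OF X, of "{}" \<psi> \<xi>] that edge by (simp add: F_def n_def adj_def)
    from transport[OF this order_refl] obtain e' where
      "(\<forall>(\<xi>, \<omega>)\<in>adj n F. chain_boundary_map R X c0 (\<xi> \<inter> \<omega>) = \<zero>) \<longrightarrow> c0 \<xi> = signed R e' (c0 \<psi>)"
      using c0(1) by blast
    then have "c0 \<xi> = signed R e' (c0 \<psi>)" using c0z adjB by blast
    then show ?thesis using x00 signed_zero[OF R(1)] by (simp add: x0_def)
  qed
  moreover have "\<sigma> \<in> F" if s: "\<sigma> \<in> X" "fdim \<sigma> = d" for \<sigma>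
  proof -
    obtain \<zeta> where \<zeta>: "\<zeta> \<in> F" "\<sigma> \<subseteq> \<zeta>" using s(1) unfolding pf(5)[symmetric] by (auto simp: faces_of_def)
    have "card \<sigma> = n" using s X(2) by (auto simp: fdim_def n_def)
    then have "\<sigma> = \<zeta>" using \<zeta> pf(3,4) by (metis card_subset_eq)
    then show ?thesis using \<zeta> by simp
  qed
  ultimately have "c0 \<sigma> = \<zero>" for \<sigma> using c0(1) unfolding chains_iff by metis
  then show False using c0(2) by auto
qed

section \<open>Homology modulo two of stacked complexes\<close>

text \<open>A chain modulo two is the set of simplices with coefficient 1, and sums are symmetric
  differences. No ambient complex is involved. The empty face is counted, so the homology is
  reduced.\<close>

definition bdy :: "'a set set \<Rightarrow> 'a set set" where
  "bdy S = {\<tau>. odd (card {v. v \<notin> \<tau> \<and> insert v \<tau> \<in> S})}"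

text \<open>Simplices through \<open>a\<close> are dropped, since their cones are
  degenerate.\<close>

definition vertex_cone :: "'a \<Rightarrow> 'a set set \<Rightarrow> 'a set set" where
  "vertex_cone a S = {insert a \<tau> | \<tau>. \<tau> \<in> S \<and> a \<notin> \<tau>}"

text \<open>Parities are read off from \<open>card\<close>, which is 0 on infinite sets, so
  finiteness has to be carried along.\<close>

definition finset :: "'a set set \<Rightarrow> bool" where
  "finset S \<longleftrightarrow> finite S \<and> (\<forall>\<sigma>\<in>S. finite \<sigma>)"

lemma finset_subset: "finset T \<Longrightarrow> S \<subseteq> T \<Longrightarrow> finset S"
  by (auto simp: finset_def intro: finite_subset)

lemma finite_cofaces:
  assumes "finset S" shows "finite {v. v \<notin> \<tau> \<and> insert v \<tau> \<in> S}"
proof -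
  have "finite (\<Union>S)" using assms by (auto simp: finset_def)
  then show ?thesis by (rule rev_finite_subset) auto
qed

lemma odd_card_sym_diff:
  assumes "finite A" "finite B"
  shows "odd (card (sym_diff A B)) \<longleftrightarrow> odd (card A) \<noteq> odd (card B)"
proof -
  have "A = (A - B) \<union> (A \<inter> B)" "B = (B - A) \<union> (A \<inter> B)" by auto
  then have "card A = card (A - B) + card (A \<inter> B)" "card B = card (B - A) + card (A \<inter> B)"
    using assms by (metis Diff_Int_distrib Diff_disjoint Int_Diff card_Un_disjoint finite_Diff finite_Int inf_commute)+
  moreover have "card (sym_diff A B) = card (A - B) + card (B - A)"
    using assms by (intro card_Un_disjoint) auto
  ultimately show ?thesis by auto
qed

lemma bdy_sym_diff:
  assumes "finset S" "finset T"
  shows "bdy (sym_diff S T) = sym_diff (bdy S) (bdy T)"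
proof -
  have "{v. v \<notin> \<tau> \<and> insert v \<tau> \<in> sym_diff S T} =
    sym_diff {v. v \<notin> \<tau> \<and> insert v \<tau> \<in> S} {v. v \<notin> \<tau> \<and> insert v \<tau> \<in> T}" for \<tau> by auto
  then show ?thesis
    using odd_card_sym_diff[OF finite_cofaces[OF assms(1)] finite_cofaces[OF assms(2)]]
    by (auto simp: bdy_def simp del: Un_iff Diff_iff)
qed

lemma bdy_empty [simp]: "bdy {} = {}"
  by (simp add: bdy_def)

lemma bdy_singleton:
  shows "bdy {\<sigma>} = {\<sigma> - {v} | v. v \<in> \<sigma>}"
proof -
  have "{v. v \<notin> \<tau> \<and> insert v \<tau> \<in> {\<sigma>}} = (if \<exists>v\<in>\<sigma>. \<tau> = \<sigma> - {v} then \<sigma> - \<tau> else {})" for \<tau> by auto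
  moreover have "\<sigma> - (\<sigma> - {v}) = {v}" if "v \<in> \<sigma>" for v using that by auto
  ultimately show ?thesis by (auto simp: bdy_def)
qed

lemma bdy_finset: "finset S \<Longrightarrow> finset (bdy S)"
proof -
  assume S: "finset S"
  have "bdy S \<subseteq> (\<Union>\<sigma>\<in>S. Pow \<sigma>)"
  proof
    fix \<tau> assume "\<tau> \<in> bdy S"
    then have "{v. v \<notin> \<tau> \<and> insert v \<tau> \<in> S} \<noteq> {}" unfolding bdy_def by fastforce
    then show "\<tau> \<in> (\<Union>\<sigma>\<in>S. Pow \<sigma>)" by auto
  qed
  moreover have "finset (\<Union>\<sigma>\<in>S. Pow \<sigma>)" using S by (auto simp: finset_def intro: finite_subset)
  ultimately show ?thesis by (rule finset_subset[rotated])
qed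

lemma bdy_coface: "\<tau> \<in> bdy S \<Longrightarrow> \<exists>v. v \<notin> \<tau> \<and> insert v \<tau> \<in> S"
proof -
  assume "\<tau> \<in> bdy S"
  then have "{v. v \<notin> \<tau> \<and> insert v \<tau> \<in> S} \<noteq> {}" unfolding bdy_def by fastforce
  then show ?thesis by auto
qed

text \<open>By additivity a single simplex suffices, and there a face that misses two vertices
  arises exactly twice.\<close>

lemma bdy_bdy: "finset S \<Longrightarrow> bdy (bdy S) = {}"
proof -
  have "finite S \<Longrightarrow> \<forall>\<sigma>\<in>S. finite \<sigma> \<Longrightarrow> bdy (bdy S) = {}"
  proof (induction rule: finite_induct)
    case (insert \<sigma> S)
    have f: "finset {\<sigma>}" "finset S" using insert by (auto simp: finset_def)
    have "insert \<sigma> S = sym_diff {\<sigma>} S" using insert.hyps by auto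
    then have "bdy (bdy (insert \<sigma> S)) = sym_diff (bdy (bdy {\<sigma>})) (bdy (bdy S))"
      using bdy_sym_diff f bdy_finset by metis
    moreover have "bdy (bdy {\<sigma>}) = {}"
    proof -
      have "even (card {v. v \<notin> \<kappa> \<and> insert v \<kappa> \<in> bdy {\<sigma>}})" for \<kappa>
      proof (cases "\<exists>v w. v \<noteq> w \<and> v \<in> \<sigma> \<and> w \<in> \<sigma> \<and> \<kappa> = \<sigma> - {v, w}")
        case True
        then obtain v w where vw: "v \<noteq> w" "v \<in> \<sigma>" "w \<in> \<sigma>" "\<kappa> = \<sigma> - {v, w}" by auto
        then have "insert v \<kappa> = \<sigma> - {w}" "insert w \<kappa> = \<sigma> - {v}" by auto
        moreover have "u \<in> {v, w}" if "u \<notin> \<kappa>" "insert u \<kappa> = \<sigma> - {x}" for u x using vw that by auto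
        ultimately have "{v. v \<notin> \<kappa> \<and> insert v \<kappa> \<in> bdy {\<sigma>}} = {v, w}"
          unfolding bdy_singleton using vw by auto
        then show ?thesis using vw(1) by simp
      next
        case False
        have "{v. v \<notin> \<kappa> \<and> insert v \<kappa> \<in> bdy {\<sigma>}} = {}"
        proof (rule ccontr)
          assume "\<not> ?thesis"
          then obtain v w where "v \<notin> \<kappa>" "insert v \<kappa> = \<sigma> - {w}" "w \<in> \<sigma>" unfolding bdy_singleton by auto
          then have "v \<noteq> w \<and> v \<in> \<sigma> \<and> w \<in> \<sigma> \<and> \<kappa> = \<sigma> - {v, w}" by auto
          then show False using False by blast
        qed
        then show ?thesis by (simp only: card.empty) simp
      qed
      then show ?thesis by (subst bdy_def) auto
    qed
    moreover have "bdy (bdy S) = {}" using insert by auto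
    ultimately show ?case by simp
  qed simp
  then show "finset S \<Longrightarrow> ?thesis" by (auto simp: finset_def)
qed

text \<open>The cone as a chain homotopy. A simplex through \<open>a\<close> contributes nothing on
  the left; on the right it cancels against the cone over its face opposite to
  \<open>a\<close>.\<close>

lemma bdy_cone:
  assumes "finset S"
  shows "bdy (vertex_cone a S) = sym_diff S (vertex_cone a (bdy S))"
proof -
  have "\<tau> \<in> bdy (vertex_cone a S) \<longleftrightarrow> \<tau> \<in> sym_diff S (vertex_cone a (bdy S))" for \<tau>
  proof (cases "a \<in> \<tau>")
    case False
    have "insert v \<tau> \<in> vertex_cone a S \<longleftrightarrow> v = a \<and> \<tau> \<in> S" if "v \<notin> \<tau>" for v
      using that False unfolding vertex_cone_def by (auto simp: insert_eq_iff split: if_splits)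
    then have "{v. v \<notin> \<tau> \<and> insert v \<tau> \<in> vertex_cone a S} = (if \<tau> \<in> S then {a} else {})" using False by auto
    moreover have "\<tau> \<notin> vertex_cone a (bdy S)" using False by (auto simp: vertex_cone_def)
    ultimately show ?thesis by (auto simp: bdy_def)
  next
    case True
    define \<tau>' where "\<tau>' = \<tau> - {a}"
    have \<tau>: "\<tau> = insert a \<tau>'" "a \<notin> \<tau>'" using True by (auto simp: \<tau>'_def)
    have c1: "insert a \<kappa> \<in> vertex_cone a T \<longleftrightarrow> \<kappa> \<in> T" if "a \<notin> \<kappa>" for \<kappa> T
      using that unfolding vertex_cone_def by (auto simp: insert_eq_iff)
    have "insert v \<tau> \<in> vertex_cone a S \<longleftrightarrow> insert v \<tau>' \<in> S" if "v \<notin> \<tau>" for v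
      using c1[of "insert v \<tau>'" S] that \<tau> by (auto simp: insert_commute)
    then have "{v. v \<notin> \<tau> \<and> insert v \<tau> \<in> vertex_cone a S} = {v. v \<notin> \<tau> \<and> insert v \<tau>' \<in> S}" by auto
    moreover have "{v. v \<notin> \<tau>' \<and> insert v \<tau>' \<in> S} =
      (if \<tau> \<in> S then insert a {v. v \<notin> \<tau> \<and> insert v \<tau>' \<in> S} else {v. v \<notin> \<tau> \<and> insert v \<tau>' \<in> S})"
      using \<tau> by auto
    moreover have "finite {v. v \<notin> \<tau> \<and> insert v \<tau>' \<in> S}"
      using finite_cofaces[OF assms, of \<tau>'] by (rule rev_finite_subset) (use \<tau> in auto)
    moreover have "a \<notin> {v. v \<notin> \<tau> \<and> insert v \<tau>' \<in> S}" using \<tau> by auto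
    ultimately have "\<tau> \<in> bdy (vertex_cone a S) \<longleftrightarrow> (\<tau> \<in> S) \<noteq> (\<tau>' \<in> bdy S)" by (simp add: bdy_def)
    moreover have "\<tau> \<in> vertex_cone a (bdy S) \<longleftrightarrow> \<tau>' \<in> bdy S" using c1[OF \<tau>(2)] \<tau>(1) by simp
    ultimately show ?thesis by auto
  qed
  then show ?thesis by blast
qed

definition layer :: "'a set set \<Rightarrow> int \<Rightarrow> 'a set set" where
  "layer X p = {\<sigma> \<in> X. fdim \<sigma> = p}"

definition cyc :: "'a set set \<Rightarrow> int \<Rightarrow> 'a set set \<Rightarrow> bool" where
  "cyc X p S \<longleftrightarrow> S \<subseteq> layer X p \<and> bdy S = {}"

definition bounds :: "'a set set \<Rightarrow> int \<Rightarrow> 'a set set \<Rightarrow> bool" where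
  "bounds X p S \<longleftrightarrow> (\<exists>T \<subseteq> layer X (p + 1). bdy T = S)"

definition mod2_acyclic :: "'a set set \<Rightarrow> bool" where
  "mod2_acyclic X \<longleftrightarrow> (\<forall>p S. cyc X p S \<longrightarrow> bounds X p S)"

text \<open>Without simplices of dimension \<open>m + 1\<close>, the homology in degree
  \<open>m\<close> is the group of cycles, which is required to have order two.\<close>

definition mod2_sphere :: "'a set set \<Rightarrow> int \<Rightarrow> bool" where
  "mod2_sphere X m \<longleftrightarrow> layer X (m + 1) = {} \<and> (\<exists>z. z \<noteq> {} \<and> (\<forall>S. cyc X m S \<longleftrightarrow> S = {} \<or> S = z)) \<and>
     (\<forall>p S. p \<noteq> m \<longrightarrow> cyc X p S \<longrightarrow> bounds X p S)"

lemma finset_layer: "simplicial_complex X \<Longrightarrow> S \<subseteq> layer X p \<Longrightarrow> finset S"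
  by (auto simp: simplicial_complex_def layer_def finset_def intro: finite_subset)

lemma bounds_empty: "bounds X p {}"
  by (auto simp: bounds_def intro!: exI[of _ "{}"])

lemma cyc_cone:
  assumes X: "simplicial_complex X" and S: "cyc X p S" and a: "\<And>\<sigma>. \<sigma> \<in> X \<Longrightarrow> insert a \<sigma> \<in> X"
  shows "bounds X p S"
proof -
  have f: "finset S" using S finset_layer[OF X] by (auto simp: cyc_def)
  have "bdy (vertex_cone a S) = S" using bdy_cone[OF f, of a] S by (simp add: cyc_def vertex_cone_def)
  moreover have "vertex_cone a S \<subseteq> layer X (p + 1)"
    using S a f by (auto simp: cyc_def vertex_cone_def layer_def fdim_def finset_def)
  ultimately show ?thesis by (auto simp: bounds_def)
qed

text \<open>A cycle is first pushed off the new vertex \<open>b\<close> by adding a boundary and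
  then bounds in the old complex. The apex \<open>a\<close> of the cones is chosen in \<alpha>, so
  the cones stay inside the new simplex.\<close>

lemma stacked_mod2_acyclic:
  assumes "stacked n F" "2 \<le> n"
  shows "mod2_acyclic (faces_of F)"
  using assms(1)
proof induction
  case (stacked_simplex \<phi>)
  then obtain a where a: "a \<in> \<phi>" using assms(2) by fastforce
  have "faces_of {\<phi>} = Pow \<phi>" by (auto simp: faces_of_def)
  moreover have "simplicial_complex (Pow \<phi>)" using stacked_simplex by (auto simp: simplicial_complex_def intro: finite_subset)
  ultimately show ?case unfolding mod2_acyclic_def using cyc_cone[of "Pow \<phi>" _ _ a] a by auto
next
  case (stacked_step F \<psi> \<alpha> b)
  let ?X = "faces_of F" and ?X' = "faces_of (insert (insert b \<alpha>) F)"
  have st: "stacked n (insert (insert b \<alpha>) F)" by (rule stacked.stacked_step[OF stacked_step.hyps])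
  note f = stacked_facets[OF stacked_step.hyps(1)] and f' = stacked_facets[OF st]
  have X: "simplicial_complex ?X" "simplicial_complex ?X'"
    using f f' by (auto intro: simplicial_complex_faces_of)
  have "\<alpha> \<noteq> {}" using stacked_step.hyps(4) assms(2) by auto
  then obtain a where a: "a \<in> \<alpha>" by auto
  have b: "b \<notin> \<alpha>" using stacked_step.hyps(2,3,6) by auto
  have ab: "a \<noteq> b" using a b by auto
  have sub: "\<sigma> \<in> ?X" if "\<sigma> \<in> ?X'" "b \<notin> \<sigma>" for \<sigma>
    using that stacked_step.hyps(2,3) unfolding faces_of_def by blast
  have bX': "\<sigma> \<subseteq> insert b \<alpha>" if "\<sigma> \<in> ?X'" "b \<in> \<sigma>" for \<sigma>
    using that stacked_step.hyps(6) unfolding faces_of_def by blast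
  have XX': "?X \<subseteq> ?X'" by (auto simp: faces_of_def)
  show ?case unfolding mod2_acyclic_def
  proof (intro allI impI)
    fix p S assume S: "cyc ?X' p S"
    then have SL: "S \<subseteq> layer ?X' p" and bS: "bdy S = {}" by (auto simp: cyc_def)
    have fS: "finset S" using finset_layer[OF X(2) SL] .
    \<comment> \<open>The simplices through \<open>b\<close> are removed from the cycle by adding the boundary of their cone over
      \<open>a\<close>.\<close>
    define E where "E = {\<sigma> \<in> S. b \<in> \<sigma>}"
    define G where "G = vertex_cone a E"
    have fE: "finset E" using finset_subset[OF fS] by (auto simp: E_def)
    have bG: "bdy G = sym_diff E (vertex_cone a (bdy E))" unfolding G_def by (rule bdy_cone[OF fE])
    have GL: "G \<subseteq> layer ?X' (p + 1)"
    proof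
      fix \<sigma> assume "\<sigma> \<in> G"
      then obtain \<tau> where \<tau>: "\<sigma> = insert a \<tau>" "\<tau> \<in> S" "b \<in> \<tau>" "a \<notin> \<tau>" by (auto simp: G_def vertex_cone_def E_def)
      then have "\<tau> \<in> ?X'" "fdim \<tau> = p" using SL by (auto simp: layer_def)
      moreover have "finite \<tau>" using \<tau> fS by (auto simp: finset_def)
      moreover have "insert a \<tau> \<subseteq> insert b \<alpha>" using bX'[OF \<open>\<tau> \<in> ?X'\<close> \<tau>(3)] a by auto
      ultimately show "\<sigma> \<in> layer ?X' (p + 1)" using \<tau> by (auto simp: layer_def fdim_def faces_of_def)
    qed
    have fG: "finset G" using finset_layer[OF X(2) GL] .
    define S' where "S' = sym_diff S (bdy G)"
    \<comment> \<open>A surviving simplex through \<open>b\<close> would be the cone over some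
      \<tau> through \<open>b\<close> in the boundary of \<open>E\<close>. All cofaces of \<tau>
      contain \<open>b\<close>, so \<tau> would already be in the boundary of the cycle
      \<open>S\<close>.\<close>
    have "b \<notin> \<sigma>" if "\<sigma> \<in> S'" for \<sigma>
    proof
      assume b\<sigma>: "b \<in> \<sigma>"
      then have "\<sigma> \<in> vertex_cone a (bdy E)" using that unfolding S'_def bG by (auto simp: E_def)
      then obtain \<tau> where \<tau>: "\<sigma> = insert a \<tau>" "\<tau> \<in> bdy E" by (auto simp: vertex_cone_def)
      then have "b \<in> \<tau>" using b\<sigma> ab by auto
      then have "{v. v \<notin> \<tau> \<and> insert v \<tau> \<in> E} = {v. v \<notin> \<tau> \<and> insert v \<tau> \<in> S}" by (auto simp: E_def)
      then have "\<tau> \<in> bdy S" using \<tau>(2) by (simp add: bdy_def)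
      then show False using bS by simp
    qed
    moreover have "bdy G \<subseteq> layer ?X' p"
    proof
      fix \<tau> assume "\<tau> \<in> bdy G"
      then obtain v where v: "v \<notin> \<tau>" "insert v \<tau> \<in> G" using bdy_coface by metis
      then have "insert v \<tau> \<in> ?X'" "fdim (insert v \<tau>) = p + 1" "finite (insert v \<tau>)" using GL fG by (auto simp: layer_def finset_def)
      then show "\<tau> \<in> layer ?X' p" using v by (auto simp: layer_def fdim_def faces_of_def)
    qed
    ultimately have "S' \<subseteq> layer ?X p" using SL sub unfolding S'_def layer_def by blast
    moreover have "bdy S' = {}" unfolding S'_def using bdy_sym_diff[OF fS bdy_finset[OF fG]] bS bdy_bdy[OF fG] by simp
    ultimately have "bounds ?X p S'" using stacked_step.IH by (auto simp: mod2_acyclic_def cyc_def)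
    then obtain T where T: "T \<subseteq> layer ?X (p + 1)" "bdy T = S'" by (auto simp: bounds_def)
    have fT: "finset T" using finset_layer[OF X(1) T(1)] .
    have "bdy (sym_diff T G) = S" using bdy_sym_diff[OF fT fG] T(2) by (auto simp: S'_def)
    moreover have "sym_diff T G \<subseteq> layer ?X' (p + 1)" using T(1) GL XX' by (auto simp: layer_def)
    ultimately show "bounds ?X' p S" unfolding bounds_def by blast
  qed
qed

section \<open>Links, inner ridges and the boundary sphere modulo two\<close>

text \<open>If \<sigma> lies in \<alpha>, the gluing step at \<alpha> becomes one at
  \<open>\<alpha> - \<sigma>\<close>. If \<sigma> lies in the new simplex and contains
  \<open>b\<close>, that simplex is alone in the star; in the remaining case the star does not
  change.\<close>

lemma stacked_link:
  assumes "stacked n F" "\<sigma> \<in> faces_of F"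
  shows "stacked (n - card \<sigma>) ((\<lambda>\<phi>. \<phi> - \<sigma>) ` star F \<sigma>)"
  using assms
proof induction
  case (stacked_simplex \<phi>)
  then have "\<sigma> \<subseteq> \<phi>" by (simp add: faces_of_def)
  then have "(\<lambda>\<phi>. \<phi> - \<sigma>) ` star {\<phi>} \<sigma> = {\<phi> - \<sigma>}" "card (\<phi> - \<sigma>) = n - card \<sigma>"
    using stacked_simplex.hyps by (auto simp: star_def card_Diff_subset finite_subset)
  then show ?case using stacked_simplex.hyps by (simp add: stacked.stacked_simplex)
next
  case (stacked_step F \<psi> \<alpha> b)
  let ?\<phi> = "insert b \<alpha>" and ?l = "\<lambda>\<phi>. \<phi> - \<sigma>"
  have st: "stacked n (insert ?\<phi> F)" by (rule stacked.stacked_step[OF stacked_step.hyps])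
  note f = stacked_facets[OF stacked_step.hyps(1)] and f' = stacked_facets[OF st]
  have b: "b \<notin> \<alpha>" using stacked_step.hyps(2,3,6) by auto
  have f\<phi>: "finite ?\<phi>" "card ?\<phi> = n" using f' by auto
  consider "\<not> \<sigma> \<subseteq> ?\<phi>" | "\<sigma> \<subseteq> \<alpha>" | "\<sigma> \<subseteq> ?\<phi>" "b \<in> \<sigma>" by blast
  then show ?case
  proof cases
    case 1
    then have "star (insert ?\<phi> F) \<sigma> = star F \<sigma>" by (auto simp: star_def)
    moreover have "\<sigma> \<in> faces_of F" using 1 stacked_step.prems by (simp add: faces_of_insert)
    ultimately show ?thesis using stacked_step.IH by simp
  next
    case 3
    then have "star (insert ?\<phi> F) \<sigma> = {?\<phi>}" using stacked_step.hyps(6) by (auto simp: star_def)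
    moreover have "card (?\<phi> - \<sigma>) = n - card \<sigma>" using 3 f\<phi> by (metis card_Diff_subset finite_subset)
    ultimately show ?thesis using f\<phi> by (simp add: stacked.stacked_simplex)
  next
    case 2
    have b\<sigma>: "b \<notin> \<sigma>" using 2 b by auto
    have star: "star (insert ?\<phi> F) \<sigma> = insert ?\<phi> (star F \<sigma>)" using 2 by (auto simp: star_def)
    have "stacked (n - card \<sigma>) (insert (insert b (\<alpha> - \<sigma>)) (?l ` star F \<sigma>))"
    proof (rule stacked.stacked_step)
      show "stacked (n - card \<sigma>) (?l ` star F \<sigma>)"
        using stacked_step.IH 2 stacked_step.hyps(2,3) by (auto simp: faces_of_def)
      show "\<psi> - \<sigma> \<in> ?l ` star F \<sigma>" using stacked_step.hyps(2,3) 2 by (auto simp: star_def)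
      show "\<alpha> - \<sigma> \<subseteq> \<psi> - \<sigma>" using stacked_step.hyps(3) by auto
      have "card \<sigma> \<le> card \<alpha>" "card (\<alpha> - \<sigma>) = card \<alpha> - card \<sigma>"
        using 2 f\<phi> by (auto simp: card_mono card_Diff_subset finite_subset)
      then show "Suc (card (\<alpha> - \<sigma>)) = n - card \<sigma>" using stacked_step.hyps(4) by simp
      show "\<xi> = \<psi> - \<sigma>" if "\<xi> \<in> ?l ` star F \<sigma>" "\<alpha> - \<sigma> \<subseteq> \<xi>" for \<xi>
      proof -
        obtain \<omega> where \<omega>: "\<omega> \<in> F" "\<sigma> \<subseteq> \<omega>" "\<xi> = \<omega> - \<sigma>" using \<open>\<xi> \<in> ?l ` star F \<sigma>\<close> by (auto simp: star_def)
        then have "\<alpha> \<subseteq> \<omega>" using \<open>\<alpha> - \<sigma> \<subseteq> \<xi>\<close> 2 by blast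
        then show ?thesis using stacked_step.hyps(5) \<omega> by blast
      qed
      show "b \<notin> \<Union>(?l ` star F \<sigma>)" using stacked_step.hyps(6) by (auto simp: star_def)
    qed
    moreover have "?\<phi> - \<sigma> = insert b (\<alpha> - \<sigma>)" using b\<sigma> by auto
    ultimately show ?thesis unfolding star by simp
  qed
qed

definition inner_ridge :: "nat \<Rightarrow> 'a set set \<Rightarrow> 'a set \<Rightarrow> bool" where
  "inner_ridge n F \<rho> \<longleftrightarrow> Suc (card \<rho>) = n \<and> \<rho> \<in> faces_of F \<and> \<not> (\<exists>\<phi>. star F \<rho> = {\<phi>})"

text \<open>The ridges of the new simplex other than \<alpha> contain \<open>b\<close> and lie in no
  other facet, and the old inner ridges are not in the new simplex. So a step adds one facet and one
  inner ridge, as a tree grows by a leaf.\<close>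

lemma inner_ridge_step:
  assumes st: "stacked n F" "\<psi> \<in> F" "\<alpha> \<subseteq> \<psi>" "Suc (card \<alpha>) = n"
    "\<forall>\<xi>\<in>F. \<alpha> \<subseteq> \<xi> \<longrightarrow> \<xi> = \<psi>" "b \<notin> \<Union>F"
  shows "inner_ridge n (insert (insert b \<alpha>) F) \<rho> \<longleftrightarrow> inner_ridge n F \<rho> \<or> \<rho> = \<alpha>"
    and "inner_ridge n F \<rho> \<Longrightarrow> \<not> \<rho> \<subseteq> insert b \<alpha>"
    and "star F \<alpha> = {\<psi>}" and "star (insert (insert b \<alpha>) F) \<alpha> = {insert b \<alpha>, \<psi>}"
proof -
  let ?\<phi> = "insert b \<alpha>"
  have f: "finite \<alpha>" using stacked_facets[OF st(1)] st(2,3) finite_subset by blast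
  show s1: "star F \<alpha> = {\<psi>}" using st(2,3,5) unfolding star_def by blast
  show s2: "star (insert ?\<phi> F) \<alpha> = {?\<phi>, \<psi>}" using s1 unfolding star_def by blast
  have ne: "?\<phi> \<noteq> \<psi>" using st(2,6) by auto
  have sub: "\<rho> = \<alpha> \<or> b \<in> \<rho>" if "\<rho> \<subseteq> ?\<phi>" "Suc (card \<rho>) = n" for \<rho>
  proof (cases "b \<in> \<rho>")
    case False
    then have "\<rho> \<subseteq> \<alpha>" using that by auto
    then show ?thesis using that(2) st(4) f by (metis card_subset_eq nat.inject)
  qed simp
  show *: "\<not> \<rho> \<subseteq> ?\<phi>" if i: "inner_ridge n F \<rho>" for \<rho>
  proof
    assume "\<rho> \<subseteq> ?\<phi>"
    moreover have "\<rho> \<noteq> \<alpha>" using i s1 by (auto simp: inner_ridge_def)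
    ultimately have "b \<in> \<rho>" using sub i by (auto simp: inner_ridge_def)
    then show False using i st(6) by (auto simp: inner_ridge_def faces_of_def)
  qed
  show "inner_ridge n (insert ?\<phi> F) \<rho> \<longleftrightarrow> inner_ridge n F \<rho> \<or> \<rho> = \<alpha>"
  proof
    assume i: "inner_ridge n (insert ?\<phi> F) \<rho>"
    show "inner_ridge n F \<rho> \<or> \<rho> = \<alpha>"
    proof (cases "\<rho> \<subseteq> ?\<phi>")
      case True
      have "\<not> b \<in> \<rho>"
      proof
        assume "b \<in> \<rho>"
        then have "star (insert ?\<phi> F) \<rho> = {?\<phi>}" using True st(6) unfolding star_def by blast
        then show False using i by (auto simp: inner_ridge_def)
      qed
      then show ?thesis using sub True i by (auto simp: inner_ridge_def)
    next
      case False
      then have "star (insert ?\<phi> F) \<rho> = star F \<rho>" by (auto simp: star_def)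
      then show ?thesis using i False by (auto simp: inner_ridge_def faces_of_insert)
    qed
  next
    assume "inner_ridge n F \<rho> \<or> \<rho> = \<alpha>"
    then show "inner_ridge n (insert ?\<phi> F) \<rho>"
    proof
      assume i: "inner_ridge n F \<rho>"
      then have "star (insert ?\<phi> F) \<rho> = star F \<rho>" using * by (auto simp: star_def)
      then show ?thesis using i by (auto simp: inner_ridge_def faces_of_insert)
    next
      assume "\<rho> = \<alpha>"
      moreover have "\<not> (\<exists>\<xi>. {?\<phi>, \<psi>} = {\<xi>})" using ne by (auto simp: doubleton_eq_iff)
      ultimately show ?thesis using s2 st(4) by (auto simp: inner_ridge_def faces_of_insert)
    qed
  qed
qed

lemma inner_ridge_two:
  assumes "stacked n F" "inner_ridge n F \<rho>"
  shows "\<exists>\<phi> \<psi>. \<phi> \<noteq> \<psi> \<and> star F \<rho> = {\<phi>, \<psi>}"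
  using assms
proof induction
  case (stacked_simplex \<phi>)
  then show ?case by (auto simp: inner_ridge_def faces_of_def star_def)
next
  case (stacked_step F \<psi> \<alpha> b)
  have un: "\<forall>\<xi>\<in>F. \<alpha> \<subseteq> \<xi> \<longrightarrow> \<xi> = \<psi>" using stacked_step.hyps(5) by blast
  note i = inner_ridge_step[OF stacked_step.hyps(1-4) un stacked_step.hyps(6)]
  show ?case
  proof (cases "\<rho> = \<alpha>")
    case True
    have "insert b \<alpha> \<noteq> \<psi>" using stacked_step.hyps(2,6) by auto
    then show ?thesis unfolding True i(4) by (intro exI[of _ "insert b \<alpha>"] exI[of _ \<psi>]) simp
  next
    case False
    then have r: "inner_ridge n F \<rho>" using i(1) stacked_step.prems by blast
    then have "star (insert (insert b \<alpha>) F) \<rho> = star F \<rho>" using i(2) by (auto simp: star_def)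
    then show ?thesis using stacked_step.IH r by simp
  qed
qed

text \<open>Taking the new simplex into \<open>H\<close> or leaving it out corrects the parity at
  \<alpha> and touches no older inner ridge. In other words, the homology relative to the boundary
  vanishes in dimension \<open>n - 2\<close>.\<close>

lemma stacked_prescribed_parity:
  assumes "stacked n F"
  shows "\<exists>H\<subseteq>F. \<forall>\<rho>. inner_ridge n F \<rho> \<longrightarrow> (odd (card (star H \<rho>)) \<longleftrightarrow> \<rho> \<in> P)"
  using assms
proof induction
  case (stacked_simplex \<phi>)
  then show ?case by (intro exI[of _ "{}"]) (auto simp: inner_ridge_def faces_of_def star_def)
next
  case (stacked_step F \<psi> \<alpha> b)
  let ?\<phi> = "insert b \<alpha>"
  have un: "\<forall>\<xi>\<in>F. \<alpha> \<subseteq> \<xi> \<longrightarrow> \<xi> = \<psi>" using stacked_step.hyps(5) by blast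
  note i = inner_ridge_step[OF stacked_step.hyps(1-4) un stacked_step.hyps(6)]
  obtain H where H: "H \<subseteq> F" "\<And>\<rho>. inner_ridge n F \<rho> \<Longrightarrow> odd (card (star H \<rho>)) \<longleftrightarrow> \<rho> \<in> P"
    using stacked_step.IH by blast
  define H' where "H' = (if odd (card (star H \<alpha>)) \<longleftrightarrow> \<alpha> \<in> P then H else insert ?\<phi> H)"
  have "?\<phi> \<notin> H" using H(1) stacked_step.hyps(6) by auto
  moreover have "finite H" using H(1) stacked_facets[OF stacked_step.hyps(1)] finite_subset by blast
  moreover have "star (insert ?\<phi> H) \<alpha> = insert ?\<phi> (star H \<alpha>)" by (auto simp: star_def)
  ultimately have "odd (card (star H' \<alpha>)) \<longleftrightarrow> \<alpha> \<in> P" by (auto simp: H'_def star_def)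
  moreover have "star H' \<rho> = star H \<rho>" if "inner_ridge n F \<rho>" for \<rho>
    using i(2)[OF that] by (auto simp: H'_def star_def)
  ultimately have "\<forall>\<rho>. inner_ridge n (insert ?\<phi> F) \<rho> \<longrightarrow> (odd (card (star H' \<rho>)) \<longleftrightarrow> \<rho> \<in> P)"
    unfolding i(1) using H(2) by auto
  moreover have "H' \<subseteq> insert ?\<phi> F" using H(1) by (auto simp: H'_def)
  ultimately show ?case by blast
qed

text \<open>\<open>H\<close> is a relative cycle of top dimension. The parity at \<alpha> puts the
  new simplex into \<open>H\<close> exactly if its neighbour is there, so only 0 and the fundamental
  cycle are left.\<close>

lemma stacked_even_parity:
  assumes "stacked n F" "H \<subseteq> F" "\<And>\<rho>. inner_ridge n F \<rho> \<Longrightarrow> even (card (star H \<rho>))"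
  shows "H = {} \<or> H = F"
  using assms
proof (induction arbitrary: H)
  case (stacked_simplex \<phi>)
  then show ?case by auto
next
  case (stacked_step F \<psi> \<alpha> b)
  let ?\<phi> = "insert b \<alpha>"
  have un: "\<forall>\<xi>\<in>F. \<alpha> \<subseteq> \<xi> \<longrightarrow> \<xi> = \<psi>" using stacked_step.hyps(5) by blast
  note i = inner_ridge_step[OF stacked_step.hyps(1-4) un stacked_step.hyps(6)]
  have nF: "?\<phi> \<notin> F" using stacked_step.hyps(6) by auto
  define H' where "H' = H - {?\<phi>}"
  have "even (card (star H' \<rho>))" if "inner_ridge n F \<rho>" for \<rho>
  proof -
    have "star H' \<rho> = star H \<rho>" using i(2)[OF that] by (auto simp: H'_def star_def)
    then show ?thesis using stacked_step.prems(2) that i(1) by simp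
  qed
  moreover have "H' \<subseteq> F" using stacked_step.prems(1) by (auto simp: H'_def)
  ultimately consider "H' = {}" | "H' = F" using stacked_step.IH[of H'] by blast
  moreover have ev: "even (card (star H \<alpha>))" using stacked_step.prems(2) i(1) by blast
  ultimately show ?case
  proof cases
    case 1
    have "?\<phi> \<notin> H"
    proof
      assume "?\<phi> \<in> H"
      then have "H = {?\<phi>}" using 1 by (auto simp: H'_def)
      then have "star H \<alpha> = {?\<phi>}" by (auto simp: star_def)
      then show False using ev by simp
    qed
    then show ?thesis using 1 by (auto simp: H'_def)
  next
    case 2
    have "?\<phi> \<in> H"
    proof (rule ccontr)
      assume "?\<phi> \<notin> H"
      then have "H = F" using 2 by (auto simp: H'_def)
      then show False using ev i(3) by simp
    qed
    then show ?thesis using 2 by (auto simp: H'_def)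
  qed
qed

definition boundary_ridges :: "nat \<Rightarrow> 'a set set \<Rightarrow> 'a set set" where
  "boundary_ridges n F = {\<rho>. Suc (card \<rho>) = n \<and> (\<exists>\<phi>. star F \<rho> = {\<phi>})}"

lemma boundary_ridges_facets:
  assumes "stacked n F" "2 \<le> n"
  shows "finite (boundary_ridges n F)" "boundary_ridges n F \<noteq> {}"
    "\<And>\<rho>. \<rho> \<in> boundary_ridges n F \<Longrightarrow> finite \<rho> \<and> card \<rho> = n - 1"
    "boundary_ridges n F \<subseteq> faces_of F" "faces_of (boundary_ridges n F) \<subseteq> faces_of F"
proof -
  note f = stacked_facets[OF assms(1)]
  show sub: "boundary_ridges n F \<subseteq> faces_of F" by (auto simp: boundary_ridges_def faces_of_def star_def)
  have sc: "simplicial_complex (faces_of F)" using f by (auto intro: simplicial_complex_faces_of)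
  then have "finite (faces_of F)" by (simp add: simplicial_complex_def)
  then show "finite (boundary_ridges n F)" using sub by (rule rev_finite_subset)
  show "finite \<rho> \<and> card \<rho> = n - 1" if "\<rho> \<in> boundary_ridges n F" for \<rho>
    using that sub sc by (auto simp: boundary_ridges_def simplicial_complex_def)
  show "faces_of (boundary_ridges n F) \<subseteq> faces_of F"
  proof
    fix \<sigma> assume "\<sigma> \<in> faces_of (boundary_ridges n F)"
    then obtain \<rho> where "\<rho> \<in> boundary_ridges n F" "\<sigma> \<subseteq> \<rho>" by (auto simp: faces_of_def)
    then show "\<sigma> \<in> faces_of F" using sub sc unfolding simplicial_complex_def by blast
  qed
  have "{} \<in> faces_of F" using f by (auto simp: faces_of_def)
  then show "boundary_ridges n F \<noteq> {}"
    using stacked_codim2_face[OF assms(1), of "{}"] assms(2) by (auto simp: boundary_ridges_def)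
qed

lemma star_card_bdy:
  assumes "\<And>\<phi>. \<phi> \<in> H \<Longrightarrow> finite \<phi> \<and> card \<phi> = Suc (card \<rho>)" "finite \<rho>"
  shows "\<rho> \<in> bdy H \<longleftrightarrow> odd (card (star H \<rho>))"
proof -
  have "bij_betw (\<lambda>v. insert v \<rho>) {v. v \<notin> \<rho> \<and> insert v \<rho> \<in> H} (star H \<rho>)"
    unfolding bij_betw_def
  proof
    show "inj_on (\<lambda>v. insert v \<rho>) {v. v \<notin> \<rho> \<and> insert v \<rho> \<in> H}" by (rule inj_onI) auto
    show "(\<lambda>v. insert v \<rho>) ` {v. v \<notin> \<rho> \<and> insert v \<rho> \<in> H} = star H \<rho>"
    proof
      show "star H \<rho> \<subseteq> (\<lambda>v. insert v \<rho>) ` {v. v \<notin> \<rho> \<and> insert v \<rho> \<in> H}"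
      proof
        fix \<phi> assume "\<phi> \<in> star H \<rho>"
        then have \<phi>: "\<phi> \<in> H" "\<rho> \<subseteq> \<phi>" by (auto simp: star_def)
        then have "card (\<phi> - \<rho>) = 1" using assms by (simp add: card_Diff_subset)
        then obtain v where "\<phi> - \<rho> = {v}" by (auto simp: card_1_singleton_iff)
        then have "\<phi> = insert v \<rho>" "v \<notin> \<rho>" using \<phi> by auto
        then show "\<phi> \<in> (\<lambda>v. insert v \<rho>) ` {v. v \<notin> \<rho> \<and> insert v \<rho> \<in> H}" using \<phi> by auto
      qed
    qed (auto simp: star_def)
  qed
  then show ?thesis unfolding bdy_def by (simp add: bij_betw_same_card)
qed

text \<open>Modulo two, the boundary sphere inherits its homology from the acyclic complex, because the
  only faces outside of the boundary are the facets and the inner ridges.\<close>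

lemma stacked_boundary_mod2_sphere:
  assumes "stacked n F" "2 \<le> n"
  shows "mod2_sphere (faces_of (boundary_ridges n F)) (int n - 2)"
proof -
  let ?X = "faces_of F" and ?B = "faces_of (boundary_ridges n F)"
  note f = stacked_facets[OF assms(1)] and r = boundary_ridges_facets[OF assms]
  have X: "simplicial_complex ?X" using f by (auto intro: simplicial_complex_faces_of)
  have B: "simplicial_complex ?B" using r by (auto intro!: simplicial_complex_faces_of)
  have BX: "?B \<subseteq> ?X" by (rule r(5))
  have FL: "F \<subseteq> layer ?X (int n - 1)" using f by (auto simp: layer_def faces_of_def fdim_def)
  have LF: "layer ?X (int n - 1) \<subseteq> F"
  proof
    fix \<sigma> assume "\<sigma> \<in> layer ?X (int n - 1)"
    then obtain \<phi> where \<phi>: "\<phi> \<in> F" "\<sigma> \<subseteq> \<phi>" "card \<sigma> = n" by (auto simp: layer_def faces_of_def fdim_def)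
    then have "\<sigma> = \<phi>" using f by (metis card_subset_eq)
    then show "\<sigma> \<in> F" using \<phi> by simp
  qed
  have par: "\<rho> \<in> bdy H \<longleftrightarrow> odd (card (star H \<rho>))" if "H \<subseteq> F" "Suc (card \<rho>) = n" for H \<rho>
  proof (cases "finite \<rho>")
    case True
    then show ?thesis using that f by (intro star_card_bdy) auto
  next
    case False
    then show ?thesis using that assms(2) by simp
  qed
  have ridgeB: "\<rho> \<in> boundary_ridges n F" if \<rho>: "\<rho> \<in> ?B" "Suc (card \<rho>) = n" for \<rho>
  proof -
    obtain \<rho>' where \<rho>': "\<rho>' \<in> boundary_ridges n F" "\<rho> \<subseteq> \<rho>'" using \<rho>(1) by (auto simp: faces_of_def)
    have "card \<rho> = card \<rho>'" using r(3)[OF \<rho>'(1)] \<rho>(2) by simp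
    then have "\<rho> = \<rho>'" using \<rho>' r(3) by (metis card_subset_eq)
    then show ?thesis using \<rho>' by simp
  qed
  have inner: "inner_ridge n F \<rho> \<longleftrightarrow> \<rho> \<notin> ?B" if \<rho>: "\<rho> \<in> ?X" "Suc (card \<rho>) = n" for \<rho>
  proof -
    have "\<rho> \<in> boundary_ridges n F \<longrightarrow> \<rho> \<in> ?B" by (auto simp: faces_of_def)
    then show ?thesis using \<rho> ridgeB[of \<rho>] by (auto simp: inner_ridge_def boundary_ridges_def)
  qed
  have dimB: "fdim \<sigma> \<le> int n - 2" if \<sigma>: "\<sigma> \<in> ?B" for \<sigma>
  proof -
    obtain \<rho>' where \<rho>': "\<rho>' \<in> boundary_ridges n F" "\<sigma> \<subseteq> \<rho>'" using \<sigma> by (auto simp: faces_of_def)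
    then have "card \<sigma> \<le> n - 1" using r(3) by (metis card_mono)
    then show ?thesis using assms(2) by (simp add: fdim_def)
  qed
  have codim2: "\<sigma> \<in> ?B" if "\<sigma> \<in> ?X" "card \<sigma> + 2 \<le> n" for \<sigma>
    using stacked_codim2_face[OF assms(1) that] by (auto simp: faces_of_def boundary_ridges_def)
  have fF: "finset F" using f by (auto simp: finset_def)
  have lift: "\<exists>T\<subseteq>layer ?X (p + 1). bdy T = S" if "cyc ?B p S" for p S
  proof -
    have "cyc ?X p S" using that BX by (auto simp: cyc_def layer_def)
    then show ?thesis using stacked_mod2_acyclic[OF assms] by (simp add: mod2_acyclic_def bounds_def)
  qed
  have bdyF: "bdy F = boundary_ridges n F"
  proof -
    have "\<rho> \<in> bdy F \<longleftrightarrow> \<rho> \<in> boundary_ridges n F" for \<rho>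
    proof (cases "\<rho> \<in> ?X \<and> Suc (card \<rho>) = n")
      case True
      show ?thesis
      proof (cases "inner_ridge n F \<rho>")
        case i: True
        obtain \<phi> \<psi> where "\<phi> \<noteq> \<psi>" "star F \<rho> = {\<phi>, \<psi>}" using inner_ridge_two[OF assms(1) i] by blast
        then show ?thesis using par[of F \<rho>] True i inner ridgeB by (auto simp: boundary_ridges_def inner_ridge_def)
      next
        case False
        then obtain \<phi> where "star F \<rho> = {\<phi>}" using True by (auto simp: inner_ridge_def)
        then show ?thesis using par[of F \<rho>] True by (auto simp: boundary_ridges_def)
      qed
    next
      case False
      have "\<rho> \<notin> bdy F"
      proof
        assume "\<rho> \<in> bdy F"
        then obtain v where v: "v \<notin> \<rho>" "insert v \<rho> \<in> F" using bdy_coface by metis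
        then have "\<rho> \<in> ?X" "Suc (card \<rho>) = n" using f by (auto simp: faces_of_def)
        then show False using False by simp
      qed
      moreover have "\<rho> \<notin> boundary_ridges n F" using False r(4) by (auto simp: boundary_ridges_def)
      ultimately show ?thesis by simp
    qed
    then show ?thesis by blast
  qed
  \<comment> \<open>A cycle of the boundary bounds a set of facets. That set is even at every inner
    ridge, hence empty or all of \<open>F\<close>.\<close>
  have top: "cyc ?B (int n - 2) S \<longleftrightarrow> S = {} \<or> S = bdy F" for S
  proof
    assume S: "cyc ?B (int n - 2) S"
    then obtain T where T: "T \<subseteq> layer ?X (int n - 1)" "bdy T = S" using lift[OF S] by auto
    then have TF: "T \<subseteq> F" using LF by blast
    have "even (card (star T \<rho>))" if i: "inner_ridge n F \<rho>" for \<rho>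
    proof -
      have i': "\<rho> \<in> ?X" "Suc (card \<rho>) = n" using i by (auto simp: inner_ridge_def)
      then have "\<rho> \<notin> ?B" using inner i by blast
      then have "\<rho> \<notin> S" using S by (auto simp: cyc_def layer_def)
      then show ?thesis using par[OF TF i'(2)] T(2) by blast
    qed
    then have "T = {} \<or> T = F" by (rule stacked_even_parity[OF assms(1) TF])
    then show "S = {} \<or> S = bdy F" using T(2) by auto
  next
    have "boundary_ridges n F \<subseteq> layer ?B (int n - 2)"
      using r(3) assms(2) by (auto simp: layer_def faces_of_def fdim_def)
    then show "S = {} \<or> S = bdy F \<Longrightarrow> cyc ?B (int n - 2) S"
      using bdy_bdy[OF fF] bdyF by (auto simp: cyc_def)
  qed
  have rest: "bounds ?B p S" if p: "p \<noteq> int n - 2" and S: "cyc ?B p S" for p S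
  proof -
    \<comment> \<open>A bounding chain of dimension less than \<open>n - 2\<close> lies in the
      boundary automatically; only \<open>p = n - 3\<close> needs a correction.\<close>
    consider "p > int n - 2" | "p + 1 < int n - 2" | "p + 1 = int n - 2" using p by linarith
    then show ?thesis
    proof cases
      case 1
      then have "layer ?B p = {}" using dimB by (auto simp: layer_def) force
      then show ?thesis using S bounds_empty by (auto simp: cyc_def)
    next
      case 2
      obtain T where T: "T \<subseteq> layer ?X (p + 1)" "bdy T = S" using lift[OF S] by blast
      have "T \<subseteq> layer ?B (p + 1)" using T(1) 2 codim2 by (auto simp: layer_def fdim_def)
      then show ?thesis using T(2) by (auto simp: bounds_def)
    next
      case 3
      obtain T where T: "T \<subseteq> layer ?X (p + 1)" "bdy T = S" using lift[OF S] by blast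
      have fT: "finset T" using finset_layer[OF X T(1)] .
      \<comment> \<open>\<open>T\<close> consists of ridges, some of which may be inner. Adding the
        boundary of \<open>H\<close> removes precisely these and keeps the boundary of
        \<open>T\<close>.\<close>
      obtain H where H: "H \<subseteq> F" "\<And>\<rho>. inner_ridge n F \<rho> \<Longrightarrow> odd (card (star H \<rho>)) \<longleftrightarrow> \<rho> \<in> T"
        using stacked_prescribed_parity[OF assms(1), of T] by blast
      have fH: "finset H" using finset_subset[OF fF H(1)] .
      define T' where "T' = sym_diff T (bdy H)"
      have "bdy T' = S"
        unfolding T'_def using bdy_sym_diff[OF fT bdy_finset[OF fH]] bdy_bdy[OF fH] T(2) by simp
      moreover have "T' \<subseteq> layer ?B (p + 1)"
      proof
        fix \<rho> assume \<rho>: "\<rho> \<in> T'"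
        have "\<rho> \<in> ?X \<and> Suc (card \<rho>) = n"
        proof (cases "\<rho> \<in> T")
          case True
          then show ?thesis using T(1) 3 by (auto simp: layer_def fdim_def)
        next
          case False
          then have "\<rho> \<in> bdy H" using \<rho> by (auto simp: T'_def)
          then obtain v where v: "v \<notin> \<rho>" "insert v \<rho> \<in> H" using bdy_coface by metis
          then have "insert v \<rho> \<in> F" using H(1) by blast
          then show ?thesis using v(1) f by (auto simp: faces_of_def)
        qed
        moreover have "\<not> inner_ridge n F \<rho>"
        proof
          assume i: "inner_ridge n F \<rho>"
          then have "Suc (card \<rho>) = n" by (simp add: inner_ridge_def)
          then have "\<rho> \<in> bdy H \<longleftrightarrow> \<rho> \<in> T" using par[OF H(1)] H(2)[OF i] by blast
          then show False using \<rho> by (auto simp: T'_def)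
        qed
        ultimately show "\<rho> \<in> layer ?B (p + 1)" using inner 3 by (auto simp: layer_def fdim_def)
      qed
      ultimately show ?thesis by (auto simp: bounds_def)
    qed
  qed
  have "layer ?B (int n - 2 + 1) = {}" using dimB by (auto simp: layer_def) force
  moreover have "bdy F \<noteq> {}" using bdyF r(2) by simp
  ultimately show ?thesis unfolding mod2_sphere_def using top rest by blast
qed

lemma empty_face_mod2_sphere: "mod2_sphere ({{}} :: 'a set set) (- 1)"
proof -
  have l: "layer ({{}} :: 'a set set) p = (if p = - 1 then {{}} else {})" for p :: int by (auto simp: layer_def fdim_def)
  have b: "bdy ({{}} :: 'a set set) = {}" by (simp add: bdy_singleton)
  have "cyc ({{}} :: 'a set set) p S \<longleftrightarrow> S = {} \<or> S = {{}} \<and> p = - 1" for p S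
    using b by (auto simp: cyc_def l subset_singleton_iff)
  moreover have "layer ({{}} :: 'a set set) (- 1 + 1) = {}" by (simp add: l)
  ultimately show ?thesis unfolding mod2_sphere_def
    by (intro conjI exI[of _ "{{}}"] allI impI) (auto simp: bounds_empty)
qed

text \<open>Two points form the boundary of the edge between them, which is stacked with
  \<open>n = 2\<close>.\<close>

lemma two_points_mod2_sphere:
  assumes "u \<noteq> w"
  shows "mod2_sphere {{}, {u}, {w}} 0"
proof -
  have st: "stacked 2 {{u, w}}" using assms by (intro stacked.stacked_simplex) auto
  have "boundary_ridges 2 {{u, w}} = {{u}, {w}}"
  proof
    show "boundary_ridges 2 {{u, w}} \<subseteq> {{u}, {w}}"
    proof
      fix \<rho> assume "\<rho> \<in> boundary_ridges 2 {{u, w}}"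
      then obtain \<phi> where \<rho>: "Suc (card \<rho>) = 2" "star {{u, w}} \<rho> = {\<phi>}" unfolding boundary_ridges_def by blast
      have "card \<rho> = 1" using \<rho>(1) by simp
      moreover have "\<rho> \<subseteq> {u, w}" using \<rho>(2) unfolding star_def by blast
      ultimately have "\<rho> = {u} \<or> \<rho> = {w}" by (auto simp: card_1_singleton_iff)
      then show "\<rho> \<in> {{u}, {w}}" by simp
    qed
    have "star {{u, w}} {u} = {{u, w}}" "star {{u, w}} {w} = {{u, w}}" by (auto simp: star_def)
    then show "{{u}, {w}} \<subseteq> boundary_ridges 2 {{u, w}}" by (simp add: boundary_ridges_def)
  qed
  moreover have "faces_of {{u}, {w}} = {{}, {u}, {w}}" by (auto simp: faces_of_def)
  ultimately show ?thesis using stacked_boundary_mod2_sphere[OF st] by simp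
qed

section \<open>The field with two elements on a given type\<close>

text \<open>The elements of the ring must have a prescribed type, so two of its elements serve as
  zero \<open>z\<close> and one \<open>e\<close>.\<close>

definition two_ring :: "'r \<Rightarrow> 'r \<Rightarrow> 'r ring" where
  "two_ring z e = \<lparr>carrier = {z, e}, monoid.mult = (\<lambda>x y. if x = e \<and> y = e then e else z), one = e,
     zero = z, add = (\<lambda>x y. if x = y then z else e)\<rparr>"

context
  fixes z e :: 'r and R :: "'r ring" (structure)
  assumes ze: "z \<noteq> e" and R_def: "R = two_ring z e"
begin

lemma two_ring_simps:
  "carrier R = {z, e}" "\<zero> = z" "\<one> = e" "x \<oplus> y = (if x = y then z else e)"
  "x \<otimes> y = (if x = e \<and> y = e then e else z)"
  by (simp_all add: R_def two_ring_def)

lemma cring_two_ring: "cring R"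
proof (rule cringI)
  show "abelian_group R"
    by (rule abelian_groupI) (use ze in \<open>auto simp: two_ring_simps\<close>)
  show "Group.comm_monoid R"
    by (rule comm_monoidI) (use ze in \<open>auto simp: two_ring_simps\<close>)
qed (use ze in \<open>auto simp: two_ring_simps\<close>)

interpretation cring R by (rule cring_two_ring)

lemma signed_two_ring: "x \<in> carrier R \<Longrightarrow> signed R s x = x"
proof -
  assume x: "x \<in> carrier R"
  have "\<ominus> x = x" by (rule minus_equality) (use x in \<open>auto simp: two_ring_simps\<close>)
  then show ?thesis by (simp add: signed_def)
qed

lemma finsum_two_ring:
  assumes "finite A" "f \<in> A \<rightarrow> carrier R"
  shows "finsum R f A = (if odd (card {v \<in> A. f v = e}) then e else z)"
  using assms
proof induction
  case empty
  then show ?case by (simp add: two_ring_simps)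
next
  case (insert a A)
  have "{v \<in> insert a A. f v = e} = (if f a = e then insert a {v \<in> A. f v = e} else {v \<in> A. f v = e})" by auto
  moreover have "finsum R f (insert a A) = f a \<oplus> finsum R f A" using insert by (intro finsum_insert) auto
  moreover have "f a = e \<or> f a = z" using insert by (auto simp: two_ring_simps)
  ultimately show ?case using insert ze by (auto simp: two_ring_simps)
qed

definition ind :: "'a set set \<Rightarrow> 'a set \<Rightarrow> 'r" where
  "ind S = (\<lambda>\<sigma>. if \<sigma> \<in> S then e else z)"

lemma ind_inject: "ind S = ind T \<longleftrightarrow> S = T"
proof
  assume "ind S = ind T"
  then have "\<sigma> \<in> S \<longleftrightarrow> \<sigma> \<in> T" for \<sigma> using ze unfolding ind_def by metis
  then show "S = T" by blast
qed simp

lemma ind_add: "(\<lambda>\<sigma>. ind S \<sigma> \<oplus> ind T \<sigma>) = ind (sym_diff S T)"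
  using ze by (auto simp: ind_def two_ring_simps)

lemma ind_empty: "(\<lambda>\<sigma>. \<zero>) = ind {}"
  by (simp add: ind_def two_ring_simps)

text \<open>The dictionary between the two descriptions: a chain over two coefficients is the
  indicator function of a set of simplices.\<close>

lemma chains_two_ring: "carrier (chain_module R X p) = ind ` Pow (layer X p)"
proof
  show "carrier (chain_module R X p) \<subseteq> ind ` Pow (layer X p)"
  proof
    fix c assume c: "c \<in> carrier (chain_module R X p)"
    then have "c = ind {\<sigma>. c \<sigma> = e}" "{\<sigma>. c \<sigma> = e} \<subseteq> layer X p"
      using ze unfolding chains_iff ind_def layer_def
      by (auto simp: two_ring_simps fun_eq_iff split: if_splits)
    then show "c \<in> ind ` Pow (layer X p)" by blast
  qed
qed (auto simp: chains_iff ind_def layer_def two_ring_simps)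

lemma boundary_two_ring:
  assumes X: "simplicial_complex X" "S \<subseteq> X"
  shows "chain_boundary_map R X (ind S) = ind (bdy S)"
proof
  fix \<tau>
  have fin: "finset X" using X by (simp add: finset_def simplicial_complex_def)
  show "chain_boundary_map R X (ind S) \<tau> = ind (bdy S) \<tau>"
  proof (cases "\<tau> \<in> X")
    case True
    have c: "ind S \<sigma> \<in> carrier R" for \<sigma> by (simp add: ind_def two_ring_simps)
    have "chain_boundary_map R X (ind S) \<tau> = finsum R (\<lambda>v. ind S (insert v \<tau>)) {v. v \<notin> \<tau> \<and> insert v \<tau> \<in> X}"
      unfolding chain_boundary_map_eq using True c by (simp add: signed_two_ring)
    also have "\<dots> = (if odd (card {v \<in> {v. v \<notin> \<tau> \<and> insert v \<tau> \<in> X}. ind S (insert v \<tau>) = e}) then e else z)"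
      using finite_cofaces[OF fin] c by (intro finsum_two_ring) auto
    also have "{v \<in> {v. v \<notin> \<tau> \<and> insert v \<tau> \<in> X}. ind S (insert v \<tau>) = e} = {v. v \<notin> \<tau> \<and> insert v \<tau> \<in> S}"
      using X(2) ze by (auto simp: ind_def)
    finally show ?thesis by (simp add: ind_def bdy_def)
  next
    case False
    then have "insert v \<tau> \<notin> S" for v using X unfolding simplicial_complex_def by blast
    then have "\<tau> \<notin> bdy S" by (simp add: bdy_def)
    then show ?thesis using False by (simp add: chain_boundary_map_eq ind_def two_ring_simps)
  qed
qed

lemma boundary_chains_two_ring:
  assumes "simplicial_complex X"
  shows "boundary_chains R X p = ind ` {S. bounds X p S}"
proof -
  have "chain_boundary_map R X (ind T) = ind (bdy T)" if "T \<subseteq> layer X (p + 1)" for T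
    using that by (intro boundary_two_ring[OF assms]) (auto simp: layer_def)
  then show ?thesis unfolding boundary_chains_def chains_two_ring bounds_def
    by (auto simp: image_iff)
qed

lemma carrier_homology_two_ring:
  assumes "simplicial_complex X"
  shows "carrier (reduced_homology R X p) = (\<lambda>S. ind ` {sym_diff U S | U. bounds X p U}) ` {S. cyc X p S}"
proof -
  have 1: "{(\<lambda>\<sigma>. b \<sigma> \<oplus> ind S \<sigma>) | b. b \<in> boundary_chains R X p} = ind ` {sym_diff U S | U. bounds X p U}" for S
    unfolding boundary_chains_two_ring[OF assms] using ind_add by (auto simp: image_iff) metis+
  have 2: "c \<in> carrier (chain_module R X p) \<and> chain_boundary_map R X c = (\<lambda>\<tau>. \<zero>) \<longleftrightarrow> c \<in> ind ` {S. cyc X p S}" for c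
  proof -
    have "chain_boundary_map R X (ind S) = (\<lambda>\<tau>. \<zero>) \<longleftrightarrow> bdy S = {}" if "S \<subseteq> layer X p" for S
    proof -
      have "S \<subseteq> X" using that by (auto simp: layer_def)
      then show ?thesis using boundary_two_ring[OF assms, of S] ind_inject[of "bdy S" "{}"] by (simp add: ind_empty)
    qed
    then show ?thesis unfolding chains_two_ring cyc_def by (auto simp: image_iff)
  qed
  define G where "G c = {(\<lambda>\<sigma>. b \<sigma> \<oplus> c \<sigma>) | b. b \<in> boundary_chains R X p}" for c
  have "carrier (reduced_homology R X p) = {G c | c. c \<in> ind ` {S. cyc X p S}}"
    unfolding carrier_reduced_homology(1) 2 G_def ..
  also have "\<dots> = (\<lambda>S. G (ind S)) ` {S. cyc X p S}" by auto
  finally show ?thesis unfolding G_def 1 .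
qed

text \<open>Adding a boundary \<open>S\<close> permutes the boundaries, so every cycle has the zero
  coset.\<close>

lemma homology_vanishes_two_ring:
  assumes X: "simplicial_complex X" and b: "\<And>S. cyc X p S \<Longrightarrow> bounds X p S"
  shows "homology_vanishes R X p"
proof -
  have "{sym_diff U S | U. bounds X p U} = {U. bounds X p U}" if S: "cyc X p S" for S
  proof -
    obtain T where T: "T \<subseteq> layer X (p + 1)" "bdy T = S" using b[OF S] by (auto simp: bounds_def)
    have *: "bounds X p (sym_diff U S)" if U: "bounds X p U" for U
    proof -
      obtain V where V: "V \<subseteq> layer X (p + 1)" "bdy V = U" using U by (auto simp: bounds_def)
      have "bdy (sym_diff V T) = sym_diff U S"
        using bdy_sym_diff[OF finset_layer[OF X V(1)] finset_layer[OF X T(1)]] V(2) T(2) by simp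
      moreover have "sym_diff V T \<subseteq> layer X (p + 1)" using V(1) T(1) by auto
      ultimately show ?thesis unfolding bounds_def by blast
    qed
    moreover have "U = sym_diff (sym_diff U S) S" for U by auto
    ultimately show ?thesis by blast
  qed
  moreover have "cyc X p {}" by (simp add: cyc_def)
  ultimately have "carrier (reduced_homology R X p) = {ind ` {U. bounds X p U}}"
    unfolding carrier_homology_two_ring[OF X] by auto
  then show ?thesis
    unfolding homology_vanishes_def carrier_reduced_homology(2) boundary_chains_two_ring[OF X] .
qed

lemma acyclic_two_ring: "simplicial_complex X \<Longrightarrow> mod2_acyclic X \<Longrightarrow> acyclic_complex R X"
  unfolding acyclic_complex_def mod2_acyclic_def using homology_vanishes_two_ring by blast

text \<open>Only the empty set bounds in degree \<open>m\<close>, so the cosets are singletons, one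
  for 0 and one for the fundamental cycle; the isomorphism sends them to \<open>z\<close> and
  \<open>e\<close>.\<close>

lemma sphere_two_ring:
  fixes X :: "'a set set"
  assumes X: "simplicial_complex X" and sph: "mod2_sphere X m"
  shows "has_homology_of_sphere R X m"
proof -
  let ?H = "reduced_homology R X m"
  obtain C where C: "C \<noteq> {}" "\<And>S. cyc X m S \<longleftrightarrow> S = {} \<or> S = C" and top: "layer X (m + 1) = {}"
    and rest: "\<And>p S. p \<noteq> m \<Longrightarrow> cyc X p S \<Longrightarrow> bounds X p S"
    using sph unfolding mod2_sphere_def by metis
  have bd: "bounds X m U \<longleftrightarrow> U = {}" for U using top by (auto simp: bounds_def)
  have "{S. cyc X m S} = {{}, C}" using C by auto
  then have carr: "carrier ?H = {{ind {}}, {ind C}}"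
    unfolding carrier_homology_two_ring[OF X] bd by auto
  have ne: "ind {} \<noteq> ind C" using C(1) ind_inject by blast
  define f where "f K = (if K = {ind {}} then z else e)" for K :: "('a set \<Rightarrow> 'r) set"
  have f: "f {ind {}} = z" "f {ind C} = e" using ne by (auto simp: f_def)
  have addH: "{ind S} \<oplus>\<^bsub>?H\<^esub> {ind T} = {ind (sym_diff S T)}" for S T
    by (simp add: reduced_homology_def Let_def set_add_def set_mult_def cycle_module_def chain_module_def ind_add)
  have smultH: "r \<odot>\<^bsub>?H\<^esub> {ind S} = {(\<lambda>\<sigma>. ind {} \<sigma> \<oplus> r \<otimes> ind S \<sigma>)}" for r S
  proof -
    have "boundary_chains R X m = {ind {}}" unfolding boundary_chains_two_ring[OF X] bd by auto
    then show ?thesis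
      by (simp add: reduced_homology_def Let_def a_r_coset_def r_coset_def cycle_module_def chain_module_def)
  qed
  have sm: "(\<lambda>\<sigma>. ind {} \<sigma> \<oplus> r \<otimes> ind S \<sigma>) = ind (if r = e then S else {})" if "r \<in> carrier R" for r S
    using that ze by (auto simp: ind_def two_ring_simps fun_eq_iff)
  have smult: "r \<odot>\<^bsub>?H\<^esub> {ind S} = {ind (if r = e then S else {})}" if "r \<in> carrier R" for r S
    unfolding smultH sm[OF that] ..
  have "f \<in> iso (add_monoid ?H) (add_monoid (self_module R))"
  proof (rule isoI)
    show "f \<in> hom (add_monoid ?H) (add_monoid (self_module R))"
    proof (rule homI)
      show "f x \<in> carrier (add_monoid (self_module R))" for x
        by (simp add: f_def self_module_def two_ring_simps)
      fix x y assume "x \<in> carrier (add_monoid ?H)" "y \<in> carrier (add_monoid ?H)"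
      then show "f (x \<otimes>\<^bsub>add_monoid ?H\<^esub> y) = f x \<otimes>\<^bsub>add_monoid (self_module R)\<^esub> f y"
        using carr ze by (auto simp: addH f self_module_def two_ring_simps)
    qed
    show "bij_betw f (carrier (add_monoid ?H)) (carrier (add_monoid (self_module R)))"
      using carr ze f by (auto simp: bij_betw_def inj_on_def self_module_def two_ring_simps)
  qed
  moreover have "f (r \<odot>\<^bsub>?H\<^esub> x) = r \<odot>\<^bsub>self_module R\<^esub> f x" if "r \<in> carrier R" "x \<in> carrier ?H" for r x
  proof -
    have "r = z \<or> r = e" using that(1) by (simp add: two_ring_simps)
    moreover have "x = {ind {}} \<or> x = {ind C}" using that(2) carr by auto
    ultimately show ?thesis using smult[OF that(1)] f ze
      by (elim disjE) (simp_all add: self_module_def two_ring_simps)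
  qed
  ultimately have "module_isomorphic R ?H (self_module R)" unfolding module_isomorphic_def by blast
  then show ?thesis unfolding has_homology_of_sphere_def using homology_vanishes_two_ring[OF X] rest by blast
qed

end

lemma sphere_not_acyclic:
  fixes R :: "('r, 'q) ring_scheme" (structure)
  assumes "cring R" "\<one> \<noteq> \<zero>" "has_homology_of_sphere R X m"
  shows "\<not> acyclic_complex R X"
proof
  interpret cring R by fact
  assume "acyclic_complex R X"
  then have "carrier (reduced_homology R X m) = {\<zero>\<^bsub>reduced_homology R X m\<^esub>}"
    by (simp add: acyclic_complex_def homology_vanishes_def)
  moreover obtain f where "f \<in> iso (add_monoid (reduced_homology R X m)) (add_monoid (self_module R))"
    using assms(3) by (auto simp: has_homology_of_sphere_def module_isomorphic_def)
  then have "f ` carrier (reduced_homology R X m) = carrier R" by (simp add: iso_def bij_betw_def self_module_def)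
  ultimately have "carrier R = {f \<zero>\<^bsub>reduced_homology R X m\<^esub>}" by simp
  then show False using assms(2) zero_closed one_closed by auto
qed

section \<open>The equivalence\<close>

text \<open>These are the links of ridges. For \<open>n = 1\<close> only the empty ridge is
  available, and uniqueness of the neighbour allows a single gluing.\<close>

lemma stacked_1_cases:
  assumes "stacked 1 F"
  shows "(\<exists>v. F = {{v}}) \<or> (\<exists>u w. u \<noteq> w \<and> F = {{u}, {w}})"
  using assms
proof cases
  case (stacked_simplex \<phi>)
  then show ?thesis by (auto simp: card_1_singleton_iff)
next
  case (stacked_step G \<psi> \<alpha> b)
  note f = stacked_facets[OF stacked_step(2)]
  have "finite \<alpha>" using f stacked_step(3,4) finite_subset by blast
  then have "\<alpha> = {}" using stacked_step(5) by simp
  then have "G = {\<psi>}" using stacked_step(3,6) by blast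
  moreover obtain c where "\<psi> = {c}" using f stacked_step(3) by (auto simp: card_1_singleton_iff)
  ultimately show ?thesis using stacked_step(1,7) \<open>\<alpha> = {}\<close>
    by (intro disjI2 exI[of _ b] exI[of _ c]) auto
qed

text \<open>Removing \<sigma> from a ridge that contains it does not change the number of facets
  over it. Thus links in the boundary sphere are again boundaries of stacked complexes, to which the
  sphere result applies.\<close>

lemma link_boundary:
  assumes "\<sigma> \<in> faces_of (boundary_ridges n F)" and fin: "\<And>\<phi>. \<phi> \<in> F \<Longrightarrow> finite \<phi>"
  shows "link (faces_of (boundary_ridges n F)) \<sigma> =
    faces_of (boundary_ridges (n - card \<sigma>) ((\<lambda>\<phi>. \<phi> - \<sigma>) ` star F \<sigma>))"
proof -
  let ?F' = "(\<lambda>\<phi>. \<phi> - \<sigma>) ` star F \<sigma>"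
  have "(\<lambda>\<rho>. \<rho> - \<sigma>) ` star (boundary_ridges n F) \<sigma> = boundary_ridges (n - card \<sigma>) ?F'"
  proof
    show "(\<lambda>\<rho>. \<rho> - \<sigma>) ` star (boundary_ridges n F) \<sigma> \<subseteq> boundary_ridges (n - card \<sigma>) ?F'"
    proof
      fix \<rho>' assume "\<rho>' \<in> (\<lambda>\<rho>. \<rho> - \<sigma>) ` star (boundary_ridges n F) \<sigma>"
      then obtain \<rho> where \<rho>0: "\<rho>' = \<rho> - \<sigma>" "\<sigma> \<subseteq> \<rho>" "\<rho> \<in> boundary_ridges n F"
        unfolding star_def[of "boundary_ridges n F"] by blast
      then obtain \<phi> where \<rho>: "\<rho>' = \<rho> - \<sigma>" "\<sigma> \<subseteq> \<rho>" "Suc (card \<rho>) = n" "star F \<rho> = {\<phi>}"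
        unfolding boundary_ridges_def by blast
      have \<phi>: "\<phi> \<in> F" "\<rho> \<subseteq> \<phi>" using \<rho>(4) by (auto simp: star_def)
      then have fr: "finite \<rho>" using fin finite_subset by blast
      then have "card \<sigma> \<le> card \<rho>" "card (\<rho> - \<sigma>) = card \<rho> - card \<sigma>"
        using \<rho>(2) by (auto simp: card_mono card_Diff_subset finite_subset)
      then have "Suc (card \<rho>') = n - card \<sigma>" using \<rho> by simp
      moreover have "star ?F' \<rho>' = (\<lambda>\<phi>. \<phi> - \<sigma>) ` star F \<rho>" using \<rho>(1,2) unfolding star_def by blast
      ultimately show "\<rho>' \<in> boundary_ridges (n - card \<sigma>) ?F'" using \<rho>(4) by (simp add: boundary_ridges_def)
    qed
    show "boundary_ridges (n - card \<sigma>) ?F' \<subseteq> (\<lambda>\<rho>. \<rho> - \<sigma>) ` star (boundary_ridges n F) \<sigma>"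
    proof
      fix \<rho>' assume "\<rho>' \<in> boundary_ridges (n - card \<sigma>) ?F'"
      then obtain \<phi>' where r: "Suc (card \<rho>') = n - card \<sigma>" "star ?F' \<rho>' = {\<phi>'}" by (auto simp: boundary_ridges_def)
      have \<phi>': "\<phi>' \<in> ?F'" "\<rho>' \<subseteq> \<phi>'" using r(2) by (auto simp: star_def[of ?F'])
      obtain \<phi> where "\<phi> \<in> star F \<sigma>" "\<phi>' = \<phi> - \<sigma>" using \<phi>'(1) by (elim imageE)
      then have \<phi>: "\<phi> \<in> F" "\<sigma> \<subseteq> \<phi>" "\<phi>' = \<phi> - \<sigma>" "\<rho>' \<subseteq> \<phi> - \<sigma>" using \<phi>'(2) by (auto simp: star_def)
      have f: "finite \<rho>'" "finite \<sigma>" "\<rho>' \<inter> \<sigma> = {}" using \<phi> fin[OF \<phi>(1)] by (auto intro: finite_subset)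
      have "card (\<rho>' \<union> \<sigma>) = card \<rho>' + card \<sigma>" using f by (simp add: card_Un_disjoint)
      then have "Suc (card (\<rho>' \<union> \<sigma>)) = n" using r(1) by simp
      moreover have "star F (\<rho>' \<union> \<sigma>) = {\<phi>}"
      proof
        show "{\<phi>} \<subseteq> star F (\<rho>' \<union> \<sigma>)" using \<phi> by (auto simp: star_def)
        show "star F (\<rho>' \<union> \<sigma>) \<subseteq> {\<phi>}"
        proof
          fix \<omega> assume "\<omega> \<in> star F (\<rho>' \<union> \<sigma>)"
          then have \<omega>: "\<omega> \<in> F" "\<sigma> \<subseteq> \<omega>" "\<rho>' \<subseteq> \<omega>" by (auto simp: star_def)
          then have "\<omega> - \<sigma> \<in> star ?F' \<rho>'" using f(3) by (auto simp: star_def)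
          then have "\<omega> - \<sigma> = \<phi> - \<sigma>" unfolding r(2) \<phi>(3) by (rule singletonD)
          then show "\<omega> \<in> {\<phi>}" using \<omega>(2) \<phi>(2) by blast
        qed
      qed
      ultimately have "\<rho>' \<union> \<sigma> \<in> boundary_ridges n F" by (simp add: boundary_ridges_def)
      then have "\<rho>' \<union> \<sigma> \<in> star (boundary_ridges n F) \<sigma>" unfolding star_def[of "boundary_ridges n F"] by blast
      moreover have "\<rho>' = (\<rho>' \<union> \<sigma>) - \<sigma>" using f(3) by auto
      ultimately show "\<rho>' \<in> (\<lambda>\<rho>. \<rho> - \<sigma>) ` star (boundary_ridges n F) \<sigma>" by blast
    qed
  qed
  then show ?thesis by (simp add: link_faces_of)
qed

text \<open>The codimension decides the link: \<open>{{}}\<close> for a facet, one or two points for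
  a ridge, and in higher codimension a stacked complex with at least two vertices per facet, which
  is acyclic. Acyclic links therefore occur exactly on the faces of boundary ridges.\<close>

lemma stacked_imp_stacked_homology_ball:
  fixes F :: "'a set set" and R :: "'r ring" (structure)
  assumes st: "stacked n F" "2 \<le> n" and ze: "z \<noteq> e" and R: "R = two_ring z e"
  shows "stacked_homology_ball R (int n - 1) 1 (faces_of F)"
proof -
  let ?X = "faces_of F" and ?B = "faces_of (boundary_ridges n F)"
  define F' where "F' \<sigma> = (\<lambda>\<phi>. \<phi> - \<sigma>) ` star F \<sigma>" for \<sigma>
  note f = stacked_facets[OF st(1)] and r = boundary_ridges_facets[OF st]
  have cr: "cring R" by (rule cring_two_ring[OF ze R])
  have ne: "\<one> \<noteq> \<zero>" using ze by (simp add: two_ring_simps[OF ze R])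
  have X: "simplicial_complex ?X" using f by (auto intro: simplicial_complex_faces_of)
  have B: "simplicial_complex ?B" using r by (auto intro!: simplicial_complex_faces_of)
  have BX: "?B \<subseteq> ?X" by (rule r(5))
  have codim2: "\<sigma> \<in> ?B" if "\<sigma> \<in> ?X" "card \<sigma> + 2 \<le> n" for \<sigma>
    using stacked_codim2_face[OF st(1) that] by (auto simp: faces_of_def boundary_ridges_def)
  have le: "card \<sigma> \<le> n" if s: "\<sigma> \<in> ?X" for \<sigma>
  proof -
    obtain \<phi> where "\<phi> \<in> F" "\<sigma> \<subseteq> \<phi>" using s by (auto simp: faces_of_def)
    then show ?thesis using f by (metis card_mono)
  qed
  have stl: "stacked (n - card \<sigma>) (F' \<sigma>)" if "\<sigma> \<in> ?X" for \<sigma>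
    unfolding F'_def by (rule stacked_link[OF st(1) that])
  have link: "link ?X \<sigma> = faces_of (F' \<sigma>)" for \<sigma> unfolding F'_def by (rule link_faces_of)
  have linkX: "simplicial_complex (link ?X \<sigma>)" if "\<sigma> \<in> ?X" for \<sigma>
    unfolding link using stacked_facets[OF stl[OF that]] by (auto intro: simplicial_complex_faces_of)
  have acyc2: "acyclic_complex R (link ?X \<sigma>)" if "\<sigma> \<in> ?X" "card \<sigma> + 2 \<le> n" for \<sigma>
  proof (rule acyclic_two_ring[OF ze R linkX[OF that(1)]])
    have "2 \<le> n - card \<sigma>" using that(2) by simp
    then show "mod2_acyclic (link ?X \<sigma>)" unfolding link using stacked_mod2_acyclic stl[OF that(1)] by blast
  qed
  have facet: "has_homology_of_sphere R (link ?X \<sigma>) (- 1) \<and> \<sigma> \<notin> ?B" if s: "\<sigma> \<in> ?X" "card \<sigma> = n" for \<sigma>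
  proof
    have st0: "stacked 0 (F' \<sigma>)" using stl[OF s(1)] s(2) by simp
    have "F' \<sigma> = {{}}" using stacked_facets[OF st0] by auto
    then have l: "link ?X \<sigma> = {{}}" unfolding link by (auto simp: faces_of_def)
    show "has_homology_of_sphere R (link ?X \<sigma>) (- 1)"
      using sphere_two_ring[OF ze R linkX[OF s(1)]] empty_face_mod2_sphere unfolding l by blast
    show "\<sigma> \<notin> ?B"
    proof
      assume "\<sigma> \<in> ?B"
      then obtain \<rho> where \<rho>: "\<rho> \<in> boundary_ridges n F" "\<sigma> \<subseteq> \<rho>" by (auto simp: faces_of_def)
      have "card \<sigma> \<le> n - 1" using card_mono[of \<rho> \<sigma>] r(3)[OF \<rho>(1)] \<rho>(2) by simp
      then show False using s(2) st(2) by linarith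
    qed
  qed
  have ridge: "has_homology_of_sphere R (link ?X \<sigma>) 0 \<and> \<sigma> \<notin> ?B \<or> acyclic_complex R (link ?X \<sigma>) \<and> \<sigma> \<in> ?B"
    if s: "\<sigma> \<in> ?X" "Suc (card \<sigma>) = n" for \<sigma>
  proof -
    have star: "star F \<sigma> = (\<lambda>\<phi>. \<phi> \<union> \<sigma>) ` F' \<sigma>" unfolding F'_def star_def by (auto simp: image_iff Un_absorb2)
    have "n - card \<sigma> = 1" using s(2) by simp
    then have "stacked 1 (F' \<sigma>)" using stl[OF s(1)] by simp
    from stacked_1_cases[OF this] show ?thesis
    proof (elim disjE exE conjE)
      fix v assume v: "F' \<sigma> = {{v}}"
      have l: "link ?X \<sigma> = Pow {v}" unfolding link v by (auto simp: faces_of_def)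
      have "mod2_acyclic (Pow {v})"
        unfolding mod2_acyclic_def using cyc_cone[of "Pow {v}" _ _ v] linkX[OF s(1)] l by auto
      then have "acyclic_complex R (link ?X \<sigma>)" using acyclic_two_ring[OF ze R linkX[OF s(1)]] l by simp
      moreover have "star F \<sigma> = {{v} \<union> \<sigma>}" unfolding star v by simp
      then have "\<sigma> \<in> ?B" using s(2) by (auto simp: boundary_ridges_def faces_of_def)
      ultimately show ?thesis by simp
    next
      fix u w assume uw: "u \<noteq> w" "F' \<sigma> = {{u}, {w}}"
      have l: "link ?X \<sigma> = {{}, {u}, {w}}" unfolding link uw(2) by (auto simp: faces_of_def)
      have "has_homology_of_sphere R (link ?X \<sigma>) 0"
        using sphere_two_ring[OF ze R linkX[OF s(1)]] two_points_mod2_sphere[OF uw(1)] unfolding l by blast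
      moreover have "\<sigma> \<notin> ?B"
      proof
        assume "\<sigma> \<in> ?B"
        then obtain \<rho> \<phi> where \<rho>: "\<rho> \<in> boundary_ridges n F" "\<sigma> \<subseteq> \<rho>" "star F \<rho> = {\<phi>}"
          by (auto simp: faces_of_def boundary_ridges_def)
        then have "\<sigma> = \<rho>" using r(3)[OF \<rho>(1)] s(2) by (intro card_subset_eq) auto
        then have "F' \<sigma> = {\<phi> - \<sigma>}" unfolding F'_def using \<rho>(3) by simp
        then have "{{u}, {w}} = {\<phi> - \<sigma>}" unfolding uw(2) .
        then have "{u} = {w}" by (metis insertCI singletonD)
        then show False using uw(1) by simp
      qed
      ultimately show ?thesis by simp
    qed
  qed
  have bd: "homology_boundary R ?X = ?B"
  proof -
    have "acyclic_complex R (link ?X \<sigma>) \<longleftrightarrow> \<sigma> \<in> ?B" if s: "\<sigma> \<in> ?X" for \<sigma>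
    proof -
      consider "card \<sigma> + 2 \<le> n" | "Suc (card \<sigma>) = n" | "card \<sigma> = n" using le[OF s] by linarith
      then show ?thesis
      proof cases
        case 1
        then show ?thesis using acyc2[OF s] codim2[OF s] by simp
      next
        case 2
        then show ?thesis using ridge[OF s 2] sphere_not_acyclic[OF cr ne] by blast
      next
        case 3
        then show ?thesis using facet[OF s 3] sphere_not_acyclic[OF cr ne] by blast
      qed
    qed
    then show ?thesis using BX by (auto simp: homology_boundary_def)
  qed
  have links: "has_homology_of_sphere R (link ?X \<sigma>) (int n - 1 - fdim \<sigma> - 1) \<or> acyclic_complex R (link ?X \<sigma>)"
    if s: "\<sigma> \<in> ?X" for \<sigma>
  proof -
    consider "card \<sigma> + 2 \<le> n" | "Suc (card \<sigma>) = n" | "card \<sigma> = n" using le[OF s] by linarith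
    then show ?thesis
    proof cases
      case 1
      then show ?thesis using acyc2[OF s] by simp
    next
      case 2
      then have "int n - 1 - fdim \<sigma> - 1 = 0" by (auto simp: fdim_def)
      then show ?thesis using ridge[OF s 2] by auto
    next
      case 3
      then have "int n - 1 - fdim \<sigma> - 1 = - 1" by (simp add: fdim_def)
      then show ?thesis using facet[OF s 3] by simp
    qed
  qed
  have "homology_sphere R (int n - 1 - 1) ?B"
    unfolding homology_sphere_def
  proof (intro conjI ballI)
    show "simplicial_complex ?B" by (rule B)
    show "cdim ?B = int n - 1 - 1" using cdim_faces_of[of "boundary_ridges n F" "n - 1"] r st(2) by simp
    fix \<sigma> assume s: "\<sigma> \<in> ?B"
    then have sX: "\<sigma> \<in> ?X" using BX by blast
    have l: "link ?B \<sigma> = faces_of (boundary_ridges (n - card \<sigma>) (F' \<sigma>))"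
      unfolding F'_def using f by (intro link_boundary[OF s]) auto
    consider "card \<sigma> + 2 \<le> n" | "Suc (card \<sigma>) = n" | "card \<sigma> = n" using le[OF sX] by linarith
    then show "has_homology_of_sphere R (link ?B \<sigma>) (int n - 1 - 1 - fdim \<sigma> - 1)"
    proof cases
      case 1
      then have n': "2 \<le> n - card \<sigma>" by simp
      note r' = boundary_ridges_facets[OF stl[OF sX] n']
      have "simplicial_complex (link ?B \<sigma>)"
        unfolding l by (rule simplicial_complex_faces_of[OF r'(1,2)]) (use r'(3) in blast)
      moreover have "mod2_sphere (link ?B \<sigma>) (int (n - card \<sigma>) - 2)"
        unfolding l by (rule stacked_boundary_mod2_sphere[OF stl[OF sX] n'])
      moreover have "int (n - card \<sigma>) - 2 = int n - 1 - 1 - fdim \<sigma> - 1" using 1 by (simp add: fdim_def)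
      ultimately show ?thesis using sphere_two_ring[OF ze R] by metis
    next
      case 2
      \<comment> \<open>Here \<sigma> is a boundary ridge, that is, a facet of the boundary sphere,
        and its link is the sphere of dimension -1.\<close>
      have "link ?B \<sigma> = {{}}"
      proof
        show "{{}} \<subseteq> link ?B \<sigma>" using s by (simp add: link_def)
        show "link ?B \<sigma> \<subseteq> {{}}"
        proof
          fix \<tau> assume \<tau>: "\<tau> \<in> link ?B \<sigma>"
          then obtain \<rho> where \<rho>: "\<rho> \<in> boundary_ridges n F" "\<tau> \<union> \<sigma> \<subseteq> \<rho>" "\<tau> \<inter> \<sigma> = {}"
            by (auto simp: faces_of_def link_def)
          then have "\<sigma> = \<rho>" using r(3)[OF \<rho>(1)] 2 by (intro card_subset_eq) auto
          then show "\<tau> \<in> {{}}" using \<rho> by auto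
        qed
      qed
      moreover have "simplicial_complex {{}}" by (simp add: simplicial_complex_def)
      moreover have "int n - 1 - 1 - fdim \<sigma> - 1 = - 1" using 2 by (auto simp: fdim_def)
      ultimately show ?thesis using sphere_two_ring[OF ze R _ empty_face_mod2_sphere] by simp
    next
      case 3
      then show ?thesis using facet[OF sX 3] s by simp
    qed
  qed
  moreover have "acyclic_complex R ?X"
  proof -
    have "{} \<in> ?X" using f by (auto simp: faces_of_def)
    moreover have "link ?X {} = ?X" by (auto simp: link_def)
    ultimately show ?thesis using acyc2[of "{}"] st(2) by simp
  qed
  moreover have "cdim ?X = int n - 1" using f by (intro cdim_faces_of) auto
  ultimately have "homology_ball R (int n - 1) ?X" unfolding homology_ball_def bd using X links by auto
  moreover have "stacked_wrt (int n - 1) 1 (homology_boundary R ?X) ?X"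
    unfolding bd stacked_wrt_def using codim2 by (auto simp: fdim_def)
  ultimately show ?thesis by (simp add: stacked_homology_ball_def)
qed

text \<open>Over a type with a single element no ring satisfies
  \<open>\<one> \<noteq> \<zero>\<close>, which would make the third condition false for every
  complex; \<open>nontrivial_type\<close> excludes this.\<close>

theorem theorem2p14:
  fixes X :: "'a set set" and d :: int
  assumes "normal_pseudomanifold d X"
    and "d \<ge> 1"
    and nontrivial_type: "\<exists>a b :: 'r. a \<noteq> b"
  shows "(shelled_ball d 1 X \<longleftrightarrow> stacked_triangulated_ball d 1 X) \<and>
    (stacked_triangulated_ball d 1 X \<longleftrightarrow>
       (\<exists>R :: 'r ring. cring R \<and> \<one>\<^bsub>R\<^esub> \<noteq> \<zero>\<^bsub>R\<^esub> \<and> stacked_homology_ball R d 1 X)) \<and>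
    ((\<exists>R :: 'r ring. cring R \<and> \<one>\<^bsub>R\<^esub> \<noteq> \<zero>\<^bsub>R\<^esub> \<and> stacked_homology_ball R d 1 X) \<longleftrightarrow>
       undirected_tree (with_proj (dual_graph d X)))"
proof -
  define n where "n = nat (d + 1)"
  have n: "2 \<le> n" and d: "d = int n - 1" using assms(2) by (auto simp: n_def)
  have wp: "weak_pseudomanifold d X" using assms(1) by (simp add: normal_pseudomanifold_def)
  then have "pure_complex d X" by (simp add: weak_pseudomanifold_def)
  then have X: "faces_of (facets X) = X" by (rule pure_complex_facets)
  have shelled: "shelled_ball d 1 X \<longleftrightarrow> stacked n (facets X)"
  proof
    assume "shelled_ball d 1 X"
    then show "stacked n (facets X)"
      using shelled_imp_stacked[of d X] wp assms(2) by (simp add: shelled_ball_def weak_pseudomanifold_def n_def)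
  next
    assume "stacked n (facets X)"
    then have "obtained_by_shelling d 1 X" using stacked_imp_shelled[of n "facets X"] X d by simp
    then show "shelled_ball d 1 X"
      using wp assms(2) normal_dual_graph_connected[OF assms(1,2)] by (simp add: shelled_ball_def pseudomanifold_def)
  qed
  have tree: "stacked n (facets X)" if "undirected_tree (with_proj (dual_graph d X))"
    using normal_tree_imp_stacked[OF assms(1,2) that] by (simp add: n_def)
  have tri: "stacked_triangulated_ball d 1 X" if "stacked n (facets X)"
    using stacked_imp_stacked_triangulated_ball[OF that n] X d by simp
  have hom: "\<exists>R :: 'r ring. cring R \<and> \<one>\<^bsub>R\<^esub> \<noteq> \<zero>\<^bsub>R\<^esub> \<and> stacked_homology_ball R d 1 X" if "stacked n (facets X)"
  proof -
    obtain z e :: 'r where ze: "z \<noteq> e" using nontrivial_type by blast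
    have "stacked_homology_ball (two_ring z e) d 1 X"
      using stacked_imp_stacked_homology_ball[OF that n ze refl] X d by simp
    moreover have "\<one>\<^bsub>two_ring z e\<^esub> \<noteq> \<zero>\<^bsub>two_ring z e\<^esub>" using ze by (simp add: two_ring_def)
    ultimately show ?thesis using cring_two_ring[OF ze refl] by blast
  qed
  show ?thesis
    using shelled tree tri hom stacked_triangulated_ball_imp_tree[OF assms(1,2)]
      stacked_homology_ball_imp_tree[OF assms(1,2)] by blast
qed

end
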